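(* There exists a complete CAT(0) space $X$ such that (a) the natural map $\nu:\partial_{\mathrm{I}}X\to\partial_{\mathrm{G}}X$ is neither injective nor surjective; (b) the natural map $\phi:\partial_{\mathrm{G}}X\to\partial_{\mathrm{E}}X$ is neither injective nor surjective; (c) the natural map $\epsilon:\partial_{\mathrm{I}}X\to\partial_{\mathrm{E}}X$ is neither injective nor surjective. Moreover, there exists an unbounded complete CAT(0) space $Y$ such that $\partial_{\mathrm{I}}Y$, $\partial_{\mathrm{G}}Y$ and $\partial_{\mathrm{E}}Y$ are all empty.
   Context: Let $(X,d)$ be a metric space and fix a basepoint $o\in X$. All the notions below are independent of $o$ up to natural identification. $\mathbb{N}=\{1,2,\dots\}$. Ideal boundary: a (unit speed) geodesic ray is a map $\gamma:[0,\infty)\to X$ with $d(\gamma(s),\gamma(t))=|s-t|$ for all $s,t\ge 0$. Two geodesic rays $\gamma_1,\gamma_2$ are equivalent if $d(\gamma_1(t),\gamma_2(t))$ is uniformly bounded for $t\ge 0$. The ideal boundary $\partial_{\mathrm{I}}X$ is the set of equivalence classes of geodesic rays in $X$. If $X$ is complete CAT(0), it is identified with the set of unit speed geodesic rays starting at $o$ (each class contains exactly one such ray). Gromov boundary: the Gromov product is $\langle x,y\rangle_w=\frac12\left(d(x,w)+d(y,w)-d(x,y)\right)$. A Gromov sequence is a sequence $(x_n)$ in $X$ with $\langle x_m,x_n\rangle_o\to\infty$ as $m,n\to\infty$. For Gromov sequences $x=(x_n)$, $y=(y_n)$ write $(x,y)\in E$ if $\langle x_m,y_n\rangle_o\to\infty$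 as $m,n\to\infty$. Let $\sim$ be the transitive closure of the reflexive symmetric relation $E$. The Gromov boundary $\partial_{\mathrm{G}}X$ is the set of $\sim$-equivalence classes of Gromov sequences in $X$. ($X$ is not required to be Gromov hyperbolic.) End boundary: for $n\in\mathbb{N}$ let $\bar B_n=\overline{B(o,n)}$ (not required to be compact). An end of $X$ is a sequence $(U_n)_{n\in\mathbb{N}}$ where each $U_n$ is a connected component of $X\setminus\bar B_n$ and $U_{n+1}\subset U_n$ for all $n$. The end boundary $\partial_{\mathrm{E}}X$ is the set of ends of $X$. Natural maps, for $X$ complete CAT(0) (all are well defined): $\nu:\partial_{\mathrm{I}}X\to\partial_{\mathrm{G}}X$ sends the class of a unit speed geodesic ray $\lambda$ to the class of the Gromov sequence $(\lambda(t_n))$, where $(t_n)$ is any sequence of nonnegative numbers tending to infinity. $\phi:\partial_{\mathrm{G}}X\to\partial_{\mathrm{E}}X$ sends the class of a Gromov sequence $(x_n)$ to the unique end $(U_m)$ such that for each $m\in\mathbb{N}$ there is $N\in\mathbb{N}$ with $x_n\in U_m$ for all $n\ge N$. $\epsilon:\partial_{\mathrm{I}}X\to\partial_{\mathrm{E}}X$ sends the class of a unit speed geodesic ray $\lambda$ from $o$ to the end $(U_n)$, where $U_n$ is the component of $X\setminus\bar B_n$ containing $\lambda(n+1)$. One has $\epsilon=\phi\circ\nu$. *)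

theory Defs
  imports "HOL-Analysis.Analysis"
begin

context Metric_space
begin

subsection \<open>CAT(0) spaces\<close>

definition geodesic_segment :: "'a \<Rightarrow> 'a \<Rightarrow> 'a set \<Rightarrow> bool" where
  "geodesic_segment x y S \<longleftrightarrow>
     (\<exists>g. g ` {0..d x y} \<subseteq> M \<and> g 0 = x \<and> g (d x y) = y \<and>
          (\<forall>s\<in>{0..d x y}. \<forall>t\<in>{0..d x y}. d (g s) (g t) = \<bar>s - t\<bar>) \<and>
          S = g ` {0..d x y})"

definition geodesic_space :: bool where
  "geodesic_space \<longleftrightarrow> (\<forall>x\<in>M. \<forall>y\<in>M. \<exists>S. geodesic_segment x y S)"

text \<open>
  \<open>x'\<close>, \<open>y'\<close>, \<open>z'\<close> is a comparison triangle of a geodesic triangle with vertices \<open>x\<close>, \<open>y\<close>, \<open>z\<close>,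
  and \<open>p'\<close>, \<open>q'\<close> are the comparison points of \<open>p\<close>, \<open>q\<close>. Only the sides \<open>xy\<close> and \<open>xz\<close> are
  compared: the other pairs of distinct sides are covered by renaming the vertices, and for two
  points on the same side the inequality is an equality.
\<close>
definition CAT0 :: bool where
  "CAT0 \<longleftrightarrow> geodesic_space \<and>
     (\<forall>x\<in>M. \<forall>y\<in>M. \<forall>z\<in>M. \<forall>Sxy Sxz Syz.
        geodesic_segment x y Sxy \<and> geodesic_segment x z Sxz \<and> geodesic_segment y z Syz \<longrightarrow>
        (\<forall>x' y' z' :: real^2.
           dist x' y' = d x y \<and> dist x' z' = d x z \<and> dist y' z' = d y z \<longrightarrow>
           (\<forall>p\<in>Sxy. \<forall>q\<in>Sxz.
              \<forall>p'\<in>closed_segment x' y'. \<forall>q'\<in>closed_segment x' z'.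
                dist x' p' = d x p \<and> dist x' q' = d x q \<longrightarrow> d p q \<le> dist p' q')))"

definition complete_CAT0 :: bool where
  "complete_CAT0 \<longleftrightarrow> mcomplete \<and> CAT0"


subsection \<open>Ideal boundary\<close>

text \<open>Rays are maps on \<open>[0,\<infinity>)\<close>; as HOL functions are total, they are taken to be \<open>undefined\<close>
  on negative reals.\<close>
definition geodesic_rays :: "(real \<Rightarrow> 'a) set" where
  "geodesic_rays =
     {\<gamma> \<in> {0..} \<rightarrow>\<^sub>E M. \<forall>s\<ge>0. \<forall>t\<ge>0. d (\<gamma> s) (\<gamma> t) = \<bar>s - t\<bar>}"

definition asymptotic :: "((real \<Rightarrow> 'a) \<times> (real \<Rightarrow> 'a)) set" where
  "asymptotic = {(\<gamma>1, \<gamma>2). \<gamma>1 \<in> geodesic_rays \<and> \<gamma>2 \<in> geodesic_rays \<and>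
     (\<exists>C. \<forall>t\<ge>0. d (\<gamma>1 t) (\<gamma>2 t) \<le> C)}"

definition ideal_boundary :: "(real \<Rightarrow> 'a) set set" where
  "ideal_boundary = geodesic_rays // asymptotic"


subsection \<open>Gromov boundary (with basepoint \<open>b\<close>)\<close>

definition gromov_product :: "'a \<Rightarrow> 'a \<Rightarrow> 'a \<Rightarrow> real" where
  "gromov_product w x y = (d x w + d y w - d x y) / 2"

definition gromov_sequences :: "'a \<Rightarrow> (nat \<Rightarrow> 'a) set" where
  "gromov_sequences b = {x. range x \<subseteq> M \<and>
     filterlim (\<lambda>(m, n). gromov_product b (x m) (x n)) at_top (sequentially \<times>\<^sub>F sequentially)}"

definition gromov_E :: "'a \<Rightarrow> ((nat \<Rightarrow> 'a) \<times> (nat \<Rightarrow> 'a)) set" where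
  "gromov_E b = {(x, y). x \<in> gromov_sequences b \<and> y \<in> gromov_sequences b \<and>
     filterlim (\<lambda>(m, n). gromov_product b (x m) (y n)) at_top (sequentially \<times>\<^sub>F sequentially)}"

definition gromov_boundary :: "'a \<Rightarrow> (nat \<Rightarrow> 'a) set set" where
  "gromov_boundary b = gromov_sequences b // (gromov_E b)\<^sup>+"


subsection \<open>End boundary (with basepoint \<open>b\<close>)\<close>

definition ball_complement :: "'a \<Rightarrow> nat \<Rightarrow> 'a topology" where
  "ball_complement b n = subtopology mtopology (M - mtopology closure_of (mball b (real n)))"

text \<open>Ends are sequences indexed by \<open>1, 2, \<dots>\<close>, hence \<open>undefined\<close> at index \<open>0\<close>.\<close>
definition end_boundary :: "'a \<Rightarrow> (nat \<Rightarrow> 'a set) set" where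
  "end_boundary b =
     {U \<in> extensional {1..}.
        \<forall>n\<ge>1. U n \<in> connected_components_of (ball_complement b n) \<and> U (Suc n) \<subseteq> U n}"


subsection \<open>The natural maps\<close>

definition nu :: "'a \<Rightarrow> (real \<Rightarrow> 'a) set \<Rightarrow> (nat \<Rightarrow> 'a) set" where
  "nu b c = (THE \<xi>. \<xi> \<in> gromov_boundary b \<and>
     (\<forall>\<gamma>\<in>c. \<forall>t. (\<forall>n. 0 \<le> t n) \<and> filterlim t at_top sequentially \<longrightarrow> (\<lambda>n. \<gamma> (t n)) \<in> \<xi>))"

definition phi :: "'a \<Rightarrow> (nat \<Rightarrow> 'a) set \<Rightarrow> (nat \<Rightarrow> 'a set)" where
  "phi b \<xi> = (THE U. U \<in> end_boundary b \<and>
     (\<forall>x\<in>\<xi>. \<forall>m\<ge>1. \<exists>N. \<forall>n\<ge>N. x n \<in> U m))"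

definition ray_from :: "'a \<Rightarrow> (real \<Rightarrow> 'a) set \<Rightarrow> (real \<Rightarrow> 'a)" where
  "ray_from b c = (THE \<gamma>. \<gamma> \<in> c \<and> \<gamma> 0 = b)"

definition eps :: "'a \<Rightarrow> (real \<Rightarrow> 'a) set \<Rightarrow> (nat \<Rightarrow> 'a set)" where
  "eps b c = (\<lambda>n\<in>{1..}.
     connected_component_of_set (ball_complement b n) (ray_from b c (real (n + 1))))"

end

text \<open>The maps above are given by definite descriptions; the condition \<open>f \<in> A \<rightarrow> B\<close> ensures that
  \<open>f ` A \<noteq> B\<close> means that some element of \<open>B\<close> is not attained.\<close>
definition neither_inj_nor_surj :: "('a \<Rightarrow> 'b) \<Rightarrow> 'a set \<Rightarrow> 'b set \<Rightarrow> bool" where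
  "neither_inj_nor_surj f A B \<longleftrightarrow> f \<in> A \<rightarrow> B \<and> \<not> inj_on f A \<and> f ` A \<noteq> B"

end

theory Submission
  imports Defs
begin

text \<open>
  The space \<open>X\<close> is a wedge of four spaces at a common point \<open>o\<close>, each of which causes one of the
  failures.

  \<^item> In a flat quarter plane the two bounding rays are not asymptotic, but points at distances \<open>s\<close>
  and \<open>t\<close> on them have Gromov product \<open>(s + t - sqrt (s\<^sup>2 + t\<^sup>2)) / 2\<close>, which tends to infinity:
  \<open>\<nu>\<close> is not injective.

  \<^item> A hedgehog is a star of segments of finite but unbounded lengths. It contains no ray, and so
  neither does the product of two hedgehogs. On fresh legs of both factors choose points at
  heights \<open>k\<^sup>6\<close> and \<open>k\<^sup>5\<close>. Two such points are separated by an angle slightly less than \<open>\<pi>\<close> at \<open>o\<close>,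
  because their slopes \<open>1/k\<close> differ, and the distances grow fast enough compared with the
  convergence of the slopes for the Gromov products to tend to infinity: \<open>\<nu>\<close> is not surjective.

  \<^item> In a sector of the hyperbolic plane different directions give different Gromov classes, but
  they are joined by arcs far away from \<open>o\<close>: \<open>\<phi>\<close> is not injective.

  \<^item> The branched cover of the hyperbolic plane with infinite angle around \<open>o\<close> contains the convex
  region \<open>sinh r \<le> e\<^sup>\<theta>\<close> bounded by a spiral. The spiral runs to infinity and defines an end. A
  sequence that tends to infinity in the region must have angles tending to infinity, and points
  whose angles differ by at least \<open>\<pi>\<close> have Gromov product \<open>0\<close>, so there is no Gromov sequence:
  \<open>\<phi>\<close> is not surjective.

  Points on different branches of a wedge have Gromov product \<open>0\<close>, so the branches do not interact.
  The failures for \<open>\<epsilon>\<close> follow from \<open>\<epsilon> = \<phi> \<circ> \<nu>\<close>. A single hedgehog is the space \<open>Y\<close>: its ends would be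
  ends of single legs, which are bounded.

  The CAT(0) property is handled through the inequality of Bruhat and Tits, with a point \<open>m\<close> that
  depends only on \<open>x\<close>, \<open>y\<close> and \<open>l\<close>:
  \<open>d(z,m)\<^sup>2 \<le> (1 - l) d(z,x)\<^sup>2 + l d(z,y)\<^sup>2 - l (1 - l) d(x,y)\<^sup>2\<close>. It implies CAT(0)
  (\<open>cn_imp_CAT0\<close>), passes to products and wedges (\<open>cn_space_prod\<close>, \<open>cn_glue\<close>), and follows from the
  corresponding convexity of \<open>cosh d(z, \<sqdot>)\<close> in hyperbolic geometry
  (\<open>cn_space_of_hyperbolic_convexity\<close>). The sector, the spiral, the hedgehogs and the half-lines are
  convex subsets of the branched cover above, which is called the cone over the line
  (\<open>cn_space_cone\<close>).
\<close>

section \<open>The inequality of Bruhat and Tits\<close>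

context Metric_space
begin

text \<open>
  The inequality is required for all \<open>l\<close>, not only for midpoints: the points \<open>m\<close> then already form a
  geodesic. The distances from \<open>m\<close> to \<open>x\<close> and \<open>y\<close> are not prescribed, because they
  follow by taking \<open>z = x\<close> and \<open>z = y\<close>.
\<close>
definition cn_space :: bool where
  "cn_space \<longleftrightarrow> (\<forall>x\<in>M. \<forall>y\<in>M. \<forall>l\<in>{0..1}. \<exists>m\<in>M. \<forall>z\<in>M.
     (d z m)\<^sup>2 \<le> (1 - l) * (d z x)\<^sup>2 + l * (d z y)\<^sup>2 - l * (1 - l) * (d x y)\<^sup>2)"

lemma cn_point_dist:
  assumes M: "x \<in> M" "y \<in> M" "m \<in> M" and l: "0 \<le> l" "l \<le> 1"
    and cn: "\<And>z. z \<in> M \<Longrightarrow>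
      (d z m)\<^sup>2 \<le> (1 - l) * (d z x)\<^sup>2 + l * (d z y)\<^sup>2 - l * (1 - l) * (d x y)\<^sup>2"
  shows "d x m = l * d x y" "d m y = (1 - l) * d x y"
proof -
  have "(d x m)\<^sup>2 \<le> (l * d x y)\<^sup>2"
    using cn[OF M(1)] M(1) by (simp add: algebra_simps power2_eq_square)
  then have 1: "d x m \<le> l * d x y"
    by (rule power2_le_imp_le) (use l in simp)
  have "(d m y)\<^sup>2 \<le> ((1 - l) * d x y)\<^sup>2"
    using cn[OF M(2)] M(2) unfolding commute[of y m] commute[of y x]
    by (simp add: algebra_simps power2_eq_square)
  then have 2: "d m y \<le> (1 - l) * d x y"
    by (rule power2_le_imp_le) (use l in simp)
  have "d x y \<le> d x m + d m y" using triangle M by blast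
  moreover have "(1 - l) * d x y + l * d x y = d x y" by (simp add: algebra_simps)
  ultimately show "d x m = l * d x y" "d m y = (1 - l) * d x y" using 1 2 by linarith+
qed

text \<open>
  With \<open>z = p\<close> the right-hand side of the inequality vanishes, so a point with the distances of \<open>m\<close>
  from \<open>x\<close> and \<open>y\<close> is equal to \<open>m\<close>. Hence the inequality holds for every point of every geodesic.
\<close>
lemma cn_ineq:
  assumes cn_space "x \<in> M" "y \<in> M" "p \<in> M" "z \<in> M" "0 \<le> l" "l \<le> 1"
    and p: "d x p = l * d x y" "d p y = (1 - l) * d x y"
  shows "(d z p)\<^sup>2 \<le> (1 - l) * (d z x)\<^sup>2 + l * (d z y)\<^sup>2 - l * (1 - l) * (d x y)\<^sup>2"
proof -
  obtain m where m: "m \<in> M" and cn: "\<And>z. z \<in> M \<Longrightarrow>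
      (d z m)\<^sup>2 \<le> (1 - l) * (d z x)\<^sup>2 + l * (d z y)\<^sup>2 - l * (1 - l) * (d x y)\<^sup>2"
    using assms(1)[unfolded cn_space_def, rule_format, OF assms(2,3), of l] assms(6,7) by auto
  have "(d p m)\<^sup>2 \<le> (1 - l) * (d p x)\<^sup>2 + l * (d p y)\<^sup>2 - l * (1 - l) * (d x y)\<^sup>2"
    using cn assms by blast
  also have "\<dots> = 0"
    unfolding commute[of p x] p by (simp add: power2_eq_square algebra_simps)
  finally have "p = m" using m assms by simp
  with cn assms show ?thesis by blast
qed

text \<open>
  The bound is the squared distance of the comparison points in a Euclidean triangle
  (\<open>euclidean_fork\<close>); it comes from applying the inequality once on each of the two sides.
\<close>
lemma cn_fork:
  assumes cn_space "x \<in> M" "y \<in> M" "z \<in> M" "p \<in> M" "q \<in> M" "0 \<le> l" "l \<le> 1" "0 \<le> k" "k \<le> 1"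
    and p: "d x p = l * d x y" "d p y = (1 - l) * d x y"
    and q: "d x q = k * d x z" "d q z = (1 - k) * d x z"
  shows "(d p q)\<^sup>2 \<le> l\<^sup>2 * (d x y)\<^sup>2 + k\<^sup>2 * (d x z)\<^sup>2
                      - l * k * ((d x y)\<^sup>2 + (d x z)\<^sup>2 - (d y z)\<^sup>2)"
proof -
  have 1: "(d p q)\<^sup>2 \<le> (1 - k) * (d p x)\<^sup>2 + k * (d p z)\<^sup>2 - k * (1 - k) * (d x z)\<^sup>2"
    using cn_ineq[OF assms(1), of x z q p k] assms by blast
  have "(d z p)\<^sup>2 \<le> (1 - l) * (d z x)\<^sup>2 + l * (d z y)\<^sup>2 - l * (1 - l) * (d x y)\<^sup>2"
    using cn_ineq[OF assms(1), of x y p z l] assms by blast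
  then have "k * (d z p)\<^sup>2 \<le> k * ((1 - l) * (d z x)\<^sup>2 + l * (d z y)\<^sup>2 - l * (1 - l) * (d x y)\<^sup>2)"
    using \<open>0 \<le> k\<close> by (rule mult_left_mono)
  then show ?thesis
    using 1 unfolding commute[of p x] p commute[of p z] commute[of z x] commute[of z y]
    by (simp add: algebra_simps power2_eq_square)
qed

text \<open>
  The points \<open>m\<close> for varying \<open>l\<close> form a geodesic: \<open>cn_fork\<close> for the degenerate triangle \<open>x, y, y\<close> bounds
  their distances from above, the triangle inequality from below.
\<close>
lemma cn_geodesic:
  assumes cn_space "x \<in> M" "y \<in> M"
  obtains g where "\<And>t. t \<in> {0..d x y} \<Longrightarrow> g t \<in> M" "g 0 = x" "g (d x y) = y"
    "\<And>s t. s \<in> {0..d x y} \<Longrightarrow> t \<in> {0..d x y} \<Longrightarrow> d (g s) (g t) = \<bar>s - t\<bar>"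
proof (cases "x = y")
  case True
  then show ?thesis using that[of "\<lambda>_. x"] assms by auto
next
  case False
  define D where "D = d x y"
  have D: "D > 0" using False assms by (simp add: D_def)
  have "\<exists>m. m \<in> M \<and> d x m = t \<and> d m y = D - t" if "t \<in> {0..D}" for t
  proof -
    have l: "0 \<le> t / D" "t / D \<le> 1" using that D by auto
    obtain m where m: "m \<in> M" and "\<And>z. z \<in> M \<Longrightarrow>
        (d z m)\<^sup>2 \<le> (1 - t/D) * (d z x)\<^sup>2 + (t/D) * (d z y)\<^sup>2 - (t/D) * (1 - t/D) * (d x y)\<^sup>2"
      using assms(1)[unfolded cn_space_def, rule_format, OF assms(2,3), of "t / D"] l by auto
    then have "d x m = t / D * d x y" "d m y = (1 - t / D) * d x y"
      using cn_point_dist[OF assms(2,3) m l] by blast+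
    have "d x m = t" "d m y = D - t"
      using D \<open>d x m = t / D * d x y\<close> \<open>d m y = (1 - t / D) * d x y\<close>
      by (simp_all add: D_def[symmetric] left_diff_distrib)
    with m show ?thesis by blast
  qed
  then obtain g where g: "\<And>t. t \<in> {0..D} \<Longrightarrow> g t \<in> M \<and> d x (g t) = t \<and> d (g t) y = D - t"
    by metis
  have g0: "g 0 = x" "g D = y" using g[of 0] g[of D] D assms by auto
  have "d (g s) (g t) = \<bar>s - t\<bar>" if st: "s \<in> {0..D}" "t \<in> {0..D}" for s t
  proof -
    have 1: "d x (g s) = s" "d x (g t) = t" "g s \<in> M" "g t \<in> M" using g st by auto
    have "(d (g s) (g t))\<^sup>2 \<le> (s/D)\<^sup>2 * (d x y)\<^sup>2 + (t/D)\<^sup>2 * (d x y)\<^sup>2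
                      - (s/D) * (t/D) * ((d x y)\<^sup>2 + (d x y)\<^sup>2 - (d y y)\<^sup>2)"
    proof (rule cn_fork[OF assms(1)])
      show "0 \<le> s / D" "s / D \<le> 1" "0 \<le> t / D" "t / D \<le> 1" using st D by auto
      show "d x (g s) = s / D * d x y" "d x (g t) = t / D * d x y"
        using 1 D by (simp_all add: D_def[symmetric])
      show "d (g s) y = (1 - s / D) * d x y" "d (g t) y = (1 - t / D) * d x y"
        using g[OF st(1)] g[OF st(2)] D by (simp_all add: D_def[symmetric] left_diff_distrib)
    qed (use assms 1 in auto)
    also have "\<dots> = (s - t)\<^sup>2"
      using D assms by (simp add: D_def[symmetric] power_divide) (simp add: power2_eq_square algebra_simps)
    finally have "d (g s) (g t) \<le> \<bar>s - t\<bar>"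
      using abs_le_square_iff[of "d (g s) (g t)" "s - t"] by simp
    moreover have "\<bar>s - t\<bar> \<le> d (g s) (g t)"
      using triangle[of x "g s" "g t"] triangle[of x "g t" "g s"] 1 assms commute[of "g s" "g t"]
      by linarith
    ultimately show ?thesis by simp
  qed
  then show ?thesis using that[of g] g g0 unfolding D_def by blast
qed

lemma euclidean_fork:
  fixes x y z :: "'b :: real_inner"
  shows "(dist (x + l *\<^sub>R (y - x)) (x + k *\<^sub>R (z - x)))\<^sup>2
    = l\<^sup>2 * (dist x y)\<^sup>2 + k\<^sup>2 * (dist x z)\<^sup>2
      - l * k * ((dist x y)\<^sup>2 + (dist x z)\<^sup>2 - (dist y z)\<^sup>2)"
proof -
  define u v where "u = y - x" and "v = z - x"
  have "y - z = u - v" by (simp add: u_def v_def)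
  moreover have "(norm (l *\<^sub>R u - k *\<^sub>R v))\<^sup>2
    = l\<^sup>2 * (norm u)\<^sup>2 + k\<^sup>2 * (norm v)\<^sup>2 - l * k * ((norm u)\<^sup>2 + (norm v)\<^sup>2 - (norm (u - v))\<^sup>2)"
    unfolding power2_norm_eq_inner
    by (simp add: algebra_simps inner_commute[of v u] power2_eq_square)
  ultimately show ?thesis
    by (simp add: dist_norm u_def v_def norm_minus_commute)
qed

lemma geodesic_segment_fraction:
  assumes "geodesic_segment x y S" "p \<in> S" "d x p = l * d x y"
  shows "p \<in> M" "d p y = (1 - l) * d x y"
proof -
  obtain g where g: "g ` {0..d x y} \<subseteq> M" "g 0 = x" "g (d x y) = y"
    "\<And>s t. s \<in> {0..d x y} \<Longrightarrow> t \<in> {0..d x y} \<Longrightarrow> d (g s) (g t) = \<bar>s - t\<bar>" "S = g ` {0..d x y}"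
    using assms(1) unfolding geodesic_segment_def by blast
  obtain s where s: "s \<in> {0..d x y}" "p = g s" using g(5) assms(2) by auto
  show "p \<in> M" using g(1) s by auto
  have "d x p = s" using g(4)[of 0 s] g(2) s by auto
  moreover have "d p y = d x y - s" using g(4)[of s "d x y"] g(3) s by auto
  ultimately show "d p y = (1 - l) * d x y" using assms(3) by (simp add: algebra_simps)
qed

theorem cn_imp_CAT0:
  assumes cn_space
  shows CAT0
  unfolding CAT0_def
proof (intro conjI ballI allI impI, goal_cases)
  case 1
  show ?case unfolding geodesic_space_def
  proof (intro ballI)
    fix x y assume xy: "x \<in> M" "y \<in> M"
    obtain g where "\<And>t. t \<in> {0..d x y} \<Longrightarrow> g t \<in> M" "g 0 = x" "g (d x y) = y"
      "\<And>s t. s \<in> {0..d x y} \<Longrightarrow> t \<in> {0..d x y} \<Longrightarrow> d (g s) (g t) = \<bar>s - t\<bar>"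
      using cn_geodesic[OF assms xy] by blast
    then show "\<exists>S. geodesic_segment x y S" unfolding geodesic_segment_def by blast
  qed
next
  case (2 x y z Sxy Sxz Syz x' y' z' p q p' q')
  obtain l where l: "0 \<le> l" "l \<le> 1" "p' = x' + l *\<^sub>R (y' - x')"
    using 2 by (auto simp: in_segment algebra_simps)
  obtain k where k: "0 \<le> k" "k \<le> 1" "q' = x' + k *\<^sub>R (z' - x')"
    using 2 by (auto simp: in_segment algebra_simps)
  have "dist x' p' = l * dist x' y'" "dist x' q' = k * dist x' z'"
    using l k by (auto simp: dist_norm norm_minus_commute)
  then have p: "d x p = l * d x y" and q: "d x q = k * d x z" using 2 by auto
  note p = p geodesic_segment_fraction[OF _ _ p] and q = q geodesic_segment_fraction[OF _ _ q]
  have "(d p q)\<^sup>2 \<le> l\<^sup>2 * (d x y)\<^sup>2 + k\<^sup>2 * (d x z)\<^sup>2 - l * k * ((d x y)\<^sup>2 + (d x z)\<^sup>2 - (d y z)\<^sup>2)"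
    using p q 2 l k by (intro cn_fork[OF assms]) auto
  also have "\<dots> = (dist p' q')\<^sup>2"
    using 2 unfolding l k euclidean_fork by simp
  finally show ?case by (rule power2_le_imp_le) simp
qed

end

section \<open>Geodesic rays\<close>

context Metric_space
begin

lemma rayD:
  assumes "\<gamma> \<in> geodesic_rays"
  shows "t \<ge> 0 \<Longrightarrow> \<gamma> t \<in> M" "s \<ge> 0 \<Longrightarrow> t \<ge> 0 \<Longrightarrow> d (\<gamma> s) (\<gamma> t) = \<bar>s - t\<bar>"
    "\<gamma> \<in> extensional {0..}"
  using assms unfolding geodesic_rays_def by (auto simp: PiE_def)

lemma equiv_asymptotic: "equiv geodesic_rays asymptotic"
proof (intro equivI refl_onI symI transI)
  show "asymptotic \<subseteq> geodesic_rays \<times> geodesic_rays"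
    by (auto simp: asymptotic_def)
  show "(\<gamma>, \<gamma>) \<in> asymptotic" if "\<gamma> \<in> geodesic_rays" for \<gamma>
    using that rayD[OF that] unfolding asymptotic_def by (auto intro!: exI[of _ 0])
  show "(\<gamma>2, \<gamma>1) \<in> asymptotic" if "(\<gamma>1, \<gamma>2) \<in> asymptotic" for \<gamma>1 \<gamma>2
    using that unfolding asymptotic_def by (auto simp: commute)
  show "(\<gamma>1, \<gamma>3) \<in> asymptotic"
    if 12: "(\<gamma>1, \<gamma>2) \<in> asymptotic" and 23: "(\<gamma>2, \<gamma>3) \<in> asymptotic" for \<gamma>1 \<gamma>2 \<gamma>3
  proof -
    obtain C1 where 1: "\<forall>t\<ge>0. d (\<gamma>1 t) (\<gamma>2 t) \<le> C1" using 12 by (auto simp: asymptotic_def)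
    obtain C2 where 2: "\<forall>t\<ge>0. d (\<gamma>2 t) (\<gamma>3 t) \<le> C2" using 23 by (auto simp: asymptotic_def)
    have r: "\<gamma>1 \<in> geodesic_rays" "\<gamma>2 \<in> geodesic_rays" "\<gamma>3 \<in> geodesic_rays"
      using 12 23 by (auto simp: asymptotic_def)
    have "d (\<gamma>1 t) (\<gamma>3 t) \<le> C1 + C2" if "t \<ge> 0" for t
      using triangle[of "\<gamma>1 t" "\<gamma>2 t" "\<gamma>3 t"] rayD(1)[OF r(1) that] rayD(1)[OF r(2) that]
        rayD(1)[OF r(3) that] 1 2 that by fastforce
    then show ?thesis using r unfolding asymptotic_def by blast
  qed
qed

lemma cn_fork_apex:
  assumes cn_space "x \<in> M" "y \<in> M" "z \<in> M" "p \<in> M" "q \<in> M" "0 \<le> l" "l \<le> 1"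
    and "d x p = l * d x y" "d p y = (1 - l) * d x y"
    and "d x q = l * d x z" "d q z = (1 - l) * d x z"
  shows "d p q \<le> l * d y z"
proof -
  have "(d p q)\<^sup>2 \<le> l\<^sup>2 * (d x y)\<^sup>2 + l\<^sup>2 * (d x z)\<^sup>2 - l * l * ((d x y)\<^sup>2 + (d x z)\<^sup>2 - (d y z)\<^sup>2)"
    using assms by (intro cn_fork)
  also have "\<dots> = (l * d y z)\<^sup>2" by (simp add: power2_eq_square algebra_simps)
  finally show ?thesis by (rule power2_le_imp_le) (use assms(7) in simp)
qed

lemma asymptotic_rays_same_origin:
  assumes cn_space "(\<gamma>1, \<gamma>2) \<in> asymptotic" "\<gamma>1 0 = \<gamma>2 0"
  shows "\<gamma>1 = \<gamma>2"
proof (rule extensionalityI[of _ "{0..}"])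
  have r: "\<gamma>1 \<in> geodesic_rays" "\<gamma>2 \<in> geodesic_rays" using assms by (auto simp: asymptotic_def)
  note r1 = rayD[OF r(1)] and r2 = rayD[OF r(2)]
  show "\<gamma>1 \<in> extensional {0..}" "\<gamma>2 \<in> extensional {0..}" using r1 r2 by auto
  obtain C where C: "\<And>t. t \<ge> 0 \<Longrightarrow> d (\<gamma>1 t) (\<gamma>2 t) \<le> C" using assms by (auto simp: asymptotic_def)
  fix t :: real assume "t \<in> {0..}"
  then have t: "t \<ge> 0" by simp
  have bound: "d (\<gamma>1 t) (\<gamma>2 t) \<le> t * C * inverse s" if s: "s \<ge> t" "s > 0" for s
  proof -
    have "d (\<gamma>1 t) (\<gamma>2 t) \<le> (t / s) * d (\<gamma>1 s) (\<gamma>2 s)"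
    proof (rule cn_fork_apex[OF assms(1), of "\<gamma>1 0"])
      show "d (\<gamma>1 0) (\<gamma>1 t) = t / s * d (\<gamma>1 0) (\<gamma>1 s)" "d (\<gamma>1 t) (\<gamma>1 s) = (1 - t / s) * d (\<gamma>1 0) (\<gamma>1 s)"
        using s t by (simp_all add: r1 left_diff_distrib)
      show "d (\<gamma>1 0) (\<gamma>2 t) = t / s * d (\<gamma>1 0) (\<gamma>2 s)" "d (\<gamma>2 t) (\<gamma>2 s) = (1 - t / s) * d (\<gamma>1 0) (\<gamma>2 s)"
        using s t unfolding assms(3) by (simp_all add: r2 left_diff_distrib)
    qed (use s t in \<open>auto simp: r1 r2\<close>)
    also have "\<dots> \<le> (t / s) * C" using s t C by (intro mult_left_mono) auto
    finally show ?thesis by (simp add: field_simps)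
  qed
  have "((\<lambda>s. t * C * inverse s) \<longlongrightarrow> t * C * 0) at_top"
    by (intro tendsto_intros tendsto_inverse_0_at_top filterlim_ident)
  then have "d (\<gamma>1 t) (\<gamma>2 t) \<le> t * C * 0"
    by (rule tendsto_lowerbound) (auto intro!: eventually_mono[OF eventually_ge_at_top[of "max t 1"]] bound)
  then have "d (\<gamma>1 t) (\<gamma>2 t) = 0" using nonneg[of "\<gamma>1 t" "\<gamma>2 t"] by linarith
  then show "\<gamma>1 t = \<gamma>2 t" using r1(1)[OF t] r2(1)[OF t] by simp
qed

text \<open>
  Compare the geodesics from \<open>b\<close> to two far points \<open>\<gamma> m\<close> and \<open>\<gamma> n\<close> of a ray. The comparison angle at \<open>b\<close>
  satisfies \<open>1 - cos \<alpha> = ((n - m)\<^sup>2 - (Dn - Dm)\<^sup>2) / (2 Dm Dn)\<close>, and the factor \<open>(n - m) - (Dn - Dm)\<close> of the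
  numerator is at most \<open>2 C\<close> as \<open>Dn\<close> and \<open>Dm\<close> differ from \<open>n\<close> and \<open>m\<close> by at most \<open>C\<close>. So the angle
  tends to \<open>0\<close> with \<open>1 / m\<close>.
\<close>
lemma geodesics_to_ray_converge:
  assumes cn: cn_space and \<gamma>: "\<gamma> \<in> geodesic_rays" and b: "b \<in> M"
    and C: "C = d b (\<gamma> 0)" and mn: "m \<le> n" "0 < m" "2 * C \<le> m"
    and t: "0 \<le> t" "2 * t \<le> m"
    and p: "p \<in> M" "d b p = t" "d p (\<gamma> m) = d b (\<gamma> m) - t"
    and q: "q \<in> M" "d b q = t" "d q (\<gamma> n) = d b (\<gamma> n) - t"
  shows "(d p q)\<^sup>2 \<le> 16 * C * t\<^sup>2 / m"
proof -
  define Dm Dn where "Dm = d b (\<gamma> m)" and "Dn = d b (\<gamma> n)"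
  note r = rayD[OF \<gamma>]
  have M: "\<gamma> 0 \<in> M" "\<gamma> m \<in> M" "\<gamma> n \<in> M" using r(1) mn by auto
  have d: "d (\<gamma> 0) (\<gamma> m) = m" "d (\<gamma> 0) (\<gamma> n) = n" "d (\<gamma> m) (\<gamma> n) = n - m" using r(2) mn by auto
  have Dm: "\<bar>Dm - m\<bar> \<le> C" 
    using triangle[of b "\<gamma> 0" "\<gamma> m"] triangle[of "\<gamma> 0" b "\<gamma> m"] d M b by (auto simp: Dm_def C commute)
  have Dn: "\<bar>Dn - n\<bar> \<le> C" 
    using triangle[of b "\<gamma> 0" "\<gamma> n"] triangle[of "\<gamma> 0" b "\<gamma> n"] d M b by (auto simp: Dn_def C commute)
  have Dmn: "\<bar>Dn - Dm\<bar> \<le> n - m"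
    using triangle[of b "\<gamma> m" "\<gamma> n"] triangle[of b "\<gamma> n" "\<gamma> m"] d M b
    by (auto simp: Dn_def Dm_def commute)
  have pos: "Dm \<ge> m / 2" "Dn \<ge> n / 2" "Dm > 0" "Dn > 0" "t \<le> Dm" "t \<le> Dn"
    using Dm Dn mn t by auto
  have "C \<ge> 0" using C by simp
  have "(d p q)\<^sup>2 \<le> (t/Dm)\<^sup>2 * Dm\<^sup>2 + (t/Dn)\<^sup>2 * Dn\<^sup>2
                      - (t/Dm) * (t/Dn) * (Dm\<^sup>2 + Dn\<^sup>2 - (n - m)\<^sup>2)"
    unfolding Dm_def Dn_def d(3)[symmetric]
  proof (rule cn_fork[OF cn b M(2,3) p(1) q(1)], unfold Dm_def[symmetric] Dn_def[symmetric])
    show "d b p = t / Dm * Dm" "d b q = t / Dn * Dn" using p q pos by auto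
    show "d p (\<gamma> m) = (1 - t / Dm) * Dm" "d q (\<gamma> n) = (1 - t / Dn) * Dn"
      using p q pos by (auto simp: Dm_def[symmetric] Dn_def[symmetric] left_diff_distrib)
  qed (use pos t in auto)
  also have "\<dots> = t\<^sup>2 / (Dm * Dn) * ((n - m)\<^sup>2 - (Dn - Dm)\<^sup>2)"
    using pos by (simp add: power_divide) (simp add: field_simps power2_eq_square)
  also have "(n - m)\<^sup>2 - (Dn - Dm)\<^sup>2 = (n - m - (Dn - Dm)) * (n - m + (Dn - Dm))"
    by (simp add: power2_eq_square algebra_simps)
  also have "t\<^sup>2 / (Dm * Dn) * \<dots> \<le> t\<^sup>2 / (Dm * Dn) * ((2 * C) * (2 * n))"
    using pos Dm Dn Dmn mn \<open>C \<ge> 0\<close> by (intro mult_left_mono mult_mono) auto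
  also have "\<dots> \<le> t\<^sup>2 / (m / 2 * (n / 2)) * ((2 * C) * (2 * n))"
    using pos mn \<open>C \<ge> 0\<close> by (intro mult_right_mono divide_left_mono mult_mono mult_pos_pos) auto
  also have "\<dots> = 16 * C * t\<^sup>2 / m" using mn by (simp add: field_simps)
  finally show ?thesis .
qed

text \<open>
  Both \<open>p\<close> and \<open>\<gamma> t\<close> are close to the point of \<open>\<gamma>\<close> that divides \<open>[\<gamma> 0, \<gamma> n]\<close> in the ratio in which \<open>p\<close>
  divides \<open>[b, \<gamma> n]\<close>.
\<close>
lemma geodesic_stays_near_ray:
  assumes cn: cn_space and \<gamma>: "\<gamma> \<in> geodesic_rays" and b: "b \<in> M"
    and C: "C = d b (\<gamma> 0)" and n: "0 \<le> n" and t: "0 \<le> t" "t \<le> d b (\<gamma> n)" "0 < d b (\<gamma> n)"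
    and p: "p \<in> M" "d b p = t" "d p (\<gamma> n) = d b (\<gamma> n) - t"
  shows "d p (\<gamma> t) \<le> 2 * C"
proof -
  define D where "D = d b (\<gamma> n)"
  note r = rayD[OF \<gamma>]
  define l where "l = 1 - t / D"
  have l: "0 \<le> l" "l \<le> 1" using t by (auto simp: l_def D_def)
  have M: "\<gamma> 0 \<in> M" "\<gamma> n \<in> M" "\<gamma> t \<in> M" "\<gamma> (t / D * n) \<in> M" using r(1) n t by (auto simp: D_def)
  have Dn: "\<bar>D - n\<bar> \<le> C" 
    using triangle[of b "\<gamma> 0" "\<gamma> n"] triangle[of "\<gamma> 0" b "\<gamma> n"] r(2)[of 0 n] n M b
    by (auto simp: D_def C commute)
  have s: "0 \<le> t / D * n" "t / D * n \<le> n"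
    using t n mult_right_mono[of "t / D" 1 n] by (auto simp: D_def)
  have sd: "d (\<gamma> n) (\<gamma> (t / D * n)) = n - t / D * n" "d (\<gamma> (t / D * n)) (\<gamma> 0) = t / D * n"
    "d (\<gamma> n) (\<gamma> 0) = n"
    using r(2)[OF n s(1)] r(2)[OF s(1) order.refl] r(2)[OF n order.refl] s n by linarith+
  have "d p (\<gamma> (t / D * n)) \<le> l * d b (\<gamma> 0)"
  proof (rule cn_fork_apex[OF cn, of "\<gamma> n"])
    show "d (\<gamma> n) p = l * d (\<gamma> n) b" "d p b = (1 - l) * d (\<gamma> n) b"
      using p t unfolding commute[of "\<gamma> n"] commute[of p b] D_def[symmetric]
      by (simp_all add: l_def left_diff_distrib)
    show "d (\<gamma> n) (\<gamma> (t / D * n)) = l * d (\<gamma> n) (\<gamma> 0)"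
      "d (\<gamma> (t / D * n)) (\<gamma> 0) = (1 - l) * d (\<gamma> n) (\<gamma> 0)"
      unfolding sd by (simp_all add: l_def left_diff_distrib)
  qed (use l b M p in auto)
  also have "\<dots> \<le> C" using l C by (simp add: mult_left_le_one_le)
  finally have 1: "d p (\<gamma> (t / D * n)) \<le> C" .
  have "d (\<gamma> (t / D * n)) (\<gamma> t) = \<bar>t / D * n - t / D * D\<bar>"
    using r(2) s t by (auto simp: D_def)
  also have "\<dots> = (t / D) * \<bar>n - D\<bar>"
    using t by (subst right_diff_distrib[symmetric], subst abs_mult) (simp add: D_def)
  also have "\<dots> \<le> 1 * \<bar>n - D\<bar>" using t by (intro mult_right_mono) (auto simp: D_def)
  finally have "d (\<gamma> (t / D * n)) (\<gamma> t) \<le> C" using Dn by simp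
  with 1 triangle[of p "\<gamma> (t / D * n)" "\<gamma> t"] M p show ?thesis by auto
qed

text \<open>
  The ray is the limit of the geodesics from \<open>b\<close> to the points \<open>\<gamma> n\<close>. They form a Cauchy sequence at each
  time \<open>t\<close> and stay within \<open>2 C\<close> of \<open>\<gamma>\<close>.
\<close>
theorem exists_asymptotic_ray:
  assumes cn: cn_space and mcomplete and \<gamma>: "\<gamma> \<in> geodesic_rays" and b: "b \<in> M"
  obtains \<rho> where "(\<gamma>, \<rho>) \<in> asymptotic" "\<rho> 0 = b"
proof -
  define C where "C = d b (\<gamma> 0)"
  define D where "D n = d b (\<gamma> (real n))" for n
  note r = rayD[OF \<gamma>]
  have "C \<ge> 0" by (simp add: C_def)
  have Dn: "\<bar>D n - n\<bar> \<le> C" for n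
    using triangle[of b "\<gamma> 0" "\<gamma> n"] triangle[of "\<gamma> 0" b "\<gamma> n"] r(1)[of 0] r(1)[of n] r(2)[of 0 n] b
    by (auto simp: D_def C_def commute)
  have "\<exists>g. (\<forall>t\<in>{0..D n}. g t \<in> M) \<and> g 0 = b \<and> g (D n) = \<gamma> n \<and>
      (\<forall>s\<in>{0..D n}. \<forall>t\<in>{0..D n}. d (g s) (g t) = \<bar>s - t\<bar>)" for n
    using cn_geodesic[OF cn b r(1)[of "real n"]] unfolding D_def by (metis of_nat_0_le_iff)
  then obtain g where gM: "\<And>n t. t \<in> {0..D n} \<Longrightarrow> g n t \<in> M" and
    g0: "\<And>n. g n 0 = b" and gD: "\<And>n. g n (D n) = \<gamma> n" and
    g: "\<And>n s t. s \<in> {0..D n} \<Longrightarrow> t \<in> {0..D n} \<Longrightarrow> d (g n s) (g n t) = \<bar>s - t\<bar>"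
    by metis
  have D0: "D n \<ge> 0" for n by (simp add: D_def)
  have gb: "d b (g n t) = t" "d (g n t) (\<gamma> n) = D n - t" if "t \<in> {0..D n}" for n t
    using g[of 0 n t] g[of t n "D n"] g0[of n] gD[of n] that D0[of n] by auto
  have large: "t \<le> D n" "D n > 0" if "2 * C \<le> n" "2 * t \<le> n" "0 < n" for n t
    using Dn[of n] that by auto
  have conv: "(d (g m t) (g n t))\<^sup>2 \<le> 16 * C * t\<^sup>2 / m"
    if "m \<le> n" "0 < m" "2 * C \<le> m" "0 \<le> t" "2 * t \<le> m" for m n :: nat and t :: real
  proof -
    have t: "t \<in> {0..D m}" "t \<in> {0..D n}" using large[of m t] large[of n t] that by auto
    show ?thesis
      by (rule geodesics_to_ray_converge[OF cn \<gamma> b C_def, of "real m" "real n"])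
         (use t that gM gb in \<open>auto simp: D_def[symmetric]\<close>)
  qed
  \<comment> \<open>For fixed t only finitely many of the geodesics are too short to be defined at t; the value b
    for them is arbitrary.\<close>
  define \<sigma> where "\<sigma> t n = (if t \<in> {0..D n} then g n t else b)" for t n
  have \<sigma>: "\<exists>N. \<forall>n\<ge>N. t \<in> {0..D n} \<and> \<sigma> t n = g n t \<and> D n > 0" if "t \<ge> 0" for t
  proof -
    obtain N :: nat where N: "2 * C + 2 * t + 1 \<le> N" using real_arch_simple by blast
    have "t \<in> {0..D n} \<and> \<sigma> t n = g n t \<and> D n > 0" if "n \<ge> N" for n
      using large[of n t] N that \<open>t \<ge> 0\<close> \<open>C \<ge> 0\<close> by (auto simp: \<sigma>_def)
    then show ?thesis by blast
  qed
  have cau: "MCauchy (\<sigma> t)" if t: "t \<ge> 0" for t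
    unfolding MCauchy_def
  proof (intro conjI allI impI)
    show "range (\<sigma> t) \<subseteq> M" using gM b by (auto simp: \<sigma>_def)
    fix e :: real assume "e > 0"
    obtain N0 where N0: "\<And>n. n \<ge> N0 \<Longrightarrow> \<sigma> t n = g n t" using \<sigma>[OF t] by blast
    obtain N1 :: nat where N1: "2 * C + 2 * t + 1 + 16 * C * t\<^sup>2 / e\<^sup>2 \<le> N1" using real_arch_simple by blast
    have pos: "16 * C * t\<^sup>2 / e\<^sup>2 \<ge> 0" using \<open>C \<ge> 0\<close> by simp
    have *: "d (\<sigma> t m) (\<sigma> t n) < e" if mn: "N0 \<le> m" "N1 \<le> m" "m \<le> n" for m n
    proof -
      have "16 * C * t\<^sup>2 / e\<^sup>2 < real m" "0 < real m" using N1 mn t \<open>C \<ge> 0\<close> pos by linarith+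
      then have "16 * C * t\<^sup>2 / m < e\<^sup>2" using \<open>e > 0\<close> by (simp add: field_simps)
      moreover have "2 * C \<le> real m" "2 * t \<le> real m" "0 < m" using N1 mn t \<open>C \<ge> 0\<close> pos by linarith+
      ultimately have "(d (g m t) (g n t))\<^sup>2 < e\<^sup>2" using conv[of m n t] mn t by simp
      then show ?thesis using N0 mn \<open>e > 0\<close> by (auto intro: power2_less_imp_less)
    qed
    show "\<exists>N. \<forall>n n'. N \<le> n \<longrightarrow> N \<le> n' \<longrightarrow> d (\<sigma> t n) (\<sigma> t n') < e"
      by (rule exI[of _ "max N0 N1"]) (metis * commute linear max.bounded_iff)
  qed
  have "\<exists>p. limitin mtopology (\<sigma> t) p sequentially" if "t \<ge> 0" for t
    using cau[OF that] \<open>mcomplete\<close> unfolding mcomplete_def by blast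
  then obtain p where p: "\<And>t. t \<ge> 0 \<Longrightarrow> limitin mtopology (\<sigma> t) (p t) sequentially" by metis
  have pM: "p t \<in> M" if "t \<ge> 0" for t using p[OF that] by (simp add: limit_metric_sequentially)
  have appr: "\<exists>N. \<forall>n\<ge>N. t \<in> {0..D n} \<and> D n > 0 \<and> g n t \<in> M \<and> d (g n t) (p t) < e" if t: "t \<ge> 0" and "e > 0" for t e
  proof -
    obtain N1 where "\<And>n. n \<ge> N1 \<Longrightarrow> d (\<sigma> t n) (p t) < e"
      using p[OF t] \<open>e > 0\<close> unfolding limit_metric_sequentially by blast
    moreover obtain N0 where "\<And>n. n \<ge> N0 \<Longrightarrow> t \<in> {0..D n} \<and> \<sigma> t n = g n t \<and> D n > 0" using \<sigma>[OF t] by blast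
    ultimately show ?thesis by (intro exI[of _ "max N0 N1"]) (metis gM max.bounded_iff)
  qed
  have iso: "d (p s) (p t) = \<bar>s - t\<bar>" if st: "s \<ge> 0" "t \<ge> 0" for s t
  proof -
    have "\<bar>d (p s) (p t) - \<bar>s - t\<bar>\<bar> \<le> e" if "e > 0" for e
    proof -
      obtain N1 where N1: "\<And>n. n \<ge> N1 \<Longrightarrow> s \<in> {0..D n} \<and> g n s \<in> M \<and> d (g n s) (p s) < e/2"
        using appr[OF st(1), of "e/2"] \<open>e > 0\<close> by auto
      obtain N2 where N2: "\<And>n. n \<ge> N2 \<Longrightarrow> t \<in> {0..D n} \<and> g n t \<in> M \<and> d (g n t) (p t) < e/2"
        using appr[OF st(2), of "e/2"] \<open>e > 0\<close> by auto
      define n where "n = max N1 N2"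
      have n: "s \<in> {0..D n}" "g n s \<in> M" "d (g n s) (p s) < e/2"
        "t \<in> {0..D n}" "g n t \<in> M" "d (g n t) (p t) < e/2" using N1[of n] N2[of n] by (auto simp: n_def)
      have "d (g n s) (g n t) = \<bar>s - t\<bar>" using g n by auto
      then show ?thesis
        using triangle[of "p s" "g n s" "p t"] triangle[of "g n s" "g n t" "p t"]
          triangle[of "g n s" "p s" "g n t"] triangle[of "p s" "p t" "g n t"]
          n pM[OF st(1)] pM[OF st(2)] commute[of "p s" "g n s"] commute[of "p t" "g n t"] by linarith
    qed
    then have "\<bar>d (p s) (p t) - \<bar>s - t\<bar>\<bar> \<le> 0" using field_le_epsilon[of _ 0] by force
    then show ?thesis by simp
  qed
  have near: "d (\<gamma> t) (p t) \<le> 2 * C + 1" if t: "t \<ge> 0" for t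
  proof -
    obtain n where n: "t \<in> {0..D n}" "D n > 0" "g n t \<in> M" "d (g n t) (p t) < 1"
      using appr[OF t, of 1] by auto
    have "d (g n t) (\<gamma> t) \<le> 2 * C"
      by (rule geodesic_stays_near_ray[OF cn \<gamma> b C_def, of "real n"])
         (use n gb[OF n(1)] in \<open>auto simp: D_def\<close>)
    then show ?thesis
      using triangle[of "\<gamma> t" "g n t" "p t"] n pM[OF t] r(1)[OF t] commute[of "\<gamma> t" "g n t"] by linarith
  qed
  have "p 0 = b"
  proof -
    have "d b (p 0) \<le> 0 + e" if "e > 0" for e
    proof -
      obtain n where "d (g n 0) (p 0) < e" using appr[of 0 e] \<open>e > 0\<close> by auto
      then show ?thesis using g0 by simp
    qed
    then have "d b (p 0) \<le> 0" by (rule field_le_epsilon)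
    then have "d b (p 0) = 0" using nonneg[of b "p 0"] by linarith
    then show ?thesis using b pM[of 0] by simp
  qed
  define \<rho> where "\<rho> = restrict p {0..}"
  have "\<rho> \<in> geodesic_rays" using pM iso by (auto simp: \<rho>_def geodesic_rays_def)
  then have "(\<gamma>, \<rho>) \<in> asymptotic" using \<gamma> near by (auto simp: asymptotic_def \<rho>_def)
  moreover have "\<rho> 0 = b" using \<open>p 0 = b\<close> by (simp add: \<rho>_def)
  ultimately show ?thesis using that by blast
qed

lemma ray_from:
  assumes cn_space mcomplete "c \<in> ideal_boundary" "b \<in> M"
  shows "ray_from b c \<in> c" "ray_from b c 0 = b"
proof -
  obtain \<gamma> where \<gamma>: "\<gamma> \<in> geodesic_rays" "c = asymptotic `` {\<gamma>}"
    using assms(3) unfolding ideal_boundary_def by (rule quotientE)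
  obtain \<rho> where "(\<gamma>, \<rho>) \<in> asymptotic" "\<rho> 0 = b"
    using exists_asymptotic_ray[OF assms(1,2) \<gamma>(1) assms(4)] by blast
  then have "\<exists>!\<rho>. \<rho> \<in> c \<and> \<rho> 0 = b"
    unfolding \<gamma>(2) using equiv_asymptotic asymptotic_rays_same_origin[OF assms(1)]
    by (metis (no_types, lifting) Image_singleton_iff equivE symD transD)
  from theI'[OF this] show "ray_from b c \<in> c" "ray_from b c 0 = b" unfolding ray_from_def by auto
qed

end

section \<open>Gromov sequences, ends and the natural maps\<close>

lemma filterlim_at_top_prod_sequentially:
  "filterlim (\<lambda>(m, n). f m n :: real) at_top (sequentially \<times>\<^sub>F sequentially)
     \<longleftrightarrow> (\<forall>K. \<exists>N. \<forall>m\<ge>N. \<forall>n\<ge>N. K \<le> f m n)"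
proof -
  have "(\<exists>N. \<forall>m\<ge>N. \<forall>n\<ge>N. K \<le> f n m) \<longleftrightarrow> (\<exists>N. \<forall>m\<ge>N. \<forall>n\<ge>N. K \<le> f m n)" for K
    by blast
  then show ?thesis unfolding filterlim_at_top eventually_prod_sequentially by simp
qed

context Metric_space
begin

text \<open>
  Ends are compared through the following relation on sequences, which, unlike the ends themselves,
  does not depend on the base point: outside any ball, late terms of the two sequences lie in a common
  connected set.
\<close>
definition joined :: "'a \<Rightarrow> real \<Rightarrow> 'a \<Rightarrow> 'a \<Rightarrow> bool" where
  "joined p R u v \<longleftrightarrow> (\<exists>S. connectedin mtopology S \<and> u \<in> S \<and> v \<in> S \<and> (\<forall>z\<in>S. R < d p z))"

definition same_end :: "'a \<Rightarrow> (nat \<Rightarrow> 'a) \<Rightarrow> (nat \<Rightarrow> 'a) \<Rightarrow> bool" where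
  "same_end p x y \<longleftrightarrow> (\<forall>R. \<exists>N. \<forall>m\<ge>N. \<forall>n\<ge>N. joined p R (x m) (y n))"

lemma joined_trans:
  assumes "joined p R u v" "joined p R v w" shows "joined p R u w"
proof -
  obtain S T where S: "connectedin mtopology S" "u \<in> S" "v \<in> S" "\<forall>z\<in>S. R < d p z"
    and T: "connectedin mtopology T" "v \<in> T" "w \<in> T" "\<forall>z\<in>T. R < d p z"
    using assms unfolding joined_def by blast
  then have "connectedin mtopology (S \<union> T)" by (intro connectedin_Un) auto
  with S T show ?thesis unfolding joined_def by blast
qed

lemma joined_rebase:
  assumes "joined p (R + d p b) u v" "p \<in> M" "b \<in> M"
  shows "joined b R u v"
proof -
  obtain S where S: "connectedin mtopology S" "u \<in> S" "v \<in> S" "\<forall>z\<in>S. R + d p b < d p z"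
    using assms unfolding joined_def by blast
  then have "S \<subseteq> M" using connectedin_subset_topspace by fastforce
  have "R < d b z" if "z \<in> S" for z
    using S(4) that triangle[of p b z] assms \<open>S \<subseteq> M\<close> by force
  with S show ?thesis unfolding joined_def by blast
qed

lemma same_end_rebase: "same_end p x y \<Longrightarrow> p \<in> M \<Longrightarrow> b \<in> M \<Longrightarrow> same_end b x y"
  unfolding same_end_def using joined_rebase[of p _ b] by blast

lemma same_end_trans:
  assumes "same_end p x y" "same_end p y z" shows "same_end p x z"
  unfolding same_end_def
proof
  fix R
  obtain N1 where "\<forall>m\<ge>N1. \<forall>n\<ge>N1. joined p R (x m) (y n)" using assms unfolding same_end_def by blast
  moreover obtain N2 where "\<forall>m\<ge>N2. \<forall>n\<ge>N2. joined p R (y m) (z n)"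
    using assms unfolding same_end_def by blast
  ultimately show "\<exists>N. \<forall>m\<ge>N. \<forall>n\<ge>N. joined p R (x m) (z n)"
    by (intro exI[of _ "max N1 N2"]) (metis joined_trans max.bounded_iff max.cobounded1 max.cobounded2)
qed

lemma connectedin_path:
  fixes f :: "real \<Rightarrow> 'a"
  assumes "connected A" and M: "\<And>t. t \<in> A \<Longrightarrow> f t \<in> M"
    and cont: "\<And>t e. t \<in> A \<Longrightarrow> e > 0 \<Longrightarrow> \<exists>r>0. \<forall>s\<in>A. \<bar>s - t\<bar> < r \<longrightarrow> d (f t) (f s) < e"
  shows "connectedin mtopology (f ` A)"
proof (rule connectedin_continuous_map_image)
  show "continuous_map (top_of_set A) mtopology f"
    unfolding continuous_map_to_metric
  proof (intro ballI allI impI)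
    fix t e :: real assume t: "t \<in> topspace (top_of_set A)" and "e > 0"
    then obtain r where "r > 0" "\<forall>s\<in>A. \<bar>s - t\<bar> < r \<longrightarrow> d (f t) (f s) < e" using cont[of t e] by auto
    then show "\<exists>U. openin (top_of_set A) U \<and> t \<in> U \<and> (\<forall>y\<in>U. f y \<in> mball (f t) e)"
      using t M by (intro exI[of _ "A \<inter> ball t r"]) (auto simp: dist_real_def abs_minus_commute)
  qed
  show "connectedin (top_of_set A) A" using \<open>connected A\<close> by (simp add: connectedin_subtopology)
qed

lemma connectedin_isometric_path:
  fixes f :: "real \<Rightarrow> 'a"
  assumes "connected A" "\<And>t. t \<in> A \<Longrightarrow> f t \<in> M" "\<And>s t. s \<in> A \<Longrightarrow> t \<in> A \<Longrightarrow> d (f s) (f t) = \<bar>s - t\<bar>"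
  shows "connectedin mtopology (f ` A)"
proof (rule connectedin_path[OF assms(1,2)])
  fix t e :: real assume "t \<in> A" "e > 0"
  then show "\<exists>r>0. \<forall>s\<in>A. \<bar>s - t\<bar> < r \<longrightarrow> d (f t) (f s) < e"
    using assms(3) by (intro exI[of _ e]) (auto simp: abs_minus_commute)
qed

subsection \<open>Gromov sequences\<close>

lemma gromov_sequences_iff:
  "x \<in> gromov_sequences b \<longleftrightarrow>
     range x \<subseteq> M \<and> (\<forall>K. \<exists>N. \<forall>m\<ge>N. \<forall>n\<ge>N. K \<le> gromov_product b (x m) (x n))"
  unfolding gromov_sequences_def by (simp add: filterlim_at_top_prod_sequentially)

lemma gromov_E_iff:
  "(x, y) \<in> gromov_E b \<longleftrightarrow> x \<in> gromov_sequences b \<and> y \<in> gromov_sequences b \<and>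
     (\<forall>K. \<exists>N. \<forall>m\<ge>N. \<forall>n\<ge>N. K \<le> gromov_product b (x m) (y n))"
  unfolding gromov_E_def by (simp add: filterlim_at_top_prod_sequentially)

lemma gromov_product_rebase:
  assumes "x \<in> M" "y \<in> M" "p \<in> M" "b \<in> M"
  shows "gromov_product p x y \<le> gromov_product b x y + d p b"
proof -
  have "d x p \<le> d x b + d p b" "d y p \<le> d y b + d p b"
    using triangle[of x b p] triangle[of y b p] assms by (simp_all add: commute[of b p])
  then show ?thesis unfolding gromov_product_def by argo
qed

lemma gromov_sequences_rebase:
  assumes "p \<in> M" "b \<in> M" shows "gromov_sequences p = gromov_sequences b"
proof -
  have "x \<in> gromov_sequences q" if x: "x \<in> gromov_sequences p" and "p \<in> M" "q \<in> M" for x p q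
  proof -
    have M: "x n \<in> M" for n using x by (auto simp: gromov_sequences_iff)
    have "\<exists>N. \<forall>m\<ge>N. \<forall>n\<ge>N. K \<le> gromov_product q (x m) (x n)" for K
    proof -
      obtain N where "\<And>m n. m \<ge> N \<Longrightarrow> n \<ge> N \<Longrightarrow> K + d p q \<le> gromov_product p (x m) (x n)"
        using x unfolding gromov_sequences_iff by meson
      then show ?thesis using gromov_product_rebase[OF M M that(2,3)] by (smt (verit, best))
    qed
    then show ?thesis using x by (auto simp: gromov_sequences_iff)
  qed
  then show ?thesis using assms by blast
qed

lemma gromov_E_rebase:
  assumes "p \<in> M" "b \<in> M" shows "gromov_E p = gromov_E b"
proof -
  have "(x, y) \<in> gromov_E q" if xy: "(x, y) \<in> gromov_E p" and pq: "p \<in> M" "q \<in> M" for x y p q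
  proof -
    have M: "x n \<in> M" "y n \<in> M" for n using xy by (auto simp: gromov_E_iff gromov_sequences_iff)
    have "\<exists>N. \<forall>m\<ge>N. \<forall>n\<ge>N. K \<le> gromov_product q (x m) (y n)" for K
    proof -
      obtain N where "\<And>m n. m \<ge> N \<Longrightarrow> n \<ge> N \<Longrightarrow> K + d p q \<le> gromov_product p (x m) (y n)"
        using xy unfolding gromov_E_iff by meson
      then show ?thesis using gromov_product_rebase[OF M(1) M(2) pq] by (smt (verit, best))
    qed
    then show ?thesis using xy gromov_sequences_rebase[OF pq] unfolding gromov_E_iff by blast
  qed
  then show ?thesis using assms by auto
qed

lemma gromov_E_sym: "(x, y) \<in> gromov_E b \<Longrightarrow> (y, x) \<in> gromov_E b"
proof -
  have "gromov_product b u v = gromov_product b v u" for u v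
    by (simp add: gromov_product_def commute)
  then show "(x, y) \<in> gromov_E b \<Longrightarrow> (y, x) \<in> gromov_E b"
    unfolding gromov_E_iff by metis
qed

lemma equiv_gromov: "equiv (gromov_sequences b) ((gromov_E b)\<^sup>+)"
proof (intro equivI refl_onI)
  have "gromov_E b \<subseteq> gromov_sequences b \<times> gromov_sequences b" by (auto simp: gromov_E_iff)
  then show "(gromov_E b)\<^sup>+ \<subseteq> gromov_sequences b \<times> gromov_sequences b" 
    by (rule trancl_subset_Sigma)
  show "(x, x) \<in> (gromov_E b)\<^sup>+" if "x \<in> gromov_sequences b" for x
    using that by (intro r_into_trancl) (auto simp: gromov_E_iff gromov_sequences_iff)
  show "sym ((gromov_E b)\<^sup>+)" by (rule sym_trancl[OF symI[OF gromov_E_sym]])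
qed simp

text \<open>
  A point \<open>z\<close> of a geodesic from \<open>x\<close> to \<open>y\<close> satisfies \<open>d p z \<ge> d p x - d x z\<close> and \<open>d p z \<ge> d p y - d z y\<close>; the
  mean of the two bounds is the Gromov product.
\<close>
lemma joined_of_gromov_product:
  assumes cn_space "p \<in> M" "x \<in> M" "y \<in> M" "R < gromov_product p x y"
  shows "joined p R x y"
proof -
  obtain g where g: "\<And>t. t \<in> {0..d x y} \<Longrightarrow> g t \<in> M" "g 0 = x" "g (d x y) = y"
    "\<And>s t. s \<in> {0..d x y} \<Longrightarrow> t \<in> {0..d x y} \<Longrightarrow> d (g s) (g t) = \<bar>s - t\<bar>"
    using cn_geodesic[OF assms(1,3,4)] by blast
  have "R < d p (g t)" if t: "t \<in> {0..d x y}" for t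
  proof -
    have "d x (g t) = t" "d (g t) y = d x y - t" using g(4)[of 0 t] g(4)[of t "d x y"] g t by auto
    then show ?thesis
      using triangle[of p "g t" x] triangle[of p "g t" y] assms g(1)[OF t]
      by (simp add: gromov_product_def commute)
  qed
  moreover have "connectedin mtopology (g ` {0..d x y})"
    using g by (intro connectedin_isometric_path) auto
  moreover have "x \<in> g ` {0..d x y}" "y \<in> g ` {0..d x y}"
    using g(2,3) image_eqI[of x g 0 "{0..d x y}"] image_eqI[of y g "d x y" "{0..d x y}"] by auto
  ultimately show ?thesis unfolding joined_def by blast
qed

lemma gromov_E_imp_same_end:
  assumes cn_space "b \<in> M" "(x, y) \<in> gromov_E b"
  shows "same_end b x y"
  unfolding same_end_def
proof
  fix R :: real
  obtain N where N: "\<And>m n. m \<ge> N \<Longrightarrow> n \<ge> N \<Longrightarrow> R + 1 \<le> gromov_product b (x m) (y n)"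
    using assms unfolding gromov_E_iff by meson
  have M: "x n \<in> M" "y n \<in> M" for n using assms by (auto simp: gromov_E_iff gromov_sequences_iff)
  have "joined b R (x m) (y n)" if "m \<ge> N" "n \<ge> N" for m n
    using N[OF that] by (intro joined_of_gromov_product assms M) auto
  then show "\<exists>N. \<forall>m\<ge>N. \<forall>n\<ge>N. joined b R (x m) (y n)" by blast
qed

lemma gromov_equivalent_imp_same_end:
  assumes cn_space "b \<in> M" "(x, y) \<in> (gromov_E b)\<^sup>+"
  shows "same_end b x y"
  using assms(3)
proof induction
  case (base y)
  then show ?case by (rule gromov_E_imp_same_end[OF assms(1,2)])
next
  case (step y z)
  show ?case by (rule same_end_trans[OF step(3) gromov_E_imp_same_end[OF assms(1,2) step(2)]])
qed

lemma gromov_sequence_same_end: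
  assumes cn_space "b \<in> M" "x \<in> gromov_sequences b"
  shows "same_end b x x"
  using assms equivE[OF equiv_gromov[of b]] by (intro gromov_equivalent_imp_same_end) (auto dest: refl_onD)

subsection \<open>Ends\<close>

definition converges_to_end :: "(nat \<Rightarrow> 'a) \<Rightarrow> (nat \<Rightarrow> 'a set) \<Rightarrow> bool" where
  "converges_to_end x U \<longleftrightarrow> (\<forall>m\<ge>1. \<exists>N. \<forall>n\<ge>N. x n \<in> U m)"

lemma converges_to_endD: "converges_to_end x U \<Longrightarrow> m \<ge> 1 \<Longrightarrow> \<exists>N. \<forall>n\<ge>N. x n \<in> U m"
  unfolding converges_to_end_def by blast

lemma topspace_ball_complement:
  "topspace (ball_complement b n) = M - mtopology closure_of (mball b (real n))"
  unfolding ball_complement_def by auto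

lemma ball_complement_outside:
  assumes "b \<in> M" "z \<in> topspace (ball_complement b n)"
  shows "z \<in> M" "n \<le> d b z"
  using assms closure_of_subset[of "mball b n" mtopology] unfolding topspace_ball_complement
  by (fastforce simp: not_less)+

lemma outside_in_ball_complement:
  assumes "z \<in> M" "n < d b z"
  shows "z \<in> topspace (ball_complement b n)"
proof -
  have "mtopology closure_of (mball b (real n)) \<subseteq> mcball b (real n)"
    by (rule closure_of_minimal) auto
  then show ?thesis using assms unfolding topspace_ball_complement by auto
qed

lemma ball_complement_mono:
  assumes "m \<le> n" "connectedin (ball_complement b n) S"
  shows "connectedin (ball_complement b m) S"
proof -
  have "mball b (real m) \<subseteq> mball b (real n)" using assms(1) by (intro mball_subset_concentric) simp
  then have "mtopology closure_of (mball b (real m)) \<subseteq> mtopology closure_of (mball b (real n))"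
    by (rule closure_of_mono)
  then show ?thesis using assms(2) unfolding ball_complement_def connectedin_subtopology by blast
qed

lemma joined_connectedin:
  assumes "joined b (real n) u v"
  shows "\<exists>S. connectedin (ball_complement b n) S \<and> u \<in> S \<and> v \<in> S"
proof -
  obtain S where S: "connectedin mtopology S" "u \<in> S" "v \<in> S" "\<forall>z\<in>S. n < d b z"
    using assms unfolding joined_def by blast
  then have "S \<subseteq> M" using connectedin_subset_topspace by fastforce
  then have "S \<subseteq> M - mtopology closure_of (mball b (real n))"
    using outside_in_ball_complement S(4) unfolding topspace_ball_complement by blast
  then have "connectedin (ball_complement b n) S"
    using S unfolding ball_complement_def by (simp add: connectedin_subtopology)
  with S show ?thesis by blast
qed

lemma end_boundary_component:
  "U \<in> end_boundary b \<Longrightarrow> n \<ge> 1 \<Longrightarrow> U n \<in> connected_components_of (ball_complement b n)"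
  by (auto simp: end_boundary_def)

lemma same_end_of_common_end:
  assumes "b \<in> M" "U \<in> end_boundary b" "converges_to_end x U" "converges_to_end y U"
  shows "same_end b x y"
  unfolding same_end_def
proof
  fix R :: real
  obtain k :: nat where k: "R + 1 < k" using reals_Archimedean2 by blast
  define m where "m = max k 1"
  have m: "R < m" "m \<ge> 1" using k by (auto simp: m_def)
  obtain N1 where N1: "\<And>n. n \<ge> N1 \<Longrightarrow> x n \<in> U m" using converges_to_endD[of x U m] assms m by blast
  obtain N2 where N2: "\<And>n. n \<ge> N2 \<Longrightarrow> y n \<in> U m" using converges_to_endD[of y U m] assms m by blast
  note C = end_boundary_component[OF assms(2) m(2)]
  have "connectedin mtopology (U m)"
    using connectedin_connected_components_of[OF C] unfolding ball_complement_def connectedin_subtopology by blast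
  moreover have "R < d b z" if "z \<in> U m" for z
    using ball_complement_outside[OF assms(1), of z m] connected_components_of_subset[OF C] that m(1) by force
  ultimately have "joined b R (x i) (y j)" if "i \<ge> N1" "j \<ge> N2" for i j
    unfolding joined_def using N1 N2 that by blast
  then show "\<exists>N. \<forall>m\<ge>N. \<forall>n\<ge>N. joined b R (x m) (y n)"
    by (intro exI[of _ "max N1 N2"]) auto
qed

lemma same_end_converges:
  assumes "U \<in> end_boundary b" "converges_to_end x U" "same_end b x y"
  shows "converges_to_end y U"
  unfolding converges_to_end_def
proof (intro allI impI)
  fix m :: nat assume m: "m \<ge> 1"
  obtain N1 where N1: "\<And>n. n \<ge> N1 \<Longrightarrow> x n \<in> U m" using converges_to_endD[of x U m] assms m by blast
  obtain N2 where N2: "\<And>i j. i \<ge> N2 \<Longrightarrow> j \<ge> N2 \<Longrightarrow> joined b m (x i) (y j)"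
    using assms unfolding same_end_def by meson
  have "y n \<in> U m" if n: "n \<ge> N2" for n
  proof -
    obtain S where S: "connectedin (ball_complement b m) S" "x (max N1 N2) \<in> S" "y n \<in> S"
      using joined_connectedin[OF N2[OF max.cobounded2 n]] by blast
    have "S \<subseteq> U m"
      using connected_components_of_maximal[OF end_boundary_component[OF assms(1) m] S(1)]
        S N1[of "max N1 N2"] by (auto simp: disjnt_iff)
    with S show ?thesis by blast
  qed
  then show "\<exists>N. \<forall>n\<ge>N. y n \<in> U m" by blast
qed

lemma end_unique:
  assumes U: "U \<in> end_boundary b" "V \<in> end_boundary b" "converges_to_end x U" "converges_to_end x V"
  shows "U = V"
proof (rule extensionalityI[of _ "{1..}"])
  show "U \<in> extensional {1..}" "V \<in> extensional {1..}" using U by (auto simp: end_boundary_def)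
  fix m :: nat assume "m \<in> {1..}"
  then have m: "m \<ge> 1" by simp
  obtain N1 where N1: "\<And>n. n \<ge> N1 \<Longrightarrow> x n \<in> U m" using converges_to_endD[of x U m] assms m by blast
  obtain N2 where N2: "\<And>n. n \<ge> N2 \<Longrightarrow> x n \<in> V m" using converges_to_endD[of x V m] assms m by blast
  have "x (max N1 N2) \<in> U m \<inter> V m" using N1 N2 by simp
  then show "U m = V m"
    using connected_components_of_overlap[OF end_boundary_component[OF U(1) m] end_boundary_component[OF U(2) m]]
    by (metis emptyE)
qed

text \<open>
  The set \<open>U m\<close> is the component of the tail of the sequence outside the ball of radius \<open>m\<close>.
\<close>
lemma same_end_imp_end:
  assumes "same_end b x x"
  obtains U where "U \<in> end_boundary b" "converges_to_end x U"
proof -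
  obtain N where N: "\<And>m i j. i \<ge> N m \<Longrightarrow> j \<ge> N m \<Longrightarrow> joined b (real m) (x i) (x j)"
  proof -
    have "\<exists>N. \<forall>i\<ge>N. \<forall>j\<ge>N. joined b (real m) (x i) (x j)" for m
      using assms[unfolded same_end_def, THEN spec, of "real m"] .
    then show ?thesis using that by metis
  qed
  define U where "U = (\<lambda>m\<in>{1..}. connected_component_of_set (ball_complement b m) (x (N m)))"
  have tail: "x n \<in> U m" if mn: "m \<ge> 1" "n \<ge> N m" for m n
  proof -
    obtain S where "connectedin (ball_complement b m) S" "x (N m) \<in> S" "x n \<in> S"
      using joined_connectedin[OF N[OF order.refl mn(2)]] by blast
    then show ?thesis using mn by (auto simp: U_def connected_component_of_def)
  qed
  have C: "U m \<in> connected_components_of (ball_complement b m)" if "m \<ge> 1" for m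
  proof -
    have "x (N m) \<in> U m" using tail that by simp
    then have "x (N m) \<in> topspace (ball_complement b m)"
      using connected_component_in_topspace that by (fastforce simp: U_def)
    then show ?thesis using that by (simp add: U_def connected_component_in_connected_components_of)
  qed
  have "U (Suc m) \<subseteq> U m" if m: "m \<ge> 1" for m
  proof (rule connected_components_of_maximal[OF C[OF m]])
    show "connectedin (ball_complement b m) (U (Suc m))"
      using C[of "Suc m"] by (intro ball_complement_mono[of m "Suc m"] connectedin_connected_components_of) auto
    have "x (max (N m) (N (Suc m))) \<in> U m \<inter> U (Suc m)" using tail m by simp
    then show "\<not> disjnt (U m) (U (Suc m))" by (auto simp: disjnt_iff)
  qed
  then have "U \<in> end_boundary b" using C by (auto simp: end_boundary_def U_def)
  moreover have "converges_to_end x U" using tail by (auto simp: converges_to_end_def)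
  ultimately show ?thesis using that by blast
qed

subsection \<open>The natural maps\<close>

lemma phi_eqI:
  assumes cn_space "b \<in> M" "\<xi> \<in> gromov_boundary b" "U \<in> end_boundary b" "x \<in> \<xi>" "converges_to_end x U"
  shows "phi b \<xi> = U"
  unfolding phi_def converges_to_end_def[symmetric]
proof (rule the_equality)
  have "converges_to_end y U" if "y \<in> \<xi>" for y
  proof (rule same_end_converges[OF assms(4,6)])
    have "(x, y) \<in> (gromov_E b)\<^sup>+"
      using in_quotient_imp_in_rel[OF equiv_gromov] assms that unfolding gromov_boundary_def by blast
    then show "same_end b x y" by (rule gromov_equivalent_imp_same_end[OF assms(1,2)])
  qed
  then show "U \<in> end_boundary b \<and> (\<forall>x\<in>\<xi>. converges_to_end x U)" using assms by blast
  show "V = U" if "V \<in> end_boundary b \<and> (\<forall>x\<in>\<xi>. converges_to_end x V)" for V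
    using end_unique[of V b U x] that assms by blast
qed

lemma phi_converges:
  assumes cn_space "b \<in> M" "\<xi> \<in> gromov_boundary b" "x \<in> \<xi>"
  shows "phi b \<xi> \<in> end_boundary b" "converges_to_end x (phi b \<xi>)"
proof -
  have "x \<in> gromov_sequences b"
    using in_quotient_imp_subset[OF equiv_gromov] assms unfolding gromov_boundary_def by blast
  then obtain U where "U \<in> end_boundary b" "converges_to_end x U"
    using same_end_imp_end[OF gromov_sequence_same_end[OF assms(1,2)]] by blast
  with phi_eqI[OF assms(1-3) _ assms(4)]
  show "phi b \<xi> \<in> end_boundary b" "converges_to_end x (phi b \<xi>)" by auto
qed

lemma phi_in_end_boundary:
  assumes cn_space "b \<in> M" "\<xi> \<in> gromov_boundary b"
  shows "phi b \<xi> \<in> end_boundary b"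
  using phi_converges(1)[OF assms] in_quotient_imp_non_empty[OF equiv_gromov] assms(3)
  unfolding gromov_boundary_def by blast

lemma asymptotic_rays_gromov_E:
  assumes r: "(\<gamma>1, \<gamma>2) \<in> asymptotic" and b: "b \<in> M"
    and s: "\<And>n. 0 \<le> s n" "filterlim s at_top sequentially"
    and t: "\<And>n. 0 \<le> t n" "filterlim t at_top sequentially"
  shows "(\<lambda>n. \<gamma>1 (s n), \<lambda>n. \<gamma>2 (t n)) \<in> gromov_E b"
proof -
  have *: "\<exists>N. \<forall>m\<ge>N. \<forall>n\<ge>N. K \<le> gromov_product b (\<gamma>1 (s m)) (\<gamma>2 (t n))"
    if r: "(\<gamma>1, \<gamma>2) \<in> asymptotic"
      and s: "\<And>n. 0 \<le> s n" "filterlim s at_top sequentially"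
      and t: "\<And>n. 0 \<le> t n" "filterlim t at_top sequentially" for K \<gamma>1 \<gamma>2 s t
  proof -
    obtain C where C: "\<And>t. t \<ge> 0 \<Longrightarrow> d (\<gamma>1 t) (\<gamma>2 t) \<le> C" using r by (auto simp: asymptotic_def)
    have r: "\<gamma>1 \<in> geodesic_rays" "\<gamma>2 \<in> geodesic_rays" using r by (auto simp: asymptotic_def)
    have M: "\<gamma>1 u \<in> M" "\<gamma>2 u \<in> M" if "u \<ge> 0" for u using rayD(1)[OF r(1)] rayD(1)[OF r(2)] that by auto
    define C0 where "C0 = max (d b (\<gamma>1 0)) (d b (\<gamma>2 0))"
    have prod: "min u v - C0 - C \<le> gromov_product b (\<gamma>1 u) (\<gamma>2 v)" if "u \<ge> 0" "v \<ge> 0" for u v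
    proof -
      have "u - C0 \<le> d (\<gamma>1 u) b"
        using triangle[of "\<gamma>1 0" b "\<gamma>1 u"] rayD(2)[OF r(1), of 0 u] M[of 0] M[of u] that b
        by (auto simp: C0_def commute)
      moreover have "v - C0 \<le> d (\<gamma>2 v) b"
        using triangle[of "\<gamma>2 0" b "\<gamma>2 v"] rayD(2)[OF r(2), of 0 v] M[of 0] M[of v] that b
        by (auto simp: C0_def commute)
      moreover have "d (\<gamma>1 u) (\<gamma>2 v) \<le> C + \<bar>u - v\<bar>"
        using triangle[of "\<gamma>1 u" "\<gamma>2 u" "\<gamma>2 v"] C[OF that(1)] rayD(2)[OF r(2), of u v] M that by auto
      moreover have "C \<ge> 0" using C[of 0] nonneg[of "\<gamma>1 0" "\<gamma>2 0"] by linarith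
      ultimately show ?thesis by (simp add: gromov_product_def)
    qed
    obtain N1 where N1: "\<And>n. n \<ge> N1 \<Longrightarrow> K + C0 + C \<le> s n"
      using s(2)[unfolded filterlim_at_top eventually_sequentially] by blast
    obtain N2 where N2: "\<And>n. n \<ge> N2 \<Longrightarrow> K + C0 + C \<le> t n"
      using t(2)[unfolded filterlim_at_top eventually_sequentially] by blast
    show ?thesis
    proof (intro exI[of _ "max N1 N2"] allI impI)
      fix m n assume "m \<ge> max N1 N2" "n \<ge> max N1 N2"
      then have "K + C0 + C \<le> min (s m) (t n)" using N1 N2 by simp
      then show "K \<le> gromov_product b (\<gamma>1 (s m)) (\<gamma>2 (t n))" using prod[OF s(1) t(1)] by (smt (verit))
    qed
  qed
  have r12: "\<gamma>1 \<in> geodesic_rays" "\<gamma>2 \<in> geodesic_rays" using r by (auto simp: asymptotic_def)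
  have refl: "(\<gamma>1, \<gamma>1) \<in> asymptotic" "(\<gamma>2, \<gamma>2) \<in> asymptotic"
    using r12 equiv_asymptotic by (auto simp: equiv_def refl_on_def)
  show ?thesis
    unfolding gromov_E_iff gromov_sequences_iff
    using *[OF r s t] *[OF refl(1) s s] *[OF refl(2) t t] rayD(1)[OF r12(1) s(1)] rayD(1)[OF r12(2) t(1)]
    by blast
qed

lemma nu_eqI:
  assumes "b \<in> M" "c \<in> ideal_boundary" "\<gamma> \<in> c" "\<xi> \<in> gromov_boundary b" "(\<lambda>n. \<gamma> (real n)) \<in> \<xi>"
  shows "nu b c = \<xi>"
  unfolding nu_def
proof (rule the_equality)
  have "(\<lambda>n. \<gamma>' (t n)) \<in> \<xi>"
    if "\<gamma>' \<in> c" "\<And>n. 0 \<le> t n" "filterlim t at_top sequentially" for \<gamma>' t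
  proof -
    have "(\<gamma>, \<gamma>') \<in> asymptotic"
      using in_quotient_imp_in_rel[OF equiv_asymptotic] assms that unfolding ideal_boundary_def by blast
    then have "((\<lambda>n. \<gamma> (real n)), (\<lambda>n. \<gamma>' (t n))) \<in> gromov_E b"
      using that assms(1) by (intro asymptotic_rays_gromov_E filterlim_real_sequentially) auto
    then show ?thesis
      using in_quotient_imp_closed[OF equiv_gromov] assms unfolding gromov_boundary_def by blast
  qed
  then show "\<xi> \<in> gromov_boundary b \<and> (\<forall>\<gamma>\<in>c. \<forall>t. (\<forall>n. 0 \<le> t n) \<and> filterlim t at_top sequentially \<longrightarrow> (\<lambda>n. \<gamma> (t n)) \<in> \<xi>)"
    using assms by blast
  fix \<zeta> assume \<zeta>: "\<zeta> \<in> gromov_boundary b \<and> (\<forall>\<gamma>\<in>c. \<forall>t. (\<forall>n. 0 \<le> t n) \<and> filterlim t at_top sequentially \<longrightarrow> (\<lambda>n. \<gamma> (t n)) \<in> \<zeta>)"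
  then have "(\<lambda>n. \<gamma> (real n)) \<in> \<zeta>"
    using assms filterlim_real_sequentially by auto
  then show "\<zeta> = \<xi>"
    using \<zeta> assms quotient_disj[OF equiv_gromov, of \<zeta> _ \<xi>] unfolding gromov_boundary_def by blast
qed

lemma nu_ray:
  assumes "b \<in> M" "c \<in> ideal_boundary" "\<gamma> \<in> c"
  shows "nu b c \<in> gromov_boundary b" "(\<lambda>n. \<gamma> (real n)) \<in> nu b c"
proof -
  have "(\<gamma>, \<gamma>) \<in> asymptotic"
    using in_quotient_imp_in_rel[OF equiv_asymptotic] assms unfolding ideal_boundary_def by blast
  then have "((\<lambda>n. \<gamma> (real n)), (\<lambda>n. \<gamma> (real n))) \<in> gromov_E b"
    using assms(1) by (intro asymptotic_rays_gromov_E filterlim_real_sequentially) auto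
  then have x: "(\<lambda>n. \<gamma> (real n)) \<in> gromov_sequences b" by (auto simp: gromov_E_iff)
  define \<xi> where "\<xi> = (gromov_E b)\<^sup>+ `` {\<lambda>n. \<gamma> (real n)}"
  have "\<xi> \<in> gromov_boundary b" unfolding \<xi>_def gromov_boundary_def using x by (rule quotientI)
  moreover have "(\<lambda>n. \<gamma> (real n)) \<in> \<xi>" unfolding \<xi>_def using equiv_class_self[OF equiv_gromov x] .
  ultimately show "nu b c \<in> gromov_boundary b" "(\<lambda>n. \<gamma> (real n)) \<in> nu b c"
    using nu_eqI[OF assms] by auto
qed

lemma nu_in_gromov_boundary:
  assumes "b \<in> M" "c \<in> ideal_boundary"
  shows "nu b c \<in> gromov_boundary b"
  using nu_ray(1)[OF assms] in_quotient_imp_non_empty[OF equiv_asymptotic] assms(2)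
  unfolding ideal_boundary_def by blast

text \<open>
  The tail of a ray from \<open>b\<close> is connected and lies outside the ball, so the ray converges to the end
  \<open>eps b c\<close>; this property characterizes \<open>phi\<close>.
\<close>
theorem eps_eq_phi_nu:
  assumes cn_space mcomplete "b \<in> M" "c \<in> ideal_boundary"
  shows "eps b c = phi b (nu b c)"
proof -
  define \<gamma> where "\<gamma> = ray_from b c"
  have \<gamma>: "\<gamma> \<in> c" "\<gamma> 0 = b" using ray_from[OF assms(1,2,4,3)] by (auto simp: \<gamma>_def)
  have "\<gamma> \<in> geodesic_rays"
    using in_quotient_imp_subset[OF equiv_asymptotic] \<gamma> assms unfolding ideal_boundary_def by blast
  note r = rayD[OF this]
  have dist: "d b (\<gamma> t) = t" if "t \<ge> 0" for t using r(2)[of 0 t] that \<gamma> by simp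
  have conn: "connectedin (ball_complement b m) (\<gamma> ` {real (m + 1)..})" for m
  proof -
    have "connectedin mtopology (\<gamma> ` {real (m + 1)..})"
      using r by (intro connectedin_isometric_path) auto
    moreover have "\<gamma> ` {real (m + 1)..} \<subseteq> topspace (ball_complement b m)"
      using r dist by (auto intro!: outside_in_ball_complement)
    ultimately show ?thesis
      unfolding topspace_ball_complement by (auto simp: ball_complement_def connectedin_subtopology)
  qed
  have tail: "\<gamma> ` {real (m + 1)..} \<subseteq> eps b c m" if "m \<ge> 1" for m
    using connected_component_of_maximal[OF conn, of "\<gamma> (real (m + 1))" m] that
    by (auto simp: eps_def \<gamma>_def)
  have C: "eps b c m \<in> connected_components_of (ball_complement b m)" if "m \<ge> 1" for m
    using that r dist
    by (auto simp: eps_def \<gamma>_def[symmetric] connected_component_in_connected_components_of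
        intro!: outside_in_ball_complement)
  have "eps b c (Suc m) \<subseteq> eps b c m" if m: "m \<ge> 1" for m
  proof (rule connected_components_of_maximal[OF C[OF m]])
    show "connectedin (ball_complement b m) (eps b c (Suc m))"
      using C[of "Suc m"] by (intro ball_complement_mono[of m "Suc m"] connectedin_connected_components_of) auto
    have "\<gamma> (real (m + 2)) \<in> eps b c m \<inter> eps b c (Suc m)" using tail[OF m] tail[of "Suc m"] by auto
    then show "\<not> disjnt (eps b c m) (eps b c (Suc m))" by (auto simp: disjnt_iff)
  qed
  then have "eps b c \<in> end_boundary b" using C by (auto simp: end_boundary_def eps_def)
  moreover have "converges_to_end (\<lambda>n. \<gamma> (real n)) (eps b c)"
    unfolding converges_to_end_def
  proof (intro allI impI)
    fix m :: nat assume "m \<ge> 1"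
    then show "\<exists>N. \<forall>n\<ge>N. \<gamma> (real n) \<in> eps b c m"
      using tail[of m] by (intro exI[of _ "m + 1"]) auto
  qed
  ultimately show ?thesis
    using phi_eqI[OF assms(1,3) nu_in_gromov_boundary[OF assms(3,4)] _ nu_ray(2)[OF assms(3,4) \<gamma>(1)]] by simp
qed

end

section \<open>Branches of a space\<close>

context Metric_space
begin

lemma gromov_boundary_equivalent:
  assumes "\<xi> \<in> gromov_boundary b" "x \<in> \<xi>" "y \<in> \<xi>"
  shows "(x, y) \<in> (gromov_E b)\<^sup>+"
  using in_quotient_imp_in_rel[OF equiv_gromov, of \<xi> b x y] assms unfolding gromov_boundary_def by blast

text \<open>
  Each group of witnesses refutes one property of \<open>nu\<close> or \<open>phi\<close>, and \<open>eps\<close> inherits the failures through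
  \<open>eps_eq_phi_nu\<close>. Witnesses for one base point \<open>p\<close> serve for every \<open>b\<close>, because neither Gromov
  equivalence nor \<open>same_end\<close> depends on the base point.
\<close>
theorem neither_inj_nor_surj_natural_maps:
  assumes cn: cn_space and complete: mcomplete and p: "p \<in> M" and b: "b \<in> M"
    and rays: "\<gamma>1 \<in> geodesic_rays" "\<gamma>2 \<in> geodesic_rays" "(\<gamma>1, \<gamma>2) \<notin> asymptotic"
      "((\<lambda>n. \<gamma>1 (real n)), (\<lambda>n. \<gamma>2 (real n))) \<in> (gromov_E p)\<^sup>+"
    and x: "x \<in> gromov_sequences p"
      "\<And>\<gamma>. \<gamma> \<in> geodesic_rays \<Longrightarrow> (x, \<lambda>n. \<gamma> (real n)) \<notin> (gromov_E p)\<^sup>+"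
    and yz: "y \<in> gromov_sequences p" "z \<in> gromov_sequences p" "same_end p y z"
      "(y, z) \<notin> (gromov_E p)\<^sup>+"
    and w: "same_end p w w" "\<And>x. x \<in> gromov_sequences p \<Longrightarrow> \<not> same_end p w x"
  shows "neither_inj_nor_surj (nu b) ideal_boundary (gromov_boundary b)"
    "neither_inj_nor_surj (phi b) (gromov_boundary b) (end_boundary b)"
    "neither_inj_nor_surj (eps b) ideal_boundary (end_boundary b)"
proof -
  note E = gromov_E_rebase[OF p b] and G = gromov_sequences_rebase[OF p b]
  note eqv = equiv_gromov[of b]
  have nu: "nu b \<in> ideal_boundary \<rightarrow> gromov_boundary b"
    using nu_in_gromov_boundary[OF b] by blast
  have phi: "phi b \<in> gromov_boundary b \<rightarrow> end_boundary b"
    using phi_in_end_boundary[OF cn b] by blast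
  have has_class: "\<exists>\<xi>\<in>gromov_boundary b. x \<in> \<xi>" if "x \<in> gromov_sequences p" for x
    using that eqv unfolding G gromov_boundary_def by (metis equiv_class_self quotientI)

  define c1 c2 where "c1 = asymptotic `` {\<gamma>1}" and "c2 = asymptotic `` {\<gamma>2}"
  have c: "c1 \<in> ideal_boundary" "c2 \<in> ideal_boundary" "\<gamma>1 \<in> c1" "\<gamma>2 \<in> c2"
    unfolding c1_def c2_def ideal_boundary_def
    using rays(1,2) equiv_class_self[OF equiv_asymptotic] by (auto intro: quotientI)
  have c12: "c1 \<noteq> c2"
    using eq_equiv_class[OF _ equiv_asymptotic rays(2)] rays(3) unfolding c1_def c2_def by blast
  have nu12: "nu b c1 = nu b c2"
    using quotient_eqI[OF eqv _ _ nu_ray(2)[OF b c(1,3)] nu_ray(2)[OF b c(2,4)]] rays(4)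
      nu_ray(1)[OF b c(1,3)] nu_ray(1)[OF b c(2,4)] unfolding E gromov_boundary_def by blast

  obtain \<xi> where \<xi>: "\<xi> \<in> gromov_boundary b" "x \<in> \<xi>" using has_class[OF x(1)] by blast
  have "nu b c \<noteq> \<xi>" if c: "c \<in> ideal_boundary" for c
  proof
    assume "nu b c = \<xi>"
    obtain \<gamma> where \<gamma>: "\<gamma> \<in> geodesic_rays" "\<gamma> \<in> c"
      using c equiv_class_self[OF equiv_asymptotic] unfolding ideal_boundary_def by (metis quotientE)
    have "(x, \<lambda>n. \<gamma> (real n)) \<in> (gromov_E b)\<^sup>+"
      using gromov_boundary_equivalent[OF \<xi>] nu_ray(2)[OF b c \<gamma>(2)] \<open>nu b c = \<xi>\<close> by simp
    with x(2)[OF \<gamma>(1)] E show False by simp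
  qed
  then have nu_surj: "\<xi> \<notin> nu b ` ideal_boundary" by auto

  obtain \<eta> where \<eta>: "\<eta> \<in> gromov_boundary b" "y \<in> \<eta>" using has_class[OF yz(1)] by blast
  obtain \<zeta> where \<zeta>: "\<zeta> \<in> gromov_boundary b" "z \<in> \<zeta>" using has_class[OF yz(2)] by blast
  have "\<eta> \<noteq> \<zeta>"
  proof
    assume "\<eta> = \<zeta>"
    then have "(y, z) \<in> (gromov_E b)\<^sup>+"
      using gromov_boundary_equivalent[OF \<eta>] \<zeta>(2) by simp
    with yz(4) E show False by simp
  qed
  have "phi b \<zeta> = phi b \<eta>"
    using phi_converges[OF cn b \<eta>] same_end_converges[OF _ _ same_end_rebase[OF yz(3) p b], of "phi b \<eta>"]
    by (intro phi_eqI[OF cn b \<zeta>(1) _ \<zeta>(2)]) simp_all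

  obtain U where U: "U \<in> end_boundary b" "converges_to_end w U"
    using same_end_imp_end[OF same_end_rebase[OF w(1) p b]] by blast
  have "phi b \<xi> \<noteq> U" if \<xi>: "\<xi> \<in> gromov_boundary b" for \<xi>
  proof
    assume "phi b \<xi> = U"
    obtain x where x: "x \<in> gromov_sequences b" "x \<in> \<xi>"
      using \<xi> equiv_class_self[OF eqv] unfolding gromov_boundary_def by (metis quotientE)
    have "same_end b w x"
      using same_end_of_common_end[OF b U] phi_converges[OF cn b \<xi> x(2)] \<open>phi b \<xi> = U\<close> by blast
    then show False using w(2)[of x] x same_end_rebase[OF _ b p] G by blast
  qed
  then have phi_surj: "U \<notin> phi b ` gromov_boundary b" by auto

  show "neither_inj_nor_surj (nu b) ideal_boundary (gromov_boundary b)"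
    unfolding neither_inj_nor_surj_def inj_on_def using nu nu_surj \<xi>(1) c c12 nu12 by blast
  show "neither_inj_nor_surj (phi b) (gromov_boundary b) (end_boundary b)"
    unfolding neither_inj_nor_surj_def inj_on_def
    using phi phi_surj U(1) \<eta>(1) \<zeta>(1) \<open>\<eta> \<noteq> \<zeta>\<close> \<open>phi b \<zeta> = phi b \<eta>\<close> by blast
  have eps: "eps b c = phi b (nu b c)" if "c \<in> ideal_boundary" for c
    using eps_eq_phi_nu[OF cn complete b that] .
  then have "eps b \<in> ideal_boundary \<rightarrow> end_boundary b" "eps b c1 = eps b c2"
    "U \<notin> eps b ` ideal_boundary"
    using nu phi phi_surj c(1,2) nu12 by (auto simp: Pi_iff)
  then show "neither_inj_nor_surj (eps b) ideal_boundary (end_boundary b)"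
    unfolding neither_inj_nor_surj_def inj_on_def using U(1) c c12 by blast
qed

text \<open>
  Restrictions of rays to integer times are easier to move between spaces than rays: if their tail
  lies in a subset, this is again a discrete ray after a shift.
\<close>
definition discrete_ray :: "(nat \<Rightarrow> 'a) \<Rightarrow> bool" where
  "discrete_ray z \<longleftrightarrow> range z \<subseteq> M \<and> (\<forall>m n. d (z m) (z n) = \<bar>real m - real n\<bar>)"

end

text \<open>
  The rest of \<open>M\<close> is attached to the branch \<open>f ` N\<close> at \<open>f q\<close>. The embedding \<open>f\<close> in place of an inclusion allows
  each branch of a wedge to have its own type and metric.
\<close>
locale branch = A: Metric_space N e + B: Metric_space M d for N :: "'a set" and e and M :: "'b set" and d +
  fixes f :: "'a \<Rightarrow> 'b" and q
  assumes f_in: "x \<in> N \<Longrightarrow> f x \<in> M"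
    and isometric: "x \<in> N \<Longrightarrow> y \<in> N \<Longrightarrow> d (f x) (f y) = e x y"
    and root: "q \<in> N"
    and through_root: "x \<in> N \<Longrightarrow> v \<in> M \<Longrightarrow> v \<notin> f ` N \<Longrightarrow> d (f x) v = d (f x) (f q) + d (f q) v"
begin

lemma gromov_product_branch:
  "x \<in> N \<Longrightarrow> y \<in> N \<Longrightarrow> B.gromov_product (f q) (f x) (f y) = A.gromov_product q x y"
  unfolding A.gromov_product_def B.gromov_product_def using root by (simp add: isometric)

lemma gromov_product_outside:
  "x \<in> N \<Longrightarrow> y \<in> M \<Longrightarrow> y \<notin> f ` N \<Longrightarrow> B.gromov_product (f q) (f x) y = 0"
  using through_root[of x y] by (simp add: B.gromov_product_def B.commute)

lemma gromov_sequence_image: "x \<in> A.gromov_sequences q \<Longrightarrow> (\<lambda>n. f (x n)) \<in> B.gromov_sequences (f q)"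
  unfolding A.gromov_sequences_iff B.gromov_sequences_iff
  using f_in by (auto simp: gromov_product_branch range_subsetD)

lemma gromov_E_image: "(x, y) \<in> A.gromov_E q \<Longrightarrow> ((\<lambda>n. f (x n)), (\<lambda>n. f (y n))) \<in> B.gromov_E (f q)"
  unfolding A.gromov_E_iff B.gromov_E_iff
  by (auto simp: gromov_sequence_image) (auto simp: A.gromov_sequences_iff gromov_product_branch range_subsetD)

lemma gromov_sequence_preimage:
  assumes u: "u \<in> B.gromov_sequences (f q)" and y: "range y \<subseteq> N" and uy: "\<And>n. n \<ge> k \<Longrightarrow> u n = f (y n)"
  shows "y \<in> A.gromov_sequences q"
  unfolding A.gromov_sequences_iff
proof (intro conjI y allI)
  fix K
  obtain j where "\<And>m n. m \<ge> j \<Longrightarrow> n \<ge> j \<Longrightarrow> K \<le> B.gromov_product (f q) (u m) (u n)"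
    using u unfolding B.gromov_sequences_iff by meson
  then have "K \<le> A.gromov_product q (y m) (y n)" if "m \<ge> max j k" "n \<ge> max j k" for m n
    using uy[of m] uy[of n] that gromov_product_branch[of "y m" "y n"] y by (metis max.bounded_iff range_subsetD)
  then show "\<exists>N. \<forall>m\<ge>N. \<forall>n\<ge>N. K \<le> A.gromov_product q (y m) (y n)" by blast
qed

text \<open>
  Gromov products between the branch and its complement vanish (\<open>gromov_product_outside\<close>), so a
  sequence that is equivalent to a sequence of the branch is finally in the branch.
\<close>
lemma gromov_E_preimage:
  assumes uv: "(u, v) \<in> B.gromov_E (f q)" and y: "range y \<subseteq> N" and uy: "\<And>n. n \<ge> k \<Longrightarrow> u n = f (y n)"
  obtains z j where "(y, z) \<in> A.gromov_E q" "\<And>n. n \<ge> j \<Longrightarrow> v n = f (z n)"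
proof -
  have v: "v \<in> B.gromov_sequences (f q)" and u: "u \<in> B.gromov_sequences (f q)" using uv by (auto simp: B.gromov_E_iff)
  have vM: "v n \<in> M" for n using v by (auto simp: B.gromov_sequences_iff)
  have K: "\<exists>j. \<forall>m\<ge>j. \<forall>n\<ge>j. K \<le> B.gromov_product (f q) (u m) (v n)" for K
    using uv unfolding B.gromov_E_iff by blast
  then obtain i where i: "\<And>m n. m \<ge> i \<Longrightarrow> n \<ge> i \<Longrightarrow> 1 \<le> B.gromov_product (f q) (u m) (v n)" by meson
  define z where "z n = (if v n \<in> f ` N then inv_into N f (v n) else q)" for n
  have zN: "range z \<subseteq> N" using root by (auto simp: z_def inv_into_into)
  have vz: "v n = f (z n)" if n: "n \<ge> i" for n
  proof -
    have "v n \<in> f ` N"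
    proof (rule ccontr)
      assume "v n \<notin> f ` N"
      then have "B.gromov_product (f q) (u (max i k)) (v n) = 0"
        using gromov_product_outside[of "y (max i k)" "v n"] uy[of "max i k"] y vM by auto
      then show False using i[of "max i k" n] n by simp
    qed
    then show ?thesis by (simp add: z_def f_inv_into_f)
  qed
  have "\<exists>j. \<forall>m\<ge>j. \<forall>n\<ge>j. K \<le> A.gromov_product q (y m) (z n)" for K
  proof -
    obtain j where j: "\<And>m n. m \<ge> j \<Longrightarrow> n \<ge> j \<Longrightarrow> K \<le> B.gromov_product (f q) (u m) (v n)" using K by meson
    have "K \<le> A.gromov_product q (y m) (z n)" if "m \<ge> max j (max i k)" "n \<ge> max j (max i k)" for m n
      using j[of m n] uy[of m] vz[of n] that gromov_product_branch[of "y m" "z n"] y zN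
      by (simp add: range_subsetD)
    then show ?thesis by blast
  qed
  then have "(y, z) \<in> A.gromov_E q"
    using gromov_sequence_preimage[OF u y uy] gromov_sequence_preimage[OF v zN vz]
    unfolding A.gromov_E_iff by blast
  with vz show ?thesis using that by blast
qed

lemma gromov_equivalent_preimage:
  assumes x: "x \<in> A.gromov_sequences q" and "((\<lambda>n. f (x n)), v) \<in> (B.gromov_E (f q))\<^sup>+"
  shows "\<exists>z. (x, z) \<in> (A.gromov_E q)\<^sup>+ \<and> (\<exists>j. \<forall>n\<ge>j. v n = f (z n))"
  using assms(2)
proof induction
  case (base v)
  have "range x \<subseteq> N" using x by (auto simp: A.gromov_sequences_iff)
  from gromov_E_preimage[OF base this, of 0] show ?case by (metis r_into_trancl)
next
  case (step u v)
  then obtain y k where y: "(x, y) \<in> (A.gromov_E q)\<^sup>+" "\<And>n. n \<ge> k \<Longrightarrow> u n = f (y n)" by blast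
  have "y \<in> A.gromov_sequences q" using y(1) equiv_type[OF A.equiv_gromov] by blast
  then have "range y \<subseteq> N" by (auto simp: A.gromov_sequences_iff)
  from gromov_E_preimage[OF step(2) this y(2)] obtain z j where
    "(y, z) \<in> A.gromov_E q" "\<And>n. n \<ge> j \<Longrightarrow> v n = f (z n)" by metis
  then show ?case using trancl_into_trancl[OF y(1)] by blast
qed

text \<open>
  Every point of the branch other than \<open>f q\<close> is at least as far from the complement of the branch as
  from \<open>f q\<close>, and conversely, so both sides are open once \<open>f q\<close> is removed.
\<close>
lemma connectedin_branch:
  assumes S: "connectedin B.mtopology S" "f q \<notin> S" "f x \<in> S" "x \<in> N"
  shows "S \<subseteq> f ` N"
proof -
  have far: "d (f q) u \<le> d u v" if "u \<in> M" "v \<in> M" "u \<in> f ` N \<longleftrightarrow> v \<notin> f ` N" for u v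
  proof (cases "u \<in> f ` N")
    case True
    then obtain a where "a \<in> N" "u = f a" by blast
    with that True show ?thesis using through_root[of a v] by (simp add: B.commute)
  next
    case False
    then have "v \<in> f ` N" using that(3) by blast
    then obtain a where "a \<in> N" "v = f a" by blast
    with that False show ?thesis using through_root[of a u] by (simp add: B.commute)
  qed
  have 1: "openin B.mtopology (f ` N - {f q})"
    unfolding B.openin_mtopology
  proof (intro conjI ballI allI impI)
    fix v assume "v \<in> f ` N - {f q}"
    then obtain u where u: "u \<in> N" "v = f u" "f u \<noteq> f q" by blast
    have "B.mball (f u) (d (f q) (f u)) \<subseteq> f ` N - {f q}"
      using far[of "f u"] u f_in root by (fastforce simp: B.commute)
    moreover have "d (f q) (f u) > 0" using u f_in root by simp
    ultimately show "\<exists>r>0. B.mball v r \<subseteq> f ` N - {f q}" using u(2) by blast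
  qed (use f_in in auto)
  have 2: "openin B.mtopology (M - f ` N)"
    unfolding B.openin_mtopology
  proof (intro conjI ballI allI impI)
    fix u assume u: "u \<in> M - f ` N"
    have "B.mball u (d (f q) u) \<subseteq> M - f ` N" using far[of u] u by fastforce
    moreover have "d (f q) u > 0" using u f_in root by (metis B.mdist_pos_less Diff_iff imageI)
    ultimately show "\<exists>r>0. B.mball u r \<subseteq> M - f ` N" by blast
  qed auto
  define U V where "U = f ` N - {f q}" and "V = M - f ` N"
  have "S \<subseteq> U \<union> V"
    using connectedin_subset_topspace[OF S(1)] S(2) by (auto simp: U_def V_def)
  moreover have "U \<inter> V \<inter> S = {}" "U \<inter> S \<noteq> {}" using S by (auto simp: U_def V_def)
  moreover have "openin B.mtopology U" "openin B.mtopology V" using 1 2 by (simp_all add: U_def V_def)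
  ultimately have "V \<inter> S = {}"
    using S(1)[unfolded connectedin, THEN conjunct2] by (simp add: disjoint_iff) blast
  then show ?thesis using connectedin_subset_topspace[OF S(1)] by (auto simp: V_def)
qed

lemma joined_image:
  assumes "A.joined q R u v" shows "B.joined (f q) R (f u) (f v)"
proof -
  obtain S where S: "connectedin A.mtopology S" "u \<in> S" "v \<in> S" "\<forall>z\<in>S. R < e q z"
    using assms unfolding A.joined_def by blast
  have "S \<subseteq> N" using connectedin_subset_topspace[OF S(1)] by simp
  have "continuous_map A.mtopology B.mtopology f"
    unfolding B.continuous_map_to_metric
  proof (intro ballI allI impI)
    fix x \<epsilon> assume "x \<in> topspace A.mtopology" "(0::real) < \<epsilon>"
    then show "\<exists>U. openin A.mtopology U \<and> x \<in> U \<and> (\<forall>y\<in>U. f y \<in> B.mball (f x) \<epsilon>)"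
      by (intro exI[of _ "A.mball x \<epsilon>"]) (auto simp: f_in isometric)
  qed
  then have "connectedin B.mtopology (f ` S)" using S(1) by (rule connectedin_continuous_map_image)
  moreover have "\<forall>z\<in>f ` S. R < d (f q) z" using S(4) \<open>S \<subseteq> N\<close> root isometric by auto
  ultimately show ?thesis using S(2,3) unfolding B.joined_def by blast
qed

lemma same_end_image:
  assumes "A.same_end q x y" shows "B.same_end (f q) (\<lambda>n. f (x n)) (\<lambda>n. f (y n))"
  unfolding B.same_end_def
proof
  fix R
  obtain k where "\<forall>m\<ge>k. \<forall>n\<ge>k. A.joined q R (x m) (y n)"
    using assms[unfolded A.same_end_def, THEN spec, of R] by blast
  then have "\<forall>m\<ge>k. \<forall>n\<ge>k. B.joined (f q) R (f (x m)) (f (y n))" by (simp add: joined_image)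
  then show "\<exists>k. \<forall>m\<ge>k. \<forall>n\<ge>k. B.joined (f q) R (f (x m)) (f (y n))" by blast
qed

lemma same_end_preimage:
  assumes v: "v \<in> B.gromov_sequences (f q)" and same: "B.same_end (f q) (\<lambda>n. f (x n)) v" and x: "range x \<subseteq> N"
  shows "A.gromov_sequences q \<noteq> {}"
proof -
  obtain k where k: "\<And>m n. m \<ge> k \<Longrightarrow> n \<ge> k \<Longrightarrow> B.joined (f q) 0 (f (x m)) (v n)"
    using same unfolding B.same_end_def by meson
  have "v n \<in> f ` N" if n: "n \<ge> k" for n
  proof -
    obtain S where S: "connectedin B.mtopology S" "f (x n) \<in> S" "v n \<in> S" "\<forall>z\<in>S. 0 < d (f q) z"
      using k[OF n n] unfolding B.joined_def by blast
    have "f q \<notin> S" using S(4) f_in[OF root] by fastforce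
    with connectedin_branch[OF S(1) _ S(2)] x S(3) show ?thesis by blast
  qed
  then have "v n = f (if n \<ge> k then inv_into N f (v n) else q)" if "n \<ge> k" for n
    using that by (simp add: f_inv_into_f)
  moreover have "range (\<lambda>n. if n \<ge> k then inv_into N f (v n) else q) \<subseteq> N"
    using \<open>\<And>n. n \<ge> k \<Longrightarrow> v n \<in> f ` N\<close> root by (auto simp: inv_into_into)
  ultimately show ?thesis using gromov_sequence_preimage[OF v] by blast
qed

lemma ray_image:
  assumes "\<gamma> \<in> A.geodesic_rays"
  shows "(\<lambda>t\<in>{0..}. f (\<gamma> t)) \<in> B.geodesic_rays"
proof -
  note r = A.rayD(1,2)[OF assms]
  have "d (f (\<gamma> s)) (f (\<gamma> t)) = \<bar>s - t\<bar>" if "s \<ge> 0" "t \<ge> 0" for s t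
    using isometric[OF r(1)[OF that(1)] r(1)[OF that(2)]] r(2)[OF that] by simp
  then show ?thesis unfolding B.geodesic_rays_def by (auto intro: f_in[OF r(1)])
qed

lemma asymptotic_image:
  assumes \<gamma>: "\<gamma>1 \<in> A.geodesic_rays" "\<gamma>2 \<in> A.geodesic_rays"
    and "((\<lambda>t\<in>{0..}. f (\<gamma>1 t)), (\<lambda>t\<in>{0..}. f (\<gamma>2 t))) \<in> B.asymptotic"
  shows "(\<gamma>1, \<gamma>2) \<in> A.asymptotic"
proof -
  obtain C where C: "\<forall>t\<ge>0. d (f (\<gamma>1 t)) (f (\<gamma>2 t)) \<le> C"
    using assms(3) unfolding B.asymptotic_def by auto
  have "e (\<gamma>1 t) (\<gamma>2 t) \<le> C" if "t \<ge> 0" for t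
    using isometric[OF A.rayD(1)[OF \<gamma>(1) that] A.rayD(1)[OF \<gamma>(2) that]] C[rule_format, OF that]
    by linarith
  then show ?thesis using \<gamma> unfolding A.asymptotic_def by blast
qed

lemma discrete_ray_preimage:
  assumes \<gamma>: "\<gamma> \<in> B.geodesic_rays" and z: "range z \<subseteq> N" and "\<And>n. n \<ge> j \<Longrightarrow> \<gamma> (real n) = f (z n)"
  shows "A.discrete_ray (\<lambda>n. z (n + j))"
  unfolding A.discrete_ray_def
proof (intro conjI allI)
  show "range (\<lambda>n. z (n + j)) \<subseteq> N" using z by blast
  fix m n
  have "e (z (m + j)) (z (n + j)) = d (f (z (m + j))) (f (z (n + j)))"
    using isometric[of "z (m + j)" "z (n + j)"] z by (simp add: range_subsetD)
  also have "\<dots> = \<bar>real (m + j) - real (n + j)\<bar>"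
    using assms(3)[of "m + j"] assms(3)[of "n + j"] B.rayD(2)[OF \<gamma>, of "real (m + j)" "real (n + j)"] by simp
  finally show "e (z (m + j)) (z (n + j)) = \<bar>real m - real n\<bar>" by simp
qed

end

text \<open>
  The properties of the branches \<open>N2\<close> and \<open>N4\<close> are absolute: \<open>N2\<close> contains no discrete ray and \<open>N4\<close> no
  Gromov sequence at all. This makes them independent of the other branches.
\<close>
theorem neither_inj_nor_surj_of_branches:
  assumes "Metric_space M d" "Metric_space.cn_space M d" "Metric_space.mcomplete M d" "b \<in> M"
    and flat: "branch N1 e1 M d f1 q1" "f1 q1 = p"
      "\<gamma>1 \<in> Metric_space.geodesic_rays N1 e1" "\<gamma>2 \<in> Metric_space.geodesic_rays N1 e1"
      "(\<gamma>1, \<gamma>2) \<notin> Metric_space.asymptotic N1 e1"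
      "((\<lambda>n. \<gamma>1 (real n)), (\<lambda>n. \<gamma>2 (real n))) \<in> Metric_space.gromov_E N1 e1 q1"
    and rayless: "branch N2 e2 M d f2 q2" "f2 q2 = p"
      "x \<in> Metric_space.gromov_sequences N2 e2 q2" "\<And>z. \<not> Metric_space.discrete_ray N2 e2 z"
    and hyperbolic: "branch N3 e3 M d f3 q3" "f3 q3 = p"
      "y \<in> Metric_space.gromov_sequences N3 e3 q3" "z \<in> Metric_space.gromov_sequences N3 e3 q3"
      "Metric_space.same_end N3 e3 q3 y z" "(y, z) \<notin> (Metric_space.gromov_E N3 e3 q3)\<^sup>+"
    and spiral: "branch N4 e4 M d f4 q4" "f4 q4 = p"
      "range w \<subseteq> N4" "Metric_space.same_end N4 e4 q4 w w" "Metric_space.gromov_sequences N4 e4 q4 = {}"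
  shows "neither_inj_nor_surj (Metric_space.nu M d b)
           (Metric_space.ideal_boundary M d) (Metric_space.gromov_boundary M d b)"
    "neither_inj_nor_surj (Metric_space.phi M d b)
       (Metric_space.gromov_boundary M d b) (Metric_space.end_boundary M d b)"
    "neither_inj_nor_surj (Metric_space.eps M d b)
       (Metric_space.ideal_boundary M d) (Metric_space.end_boundary M d b)"
proof -
  interpret Metric_space M d by fact
  interpret B1: branch N1 e1 M d f1 q1 by fact
  interpret B2: branch N2 e2 M d f2 q2 by fact
  interpret B3: branch N3 e3 M d f3 q3 by fact
  interpret B4: branch N4 e4 M d f4 q4 by fact
  have p: "p \<in> M" using B1.f_in[OF B1.root] flat(2) by simp
  define \<delta>1 \<delta>2 where "\<delta>1 = (\<lambda>t\<in>{0..}. f1 (\<gamma>1 t))" and "\<delta>2 = (\<lambda>t\<in>{0..}. f1 (\<gamma>2 t))"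
  have \<delta>: "\<delta>1 \<in> geodesic_rays" "\<delta>2 \<in> geodesic_rays" "(\<delta>1, \<delta>2) \<notin> asymptotic"
    unfolding \<delta>1_def \<delta>2_def
    using B1.ray_image[OF flat(3)] B1.ray_image[OF flat(4)] B1.asymptotic_image[OF flat(3,4)] flat(5) by auto
  have \<delta>E: "((\<lambda>n. \<delta>1 (real n)), (\<lambda>n. \<delta>2 (real n))) \<in> (gromov_E p)\<^sup>+"
    using B1.gromov_E_image[OF flat(6)] unfolding \<delta>1_def \<delta>2_def flat(2) by auto
  have x: "(\<lambda>n. f2 (x n)) \<in> gromov_sequences p"
    using B2.gromov_sequence_image[OF rayless(3)] rayless(2) by simp
  have no_ray: "((\<lambda>n. f2 (x n)), \<lambda>n. \<gamma> (real n)) \<notin> (gromov_E p)\<^sup>+" if \<gamma>: "\<gamma> \<in> geodesic_rays" for \<gamma>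
  proof
    assume "((\<lambda>n. f2 (x n)), \<lambda>n. \<gamma> (real n)) \<in> (gromov_E p)\<^sup>+"
    then obtain z j where z: "(x, z) \<in> (B2.A.gromov_E q2)\<^sup>+" "\<And>n. n \<ge> j \<Longrightarrow> \<gamma> (real n) = f2 (z n)"
      using B2.gromov_equivalent_preimage[OF rayless(3), unfolded rayless(2)] by blast
    have "z \<in> B2.A.gromov_sequences q2" using z(1) equiv_type[OF B2.A.equiv_gromov] by blast
    then have "range z \<subseteq> N2" by (auto simp: B2.A.gromov_sequences_iff)
    from B2.discrete_ray_preimage[OF \<gamma> this z(2)] rayless(4) show False by blast
  qed
  have yz: "(\<lambda>n. f3 (y n)) \<in> gromov_sequences p" "(\<lambda>n. f3 (z n)) \<in> gromov_sequences p"
    "same_end p (\<lambda>n. f3 (y n)) (\<lambda>n. f3 (z n))"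
    using B3.gromov_sequence_image[OF hyperbolic(3)] B3.gromov_sequence_image[OF hyperbolic(4)]
      B3.same_end_image[OF hyperbolic(5)] unfolding hyperbolic(2) by auto
  have yzE: "((\<lambda>n. f3 (y n)), (\<lambda>n. f3 (z n))) \<notin> (gromov_E p)\<^sup>+"
  proof
    assume "((\<lambda>n. f3 (y n)), (\<lambda>n. f3 (z n))) \<in> (gromov_E p)\<^sup>+"
    then obtain u j where u: "(y, u) \<in> (B3.A.gromov_E q3)\<^sup>+" "\<And>n. n \<ge> j \<Longrightarrow> f3 (z n) = f3 (u n)"
      using B3.gromov_equivalent_preimage[OF hyperbolic(3), unfolded hyperbolic(2)] by blast
    have uG: "u \<in> B3.A.gromov_sequences q3" using u(1) equiv_type[OF B3.A.equiv_gromov] by blast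
    have uz: "u n \<in> N3" "z n \<in> N3" for n
      using uG hyperbolic(4) by (auto simp: B3.A.gromov_sequences_iff)
    have eq: "u n = z n" if "n \<ge> j" for n
      using u(2)[OF that] B3.isometric[of "z n" "u n"] uz[of n] B3.f_in[of "u n"] by simp
    have "(u, z) \<in> B3.A.gromov_E q3"
      unfolding B3.A.gromov_E_iff
    proof (intro conjI uG hyperbolic(4) allI)
      fix K
      obtain i where "\<And>m n. m \<ge> i \<Longrightarrow> n \<ge> i \<Longrightarrow> K \<le> B3.A.gromov_product q3 (u m) (u n)"
        using uG unfolding B3.A.gromov_sequences_iff by meson
      then show "\<exists>N. \<forall>m\<ge>N. \<forall>n\<ge>N. K \<le> B3.A.gromov_product q3 (u m) (z n)"
        using eq by (metis max.bounded_iff)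
    qed
    with u(1) hyperbolic(6) show False using trancl_into_trancl by metis
  qed
  have w: "same_end p (\<lambda>n. f4 (w n)) (\<lambda>n. f4 (w n))"
    using B4.same_end_image[OF spiral(4)] spiral(2) by simp
  have w': "\<not> same_end p (\<lambda>n. f4 (w n)) v" if "v \<in> gromov_sequences p" for v
    using B4.same_end_preimage[OF _ _ spiral(3), unfolded spiral(2), of v] spiral(5) that by blast
  show "neither_inj_nor_surj (nu b) ideal_boundary (gromov_boundary b)"
    "neither_inj_nor_surj (phi b) (gromov_boundary b) (end_boundary b)"
    "neither_inj_nor_surj (eps b) ideal_boundary (end_boundary b)"
    using neither_inj_nor_surj_natural_maps[OF assms(2,3) p assms(4) \<delta> \<delta>E x no_ray yz yzE w w'] by blast+
qed

section \<open>Hedgehogs\<close>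

text \<open>
  The legs are the fibres of \<open>leg\<close>. The centre lies in only one of them, but as it has height \<open>0\<close>, the
  condition on points of different legs is correct for it as well.
\<close>
locale hedgehog = Metric_space M d for M :: "'a set" and d +
  fixes p :: 'a and leg :: "'a \<Rightarrow> 'l"
  assumes centre: "p \<in> M"
    and legs_apart: "x \<in> M \<Longrightarrow> y \<in> M \<Longrightarrow> leg x \<noteq> leg y \<Longrightarrow> d x y = d p x + d p y"
    and legs_bounded: "\<exists>B. \<forall>x\<in>M. leg x = i \<longrightarrow> d p x \<le> B"
begin

lemma no_gromov_sequence: "gromov_sequences p = {}"
proof (rule equals0I)
  fix x assume "x \<in> gromov_sequences p"
  then have M: "x n \<in> M" and K: "\<exists>N. \<forall>m\<ge>N. \<forall>n\<ge>N. K \<le> gromov_product p (x m) (x n)" for n K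
    unfolding gromov_sequences_iff by auto
  obtain j where j: "\<And>m n. m \<ge> j \<Longrightarrow> n \<ge> j \<Longrightarrow> 1 \<le> gromov_product p (x m) (x n)" using K[of 1] by blast
  have leg: "leg (x n) = leg (x j)" if "n \<ge> j" for n
  proof (rule ccontr)
    assume "leg (x n) \<noteq> leg (x j)"
    then have "gromov_product p (x n) (x j) = 0"
      using legs_apart[OF M M] by (simp add: gromov_product_def commute)
    with j[of n j] that show False by simp
  qed
  obtain B where B: "\<forall>y\<in>M. leg y = leg (x j) \<longrightarrow> d p y \<le> B" using legs_bounded by blast
  obtain k where k: "\<And>m n. m \<ge> k \<Longrightarrow> n \<ge> k \<Longrightarrow> B + 1 \<le> gromov_product p (x m) (x n)" using K[of "B + 1"] by blast
  define n where "n = max j k"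
  have "B + 1 \<le> gromov_product p (x n) (x n)" using k by (simp add: n_def)
  also have "\<dots> = d p (x n)" using M[of n] by (simp add: gromov_product_def commute)
  also have "\<dots> \<le> B" using B M[of n] leg[of n] by (simp add: n_def)
  finally show False by simp
qed

text \<open>
  Far from the centre the sequence would have to stay on one leg, as a jump to another leg costs the
  sum of the heights. The speed \<open>c\<close> is arbitrary because the components of a ray in a product have
  speeds that may be less than \<open>1\<close>.
\<close>
lemma no_linear_sequence:
  assumes z: "\<And>n. z n \<in> M" and c: "c > 0" and dz: "\<And>m n. m \<le> n \<Longrightarrow> d (z m) (z n) = c * (real n - real m)"
  shows False
proof -
  define r where "r n = d p (z n)" for n
  have r: "c * n - r 0 \<le> r n" for n
    using dz[of 0 n] triangle[OF z centre z, of 0 n] by (simp add: r_def commute)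
  obtain m :: nat where m: "2 * r 0 + 1 < m * c" using reals_Archimedean3[OF c] by blast
  have leg: "leg (z n) = leg (z m)" if "n \<ge> m" for n
  proof (rule ccontr)
    assume "leg (z n) \<noteq> leg (z m)"
    then have "d (z m) (z n) = r m + r n" using legs_apart[OF z z, of m n] by (simp add: r_def)
    then have "c * n - c * m = r m + r n" using dz[OF that] by (simp add: algebra_simps)
    moreover have "c * m > 2 * r 0 + 1" using m by (simp add: mult.commute)
    moreover have "r 0 \<ge> 0" by (simp add: r_def)
    ultimately show False using r[of m] r[of n] by linarith
  qed
  obtain B where B: "\<forall>y\<in>M. leg y = leg (z m) \<longrightarrow> d p y \<le> B" using legs_bounded by blast
  obtain k :: nat where k: "B + r 0 < k * c" using reals_Archimedean3[OF c] by blast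
  define n where "n = max m k"
  have "r n \<le> B" using B leg[of n] z by (simp add: n_def r_def)
  moreover have "k * c \<le> c * n" using c by (simp add: n_def mult.commute)
  ultimately show False using r[of n] k by linarith
qed

lemma ideal_boundary_empty: "ideal_boundary = {}"
proof -
  have "\<gamma> \<notin> geodesic_rays" for \<gamma>
  proof
    assume "\<gamma> \<in> geodesic_rays"
    from rayD(1,2)[OF this] show False by (intro no_linear_sequence[of "\<lambda>n. \<gamma> (real n)" 1]) auto
  qed
  then show ?thesis unfolding ideal_boundary_def by auto
qed

text \<open>
  Outside a ball around \<open>b\<close> that contains the centre each component lies on one leg. So it is bounded,
  and its intersection with the complement of a larger ball is empty.
\<close>
lemma end_boundary_empty:
  assumes b: "b \<in> M" shows "end_boundary b = {}"
proof (rule equals0I)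
  fix U assume U: "U \<in> end_boundary b"
  obtain k :: nat where k: "d b p < k" using reals_Archimedean2 by blast
  define m where "m = max k 1"
  have m: "m \<ge> 1" "d b p < m" using k by (auto simp: m_def)
  note C = end_boundary_component[OF U]
  have out: "z \<in> M" "n \<le> d b z" if "n \<ge> 1" "z \<in> U n" for z n
    using ball_complement_outside[OF b, of z n] connected_components_of_subset[OF C[OF that(1)]] that by auto
  obtain x where x: "x \<in> U m" using nonempty_connected_components_of[OF C[OF m(1)]] by blast
  define N where "N = insert p {y \<in> M. leg y = leg x}"
  have "branch N d M d id p"
  proof (intro branch.intro branch_axioms.intro)
    show "Metric_space N d" by (rule subspace) (auto simp: N_def centre)
    show "d (id y) v = d (id y) (id p) + d (id p) v" if "y \<in> N" "v \<in> M" "v \<notin> id ` N" for y v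
      using that legs_apart[of y v] centre by (auto simp: N_def commute)
  qed (auto simp: N_def centre intro: Metric_space_axioms)
  then interpret branch N d M d id p .
  have "connectedin mtopology (U m)"
    using connectedin_connected_components_of[OF C[OF m(1)]]
    unfolding ball_complement_def connectedin_subtopology by blast
  moreover have "id p \<notin> U m" using out[of m p] m by auto
  moreover have "x \<in> N" using out[OF m(1) x] by (simp add: N_def)
  ultimately have UN: "U m \<subseteq> N" using connectedin_branch[of "U m" x] x by simp
  obtain B where B: "\<forall>y\<in>M. leg y = leg x \<longrightarrow> d p y \<le> B" using legs_bounded by blast
  have "d p x \<le> B" using B out(1)[OF m(1) x] by blast
  then have "0 \<le> B" using nonneg[of p x] by linarith
  obtain j :: nat where j: "d b p + B < j" using reals_Archimedean2 by blast
  define n where "n = max m j"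
  have "U n \<subseteq> U m" if "n \<ge> m" for n
    using that
  proof (induction rule: dec_induct)
    case (step i)
    then have "U (Suc i) \<subseteq> U i" using U m(1) unfolding end_boundary_def by simp
    with step(3) show ?case by blast
  qed simp
  then have sub: "U n \<subseteq> U m" by (simp add: n_def)
  have n: "n \<ge> 1" using m by (simp add: n_def)
  obtain z where z: "z \<in> U n" using nonempty_connected_components_of[OF C[OF n]] by blast
  have "d p z \<le> B" using UN sub z B \<open>0 \<le> B\<close> centre by (auto simp: N_def)
  moreover have "real n \<le> d b p + d p z" using triangle[OF b centre out(1)[OF n z]] out(2)[OF n z] by linarith
  ultimately show False using j by (simp add: n_def)
qed

end

section \<open>Gluing at a point, products and wedges\<close>

lemma cn_scalar_convex:
  fixes A B D l m :: real
  assumes "0 \<le> l" "l \<le> 1" "\<bar>A - B\<bar> \<le> D" "0 \<le> A" "0 \<le> B"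
    and "m\<^sup>2 \<le> (1 - l) * A\<^sup>2 + l * B\<^sup>2 - l * (1 - l) * D\<^sup>2"
  shows "m \<le> (1 - l) * A + l * B"
proof -
  have "(A - B)\<^sup>2 \<le> D\<^sup>2" using power_mono[OF assms(3), of 2] by simp
  then have "l * (1 - l) * (A - B)\<^sup>2 \<le> l * (1 - l) * D\<^sup>2" using assms by (intro mult_left_mono) auto
  then have "m\<^sup>2 \<le> (1 - l) * A\<^sup>2 + l * B\<^sup>2 - l * (1 - l) * (A - B)\<^sup>2" using assms by linarith
  also have "\<dots> = ((1 - l) * A + l * B)\<^sup>2" by (simp add: power2_eq_square algebra_simps)
  finally show ?thesis by (rule power2_le_imp_le) (use assms in auto)
qed

text \<open>
  For a point \<open>z\<close> on the other side of the gluing point all distances exceed those of the gluing point by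
  \<open>w\<close>. The inequality survives because \<open>m\<close>, and not only \<open>m\<^sup>2\<close>, satisfies a convexity bound.
\<close>
lemma cn_scalar_add:
  fixes A B D l m w :: real
  assumes "0 \<le> l" "l \<le> 1" "\<bar>A - B\<bar> \<le> D" "0 \<le> A" "0 \<le> B" "0 \<le> w"
    and m: "m\<^sup>2 \<le> (1 - l) * A\<^sup>2 + l * B\<^sup>2 - l * (1 - l) * D\<^sup>2"
  shows "(m + w)\<^sup>2 \<le> (1 - l) * (A + w)\<^sup>2 + l * (B + w)\<^sup>2 - l * (1 - l) * D\<^sup>2"
proof -
  have "2 * w * m \<le> 2 * w * ((1 - l) * A + l * B)"
    using cn_scalar_convex[OF assms(1-5) m] assms by (intro mult_left_mono) auto
  with m show ?thesis by (simp add: power2_eq_square algebra_simps)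
qed

text \<open>
  These two lemmas are the inequality along a geodesic of length \<open>s + t\<close> that passes through the gluing
  point at time \<open>s\<close>, evaluated at time \<open>l (s + t) \<le> s\<close>. Here the third point \<open>z\<close> lies on the side of
  \<open>x\<close>, with distances \<open>A\<close> to \<open>x\<close> and \<open>P\<close> to the gluing point. The difference of the two bounds is the
  nonnegative number \<open>(l t / s) (A\<^sup>2 - (P - s)\<^sup>2)\<close>.
\<close>
lemma cn_scalar_glue:
  fixes A P s t l k u :: real
  assumes "0 \<le> l" "0 < s" "0 \<le> t" "k * s = l * (s + t)" "\<bar>P - s\<bar> \<le> A"
    and u: "u \<le> (1 - k) * A\<^sup>2 + k * P\<^sup>2 - k * (1 - k) * s\<^sup>2"
  shows "u \<le> (1 - l) * A\<^sup>2 + l * (P + t)\<^sup>2 - l * (1 - l) * (s + t)\<^sup>2"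
proof -
  have k: "k = l * (s + t) / s" using assms by (simp add: field_simps)
  have "(P - s)\<^sup>2 \<le> A\<^sup>2" using power_mono[OF assms(5), of 2] by simp
  then have "0 \<le> l * t / s * (A\<^sup>2 - (P - s)\<^sup>2)" using assms by simp
  also have "\<dots> = ((1 - l) * A\<^sup>2 + l * (P + t)\<^sup>2 - l * (1 - l) * (s + t)\<^sup>2)
     - ((1 - k) * A\<^sup>2 + k * P\<^sup>2 - k * (1 - k) * s\<^sup>2)"
    unfolding k using assms(2) by (simp add: field_simps power2_eq_square)
  finally show ?thesis using u by linarith
qed

text \<open>
  Here \<open>z\<close> lies on the side of \<open>y\<close>, with distances \<open>w\<close> to the gluing point and \<open>B\<close> to \<open>y\<close>. With \<open>B = \<bar>w - t\<bar>\<close>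
  the inequality is an identity.
\<close>
lemma cn_scalar_opposite:
  fixes w s t l B :: real
  assumes "0 \<le> l" "\<bar>w - t\<bar> \<le> B"
  shows "(s - l * (s + t) + w)\<^sup>2 \<le> (1 - l) * (s + w)\<^sup>2 + l * B\<^sup>2 - l * (1 - l) * (s + t)\<^sup>2"
proof -
  have "(w - t)\<^sup>2 \<le> B\<^sup>2" using power_mono[OF assms(2), of 2] by simp
  then have "l * (w - t)\<^sup>2 \<le> l * B\<^sup>2" using assms by (intro mult_left_mono)
  moreover have "(s - l * (s + t) + w)\<^sup>2 = (1 - l) * (s + w)\<^sup>2 + l * (w - t)\<^sup>2 - l * (1 - l) * (s + t)\<^sup>2"
    by (simp add: power2_eq_square algebra_simps)
  ultimately show ?thesis by linarith
qed

context Metric_space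
begin

text \<open>
  The point \<open>m\<close> lies on the side of \<open>x\<close>; on the geodesic from \<open>x\<close> to \<open>p\<close> it has the parameter \<open>k\<close>.
\<close>
lemma cn_glue_aux:
  assumes M: "M = A \<union> B" and p: "p \<in> A" "p \<in> B"
    and glue: "\<And>x y. x \<in> A \<Longrightarrow> y \<in> B \<Longrightarrow> d x y = d x p + d p y"
    and A: "Metric_space.cn_space A d"
    and x: "x \<in> A" and y: "y \<in> B" and l: "0 \<le> l" "l \<le> 1" and near: "l * d x y \<le> d x p"
  shows "\<exists>m\<in>M. \<forall>z\<in>M. (d z m)\<^sup>2 \<le> (1 - l) * (d z x)\<^sup>2 + l * (d z y)\<^sup>2 - l * (1 - l) * (d x y)\<^sup>2"
proof -
  interpret A: Metric_space A d by (rule subspace) (simp add: M)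
  define s t where "s = d x p" and "t = d p y"
  have st: "0 \<le> s" "0 \<le> t" "d x y = s + t" using glue[OF x y] by (auto simp: s_def t_def)
  show ?thesis
  proof (cases "s = 0")
    case True
    have "l * t \<le> 0" using near True st(3) unfolding s_def[symmetric] by simp
    then have "l = 0 \<or> d x y = 0" using st True l(1) by (auto simp: mult_le_0_iff)
    then consider "l = 0" | "x = y" using x y M by auto
    then show ?thesis by cases (use x y M in \<open>auto simp: algebra_simps intro!: bexI[of _ x]\<close>)
  next
    case False
    with st have s: "0 < s" by simp
    define k where "k = l * (s + t) / s"
    have ks: "k * s = l * (s + t)" using s by (simp add: k_def)
    have k: "0 \<le> k" "k \<le> 1" using near st l s by (auto simp: k_def s_def[symmetric])
    obtain m where m: "m \<in> A" and cn: "\<And>z. z \<in> A \<Longrightarrow>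
        (d z m)\<^sup>2 \<le> (1 - k) * (d z x)\<^sup>2 + k * (d z p)\<^sup>2 - k * (1 - k) * (d x p)\<^sup>2"
      using A[unfolded A.cn_space_def, rule_format, OF x p(1), of k] k by auto
    have mp: "d m p = (1 - k) * s" using A.cn_point_dist(2)[OF x p(1) m k cn] by (simp add: s_def)
    have "(d z m)\<^sup>2 \<le> (1 - l) * (d z x)\<^sup>2 + l * (d z y)\<^sup>2 - l * (1 - l) * (d x y)\<^sup>2" if z: "z \<in> M" for z
    proof (cases "z \<in> A")
      case True
      have "d z y = d z p + t" using glue[OF True y] by (simp add: t_def)
      moreover have "\<bar>d z p - s\<bar> \<le> d z x"
        using triangle[of z x p] triangle[of x z p] True x p M by (auto simp: s_def commute)
      ultimately show ?thesis
        using cn_scalar_glue[OF l(1) s st(2) ks _ cn[OF True, folded s_def]] st(3) by simp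
    next
      case False
      then have zB: "z \<in> B" using z M by auto
      define w where "w = d p z"
      have "d z m = s - l * (s + t) + w" "d z x = s + w"
        using glue[OF m zB] glue[OF x zB] mp ks by (auto simp: w_def s_def commute algebra_simps)
      moreover have "\<bar>w - t\<bar> \<le> d z y"
        using triangle[of p z y] triangle[of p y z] z y p M by (auto simp: w_def t_def commute)
      ultimately show ?thesis using cn_scalar_opposite[OF l(1), of w t "d z y" s] st(3) by simp
    qed
    then show ?thesis using m M by blast
  qed
qed

lemma cn_glue_same:
  assumes M: "M = A \<union> B" and p: "p \<in> A" "p \<in> B"
    and glue: "\<And>x y. x \<in> A \<Longrightarrow> y \<in> B \<Longrightarrow> d x y = d x p + d p y"
    and A: "Metric_space.cn_space A d"
    and x: "x \<in> A" and y: "y \<in> A" and l: "0 \<le> l" "l \<le> 1"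
  shows "\<exists>m\<in>M. \<forall>z\<in>M. (d z m)\<^sup>2 \<le> (1 - l) * (d z x)\<^sup>2 + l * (d z y)\<^sup>2 - l * (1 - l) * (d x y)\<^sup>2"
proof -
  interpret A: Metric_space A d by (rule subspace) (simp add: M)
  obtain m where m: "m \<in> A" and cn: "\<And>z. z \<in> A \<Longrightarrow>
      (d z m)\<^sup>2 \<le> (1 - l) * (d z x)\<^sup>2 + l * (d z y)\<^sup>2 - l * (1 - l) * (d x y)\<^sup>2"
    using A[unfolded A.cn_space_def, rule_format, OF x y, of l] l by auto
  have "(d z m)\<^sup>2 \<le> (1 - l) * (d z x)\<^sup>2 + l * (d z y)\<^sup>2 - l * (1 - l) * (d x y)\<^sup>2" if z: "z \<in> M" for z
  proof (cases "z \<in> A")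
    case False
    then have zB: "z \<in> B" using z M by auto
    have "d z u = d p u + d p z" if "u \<in> A" for u using glue[OF that zB] by (simp add: commute)
    moreover have "\<bar>d p x - d p y\<bar> \<le> d x y"
      using triangle[of p x y] triangle[of p y x] x y p M by (auto simp: commute)
    ultimately show ?thesis using cn_scalar_add[OF l _ _ _ _ cn[OF p(1)], of "d p z"] x y m by simp
  qed (rule cn)
  then show ?thesis using m M by blast
qed

lemma cn_glue:
  assumes M: "M = A \<union> B" and p: "p \<in> A" "p \<in> B"
    and glue: "\<And>x y. x \<in> A \<Longrightarrow> y \<in> B \<Longrightarrow> d x y = d x p + d p y"
    and A: "Metric_space.cn_space A d" and B: "Metric_space.cn_space B d"
  shows cn_space
  unfolding cn_space_def
proof (intro ballI)
  fix x y and l :: real assume x: "x \<in> M" and y: "y \<in> M" and "l \<in> {0..1}"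
  then have l: "0 \<le> l" "l \<le> 1" by auto
  have M': "M = B \<union> A" using M by auto
  have glue': "d x y = d x p + d p y" if "x \<in> B" "y \<in> A" for x y
    using glue[OF that(2,1)] by (simp add: commute)
  note swap = M' p(2,1) glue'
  have across: "\<exists>m\<in>M. \<forall>z\<in>M. (d z m)\<^sup>2 \<le> (1 - l) * (d z x)\<^sup>2 + l * (d z y)\<^sup>2 - l * (1 - l) * (d x y)\<^sup>2"
    if x: "x \<in> A" and y: "y \<in> B" and l: "0 \<le> l" "l \<le> 1" for x y l
  proof (cases "l * d x y \<le> d x p")
    case True
    show ?thesis by (rule cn_glue_aux[OF M p glue A x y l True])
  next
    case False
    then have "(1 - l) * d y x \<le> d y p" using glue[OF x y] by (simp add: commute algebra_simps)
    then have "\<exists>m\<in>M. \<forall>z\<in>M. (d z m)\<^sup>2 \<le> (1 - (1 - l)) * (d z y)\<^sup>2 + (1 - l) * (d z x)\<^sup>2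
        - (1 - l) * (1 - (1 - l)) * (d y x)\<^sup>2"
      using l by (intro cn_glue_aux[OF swap B y x]) auto
    then show ?thesis by (simp add: commute algebra_simps)
  qed
  consider "x \<in> A" "y \<in> A" | "x \<in> B" "y \<in> B" | "x \<in> A" "y \<in> B" | "x \<in> B" "y \<in> A"
    using x y M by blast
  then show "\<exists>m\<in>M. \<forall>z\<in>M. (d z m)\<^sup>2 \<le> (1 - l) * (d z x)\<^sup>2 + l * (d z y)\<^sup>2 - l * (1 - l) * (d x y)\<^sup>2"
  proof cases
    case 1 show ?thesis by (rule cn_glue_same[OF M p glue A 1 l])
  next
    case 2 show ?thesis by (rule cn_glue_same[OF swap B 2 l])
  next
    case 3 show ?thesis by (rule across[OF 3 l])
  next
    case 4
    have "\<exists>m\<in>M. \<forall>z\<in>M. (d z m)\<^sup>2 \<le> (1 - (1 - l)) * (d z y)\<^sup>2 + (1 - l) * (d z x)\<^sup>2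
        - (1 - l) * (1 - (1 - l)) * (d y x)\<^sup>2"
      using l by (intro across[OF 4(2,1)]) auto
    then show ?thesis by (simp add: commute algebra_simps)
  qed
qed

end

lemma isometric_image:
  assumes "Metric_space N e" "Metric_space (f ` N) d"
    and iso: "\<And>x y. x \<in> N \<Longrightarrow> y \<in> N \<Longrightarrow> d (f x) (f y) = e x y"
  shows "Metric_space.cn_space N e \<Longrightarrow> Metric_space.cn_space (f ` N) d"
    and "Metric_space.mcomplete N e \<Longrightarrow> Metric_space.mcomplete (f ` N) d"
proof -
  interpret A: Metric_space N e by fact
  interpret B: Metric_space "f ` N" d by fact
  show "B.cn_space" if A.cn_space
    using that unfolding A.cn_space_def B.cn_space_def by (simp add: iso)
  show "B.mcomplete" if complete: A.mcomplete
    unfolding B.mcomplete_def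
  proof (intro allI impI)
    fix \<sigma> :: "nat \<Rightarrow> _" assume \<sigma>: "B.MCauchy \<sigma>"
    define \<tau> where "\<tau> n = inv_into N f (\<sigma> n)" for n
    have \<tau>: "\<tau> n \<in> N" "\<sigma> n = f (\<tau> n)" for n
    proof -
      have "\<sigma> n \<in> f ` N" using \<sigma> unfolding B.MCauchy_def by (simp add: image_subset_iff)
      then show "\<tau> n \<in> N" "\<sigma> n = f (\<tau> n)" by (simp_all add: \<tau>_def inv_into_into f_inv_into_f)
    qed
    have "d (\<sigma> m) (\<sigma> n) = e (\<tau> m) (\<tau> n)" for m n using \<tau> iso by simp
    then have "A.MCauchy \<tau>" using \<sigma> \<tau>(1) unfolding A.MCauchy_def B.MCauchy_def by auto
    then obtain x where x: "limitin A.mtopology \<tau> x sequentially"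
      using complete unfolding A.mcomplete_def by blast
    then have "x \<in> N" by (simp add: A.limit_metric_sequentially)
    then have "limitin B.mtopology \<sigma> (f x) sequentially"
      using x unfolding A.limit_metric_sequentially B.limit_metric_sequentially by (simp add: \<tau> iso)
    then show "\<exists>x. limitin B.mtopology \<sigma> x sequentially" by blast
  qed
qed

text \<open>
  Transport of a metric along an injective map, used to move a space into the type of real sequences.
\<close>
definition pull_dist :: "'a set \<Rightarrow> ('a \<Rightarrow> 'b) \<Rightarrow> ('a \<Rightarrow> 'a \<Rightarrow> real) \<Rightarrow> 'b \<Rightarrow> 'b \<Rightarrow> real" where
  "pull_dist N f e x y = e (inv_into N f x) (inv_into N f y)"

lemma pull_dist_image: "inj_on f N \<Longrightarrow> x \<in> N \<Longrightarrow> y \<in> N \<Longrightarrow> pull_dist N f e (f x) (f y) = e x y"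
  by (simp add: pull_dist_def)

lemma Metric_space_pull_dist:
  assumes "Metric_space N e" "inj_on f N" shows "Metric_space (f ` N) (pull_dist N f e)"
proof -
  interpret Metric_space N e by fact
  show ?thesis
    by unfold_locales (use assms(2) in \<open>auto simp: pull_dist_def triangle intro: commute\<close>)
qed

subsection \<open>Products\<close>

lemma (in Metric_space12) cn_space_prod:
  assumes "M1.cn_space" "M2.cn_space"
  shows "Prod_metric.cn_space"
  unfolding Prod_metric.cn_space_def
proof (intro ballI)
  fix x y l assume xy: "x \<in> M1 \<times> M2" "y \<in> M1 \<times> M2" and l: "l \<in> {0..1::real}"
  obtain x1 x2 y1 y2 where x: "x = (x1, x2)" "x1 \<in> M1" "x2 \<in> M2" and y: "y = (y1, y2)" "y1 \<in> M1" "y2 \<in> M2"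
    using xy by auto
  obtain m1 where m1: "m1 \<in> M1" "\<And>z. z \<in> M1 \<Longrightarrow>
      (d1 z m1)\<^sup>2 \<le> (1 - l) * (d1 z x1)\<^sup>2 + l * (d1 z y1)\<^sup>2 - l * (1 - l) * (d1 x1 y1)\<^sup>2"
    using assms(1)[unfolded M1.cn_space_def, rule_format, OF x(2) y(2) l] by blast
  obtain m2 where m2: "m2 \<in> M2" "\<And>z. z \<in> M2 \<Longrightarrow>
      (d2 z m2)\<^sup>2 \<le> (1 - l) * (d2 z x2)\<^sup>2 + l * (d2 z y2)\<^sup>2 - l * (1 - l) * (d2 x2 y2)\<^sup>2"
    using assms(2)[unfolded M2.cn_space_def, rule_format, OF x(3) y(3) l] by blast
  have "(prod_dist d1 d2 z (m1, m2))\<^sup>2 \<le> (1 - l) * (prod_dist d1 d2 z x)\<^sup>2 + l * (prod_dist d1 d2 z y)\<^sup>2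
      - l * (1 - l) * (prod_dist d1 d2 x y)\<^sup>2" if z: "z \<in> M1 \<times> M2" for z
  proof -
    obtain z1 z2 where z: "z = (z1, z2)" "z1 \<in> M1" "z2 \<in> M2" using z by auto
    show ?thesis unfolding x y z prod_dist_def
      using m1(2)[OF z(2)] m2(2)[OF z(3)] by (simp add: algebra_simps)
  qed
  then show "\<exists>m\<in>M1 \<times> M2. \<forall>z\<in>M1 \<times> M2. (prod_dist d1 d2 z m)\<^sup>2 \<le> (1 - l) * (prod_dist d1 d2 z x)\<^sup>2
      + l * (prod_dist d1 d2 z y)\<^sup>2 - l * (1 - l) * (prod_dist d1 d2 x y)\<^sup>2"
    using m1(1) m2(1) by blast
qed

subsection \<open>Wedges\<close>

text \<open>
  The wedge is the union of the two axes through \<open>(a, b)\<close> in the product. On it the sum of the distances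
  measures paths through \<open>(a, b)\<close>.
\<close>
definition wedge :: "'a set \<Rightarrow> 'a \<Rightarrow> 'b set \<Rightarrow> 'b \<Rightarrow> ('a \<times> 'b) set" where
  "wedge A a B b = (\<lambda>x. (x, b)) ` A \<union> (\<lambda>y. (a, y)) ` B"

definition wedge_dist :: "('a \<Rightarrow> 'a \<Rightarrow> real) \<Rightarrow> ('b \<Rightarrow> 'b \<Rightarrow> real) \<Rightarrow> 'a \<times> 'b \<Rightarrow> 'a \<times> 'b \<Rightarrow> real" where
  "wedge_dist d1 d2 = (\<lambda>(x, y) (x', y'). d1 x x' + d2 y y')"

locale wedge_space = Metric_space12 +
  fixes p1 p2
  assumes base: "p1 \<in> M1" "p2 \<in> M2"
begin

lemma wedge_subset: "wedge M1 p1 M2 p2 \<subseteq> M1 \<times> M2"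
  using base by (auto simp: wedge_def)

lemma Metric_space_wedge: "Metric_space (wedge M1 p1 M2 p2) (wedge_dist d1 d2)"
proof
  fix x y z assume "x \<in> wedge M1 p1 M2 p2" "y \<in> wedge M1 p1 M2 p2"
  then have xy: "x \<in> M1 \<times> M2" "y \<in> M1 \<times> M2" using wedge_subset by auto
  have "wedge_dist d1 d2 x y = 0 \<longleftrightarrow> d1 (fst x) (fst y) = 0 \<and> d2 (snd x) (snd y) = 0"
    by (simp add: wedge_dist_def case_prod_unfold add_nonneg_eq_0_iff)
  then show "wedge_dist d1 d2 x y = 0 \<longleftrightarrow> x = y" using xy by (auto simp: prod_eq_iff)
  assume "z \<in> wedge M1 p1 M2 p2"
  then have "z \<in> M1 \<times> M2" using wedge_subset by auto
  with xy show "wedge_dist d1 d2 x z \<le> wedge_dist d1 d2 x y + wedge_dist d1 d2 y z"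
    using M1.triangle[of "fst x" "fst y" "fst z"] M2.triangle[of "snd x" "snd y" "snd z"]
    by (auto simp: wedge_dist_def)
qed (auto simp: wedge_dist_def M1.commute M2.commute case_prod_unfold)

sublocale W: Metric_space "wedge M1 p1 M2 p2" "wedge_dist d1 d2"
  by (rule Metric_space_wedge)

lemma wedge_branch1: "branch M1 d1 (wedge M1 p1 M2 p2) (wedge_dist d1 d2) (\<lambda>x. (x, p2)) p1"
proof (intro branch.intro branch_axioms.intro M1.Metric_space_axioms W.Metric_space_axioms base)
  fix x v assume "x \<in> M1" "v \<in> wedge M1 p1 M2 p2" "v \<notin> (\<lambda>x. (x, p2)) ` M1"
  then show "wedge_dist d1 d2 (x, p2) v = wedge_dist d1 d2 (x, p2) (p1, p2) + wedge_dist d1 d2 (p1, p2) v"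
    using base by (auto simp: wedge_def wedge_dist_def)
qed (auto simp: wedge_def wedge_dist_def base)

lemma wedge_branch2: "branch M2 d2 (wedge M1 p1 M2 p2) (wedge_dist d1 d2) (\<lambda>y. (p1, y)) p2"
proof (intro branch.intro branch_axioms.intro M2.Metric_space_axioms W.Metric_space_axioms base)
  fix y v assume "y \<in> M2" "v \<in> wedge M1 p1 M2 p2" "v \<notin> (\<lambda>y. (p1, y)) ` M2"
  then show "wedge_dist d1 d2 (p1, y) v = wedge_dist d1 d2 (p1, y) (p1, p2) + wedge_dist d1 d2 (p1, p2) v"
    using base by (auto simp: wedge_def wedge_dist_def)
qed (auto simp: wedge_def wedge_dist_def base)

lemma wedge_parts:
  shows "Metric_space ((\<lambda>x. (x, p2)) ` M1) (wedge_dist d1 d2)"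
    "Metric_space ((\<lambda>y. (p1, y)) ` M2) (wedge_dist d1 d2)"
  by (rule W.subspace; simp add: wedge_def)+

lemma cn_space_wedge:
  assumes "M1.cn_space" "M2.cn_space" shows "W.cn_space"
proof (rule W.cn_glue[of "(\<lambda>x. (x, p2)) ` M1" "(\<lambda>y. (p1, y)) ` M2" "(p1, p2)"])
  show "Metric_space.cn_space ((\<lambda>x. (x, p2)) ` M1) (wedge_dist d1 d2)"
    using assms(1) base
    by (intro isometric_image(1)[OF M1.Metric_space_axioms wedge_parts(1)]) (auto simp: wedge_dist_def)
  show "Metric_space.cn_space ((\<lambda>y. (p1, y)) ` M2) (wedge_dist d1 d2)"
    using assms(2) base
    by (intro isometric_image(1)[OF M2.Metric_space_axioms wedge_parts(2)]) (auto simp: wedge_dist_def)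
qed (use base in \<open>auto simp: wedge_def wedge_dist_def\<close>)

lemma mcomplete_wedge:
  assumes "M1.mcomplete" "M2.mcomplete" shows "W.mcomplete"
proof -
  have "Metric_space.mcomplete ((\<lambda>x. (x, p2)) ` M1) (wedge_dist d1 d2)"
    using assms(1) base
    by (intro isometric_image(2)[OF M1.Metric_space_axioms wedge_parts(1)]) (auto simp: wedge_dist_def)
  moreover have "Metric_space.mcomplete ((\<lambda>y. (p1, y)) ` M2) (wedge_dist d1 d2)"
    using assms(2) base
    by (intro isometric_image(2)[OF M2.Metric_space_axioms wedge_parts(2)]) (auto simp: wedge_dist_def)
  ultimately have "Metric_space.mcomplete ((\<lambda>x. (x, p2)) ` M1 \<union> (\<lambda>y. (p1, y)) ` M2) (wedge_dist d1 d2)"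
    by (intro W.mcomplete_Un(2)) (auto simp: Submetric_def Submetric_axioms_def wedge_def W.Metric_space_axioms[unfolded wedge_def])
  then show ?thesis unfolding wedge_def[symmetric] .
qed

end

lemma branch_comp:
  assumes "branch N e M d f q" "branch M d L c g p" "f q = p"
  shows "branch N e L c (\<lambda>x. g (f x)) q"
proof -
  interpret F: branch N e M d f q by fact
  interpret G: branch M d L c g p by fact
  show ?thesis
  proof (intro branch.intro branch_axioms.intro F.A.Metric_space_axioms G.B.Metric_space_axioms F.root)
    show "g (f x) \<in> L" if "x \<in> N" for x using that F.f_in G.f_in by blast
    show "c (g (f x)) (g (f y)) = e x y" if "x \<in> N" "y \<in> N" for x y
      using that by (simp add: F.f_in F.isometric G.isometric)
    fix x v assume x: "x \<in> N" and v: "v \<in> L" "v \<notin> (\<lambda>x. g (f x)) ` N"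
    show "c (g (f x)) v = c (g (f x)) (g (f q)) + c (g (f q)) v"
    proof (cases "v \<in> g ` M")
      case True
      then obtain u where u: "u \<in> M" "v = g u" by blast
      then have "u \<notin> f ` N" using v by blast
      then show ?thesis
        using F.through_root[OF x u(1)] u x F.root by (simp add: G.isometric F.f_in)
    next
      case False
      then show ?thesis using G.through_root[OF F.f_in[OF x] v(1)] assms(3) by simp
    qed
  qed
qed

lemma branch_of_isometry:
  assumes "Metric_space N e" "inj_on f N" "q \<in> N"
  shows "branch N e (f ` N) (pull_dist N f e) f q"
  using assms Metric_space_pull_dist[OF assms(1,2)]
  by (intro branch.intro branch_axioms.intro) (auto simp: pull_dist_image)

section \<open>Hyperbolic convexity\<close>

lemma convex_on_nonneg_power: "convex_on {0::real..} (\<lambda>x. x ^ k)"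
  using convex_power_odd convex_on_subset[OF convex_power_even] by (cases "even k") auto

text \<open>
  The power series of \<open>cosh (sqrt q)\<close> in \<open>q\<close> has nonnegative coefficients.
\<close>
lemma convex_on_cosh_sqrt: "convex_on {0::real..} (\<lambda>q. cosh (sqrt q))"
proof (rule convex_onI)
  fix w p q :: real assume w: "0 < w" "w < 1" and pq: "p \<in> {0..}" "q \<in> {0..}"
  define r where "r = (1 - w) * p + w * q"
  have r: "r \<ge> 0" using w pq by (simp add: r_def)
  define c where "c x n = (if even n then sqrt x ^ n /\<^sub>R fact n else 0)" for x :: real and n :: nat
  have c: "c x sums cosh (sqrt x)" for x unfolding c_def by (rule cosh_converges)
  have ce: "c x n = (if even n then x ^ (n div 2) / fact n else 0)" if "x \<ge> 0" for x n
    using that by (auto simp: c_def elim!: evenE simp: power_mult divide_inverse)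
  have "c r n \<le> (1 - w) * c p n + w * c q n" for n
  proof (cases "even n")
    case True
    have "r ^ (n div 2) \<le> (1 - w) * p ^ (n div 2) + w * q ^ (n div 2)"
      using convex_onD[OF convex_on_nonneg_power, of w p q "n div 2"] w pq by (simp add: r_def)
    then have "r ^ (n div 2) / fact n \<le> ((1 - w) * p ^ (n div 2) + w * q ^ (n div 2)) / fact n"
      by (rule divide_right_mono) simp
    with True show ?thesis using r pq by (simp add: ce add_divide_distrib)
  qed (use r pq in \<open>simp add: ce\<close>)
  moreover have "(\<lambda>n. (1 - w) * c p n + w * c q n) sums ((1 - w) * cosh (sqrt p) + w * cosh (sqrt q))"
    by (intro sums_add sums_mult c)
  ultimately have "cosh (sqrt r) \<le> (1 - w) * cosh (sqrt p) + w * cosh (sqrt q)"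
    by (rule sums_le[OF _ c])
  then show "cosh (sqrt ((1 - w) *\<^sub>R p + w *\<^sub>R q)) \<le> (1 - w) * cosh (sqrt p) + w * cosh (sqrt q)"
    by (simp add: r_def)
qed simp

text \<open>
  For equal sides \<open>R\<close>, \<open>t\<close> and equal angle with cosine \<open>- s\<close>, the third side is longer in the hyperbolic than
  in the Euclidean plane. Both sides of the inequality
  \<open>cosh (sqrt (R\<^sup>2 + t\<^sup>2 + 2 s R t)) \<le> cosh R cosh t + s sinh R sinh t\<close> agree for \<open>s = 1\<close> and \<open>s = - 1\<close>; in
  between the left one is convex and the right one is linear in \<open>s\<close>.
\<close>
lemma hyperbolic_side_ge_euclidean_side:
  fixes R t s a :: real
  assumes "0 \<le> R" "0 \<le> t" "\<bar>s\<bar> \<le> 1" "0 \<le> a"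
    and a: "cosh a = cosh R * cosh t + s * (sinh R * sinh t)"
  shows "R\<^sup>2 + t\<^sup>2 + 2 * s * R * t \<le> a\<^sup>2"
proof -
  define w where "w = (1 + s) / 2"
  have w: "0 \<le> w" "w \<le> 1" using assms(3) by (auto simp: w_def)
  have q: "R\<^sup>2 + t\<^sup>2 + 2 * s * R * t = (1 - w) * (R - t)\<^sup>2 + w * (R + t)\<^sup>2"
    by (simp add: w_def power2_eq_square field_simps)
  then have q0: "R\<^sup>2 + t\<^sup>2 + 2 * s * R * t \<ge> 0" using w by simp
  have "cosh (sqrt (R\<^sup>2 + t\<^sup>2 + 2 * s * R * t)) \<le> (1 - w) * cosh (sqrt ((R - t)\<^sup>2)) + w * cosh (sqrt ((R + t)\<^sup>2))"
    unfolding q using convex_onD[OF convex_on_cosh_sqrt, of w "(R - t)\<^sup>2" "(R + t)\<^sup>2"] w by simp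
  also have "\<dots> = (1 - w) * cosh (R - t) + w * cosh (R + t)" by simp
  also have "\<dots> = cosh a" unfolding a cosh_add cosh_diff by (simp add: w_def field_simps)
  finally have "sqrt (R\<^sup>2 + t\<^sup>2 + 2 * s * R * t) \<le> a"
    using q0 assms(4) by (simp add: cosh_real_nonneg_le_iff)
  then show ?thesis using q0 by (simp add: sqrt_le_D)
qed

lemma cosh_between:
  fixes R s a :: real
  assumes "0 < R" "0 < s" "0 \<le> a" "\<bar>R - s\<bar> \<le> a" "a \<le> R + s"
  obtains \<sigma> where "\<bar>\<sigma>\<bar> \<le> 1" "cosh a = cosh R * cosh s + \<sigma> * (sinh R * sinh s)"
proof -
  have pos: "sinh R * sinh s > 0" using assms by simp
  have "cosh a \<le> cosh (R + s)" using assms by (simp add: cosh_real_nonneg_le_iff)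
  moreover have "cosh \<bar>R - s\<bar> \<le> cosh a" using assms by (subst cosh_real_nonneg_le_iff) auto
  ultimately have "\<bar>cosh a - cosh R * cosh s\<bar> \<le> sinh R * sinh s" by (simp add: cosh_add cosh_diff)
  then show ?thesis
    using pos assms(1,2) by (intro that[of "(cosh a - cosh R * cosh s) / (sinh R * sinh s)"]) (simp_all add: abs_divide)
qed

text \<open>
  Let \<open>R\<close> be the distance from \<open>z\<close> to the point \<open>m\<close>, which divides a geodesic of length \<open>D\<close>. The numbers
  \<open>- \<alpha>\<close> and \<open>- \<beta>\<close> are the cosines of hyperbolic comparison angles at \<open>m\<close>. The hypothesis \<open>H\<close> says that
  \<open>\<alpha> + \<beta> \<ge> 0\<close>, so passing to the Euclidean bounds for \<open>a\<close> and \<open>b\<close> gives the inequality.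
\<close>
lemma hyperbolic_imp_cn_ineq:
  fixes R a b D l :: real
  assumes "0 < R" "0 < l" "l < 1" "0 < D" "0 \<le> a" "0 \<le> b"
    and a: "\<bar>R - l * D\<bar> \<le> a" "a \<le> R + l * D"
    and b: "\<bar>R - (1 - l) * D\<bar> \<le> b" "b \<le> R + (1 - l) * D"
    and H: "sinh D * cosh R \<le> sinh ((1 - l) * D) * cosh a + sinh (l * D) * cosh b"
  shows "R\<^sup>2 \<le> (1 - l) * a\<^sup>2 + l * b\<^sup>2 - l * (1 - l) * D\<^sup>2"
proof -
  define s t where "s = l * D" and "t = (1 - l) * D"
  have st: "0 < s" "0 < t" "D = s + t" using assms by (auto simp: s_def t_def algebra_simps)
  obtain \<alpha> where \<alpha>: "\<bar>\<alpha>\<bar> \<le> 1" "cosh a = cosh R * cosh s + \<alpha> * (sinh R * sinh s)"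
    using cosh_between[of R s a] assms st unfolding s_def by blast
  obtain \<beta> where \<beta>: "\<bar>\<beta>\<bar> \<le> 1" "cosh b = cosh R * cosh t + \<beta> * (sinh R * sinh t)"
    using cosh_between[of R t b] assms st unfolding t_def by blast
  have "sinh (s + t) * cosh R \<le> sinh t * cosh a + sinh s * cosh b"
    unfolding st(3)[symmetric] using H by (simp add: s_def t_def)
  then have "0 \<le> (\<alpha> + \<beta>) * (sinh R * sinh s * sinh t)"
    unfolding \<alpha>(2) \<beta>(2) sinh_add by (simp add: algebra_simps)
  moreover have "sinh R * sinh s * sinh t > 0" using st assms by simp
  ultimately have "\<alpha> + \<beta> \<ge> 0" by (simp add: zero_le_mult_iff)
  then have 0: "0 \<le> 2 * (l * (1 - l) * D) * R * (\<alpha> + \<beta>)" using assms by simp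
  have "R\<^sup>2 + s\<^sup>2 + 2 * \<alpha> * R * s \<le> a\<^sup>2" "R\<^sup>2 + t\<^sup>2 + 2 * \<beta> * R * t \<le> b\<^sup>2"
    using hyperbolic_side_ge_euclidean_side[OF _ _ \<alpha>(1) _ \<alpha>(2)]
      hyperbolic_side_ge_euclidean_side[OF _ _ \<beta>(1) _ \<beta>(2)] assms st by auto
  then have "(1 - l) * (R\<^sup>2 + s\<^sup>2 + 2 * \<alpha> * R * s) + l * (R\<^sup>2 + t\<^sup>2 + 2 * \<beta> * R * t) \<le> (1 - l) * a\<^sup>2 + l * b\<^sup>2"
    using assms by (intro add_mono mult_left_mono) auto
  moreover have "(1 - l) * (R\<^sup>2 + s\<^sup>2 + 2 * \<alpha> * R * s) + l * (R\<^sup>2 + t\<^sup>2 + 2 * \<beta> * R * t)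
    = R\<^sup>2 + l * (1 - l) * D\<^sup>2 + 2 * (l * (1 - l) * D) * R * (\<alpha> + \<beta>)"
    by (simp add: s_def t_def power2_eq_square algebra_simps)
  ultimately show ?thesis using 0 by linarith
qed

context Metric_space
begin

text \<open>
  Along a geodesic of the hyperbolic plane the function \<open>u = cosh d(z, \<sqdot>)\<close> solves \<open>u'' = u\<close>; the hypothesis
  requires \<open>cosh d(z, \<sqdot>)\<close> to lie below the solution with the same boundary values.
\<close>
lemma cn_space_of_hyperbolic_convexity:
  assumes H: "\<And>x y l. x \<in> M \<Longrightarrow> y \<in> M \<Longrightarrow> x \<noteq> y \<Longrightarrow> 0 < l \<Longrightarrow> l < 1 \<Longrightarrow>
    \<exists>m\<in>M. \<forall>z\<in>M. sinh (d x y) * cosh (d z m)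
      \<le> sinh ((1 - l) * d x y) * cosh (d z x) + sinh (l * d x y) * cosh (d z y)"
  shows cn_space
  unfolding cn_space_def
proof (intro ballI)
  fix x y and l :: real assume x: "x \<in> M" and y: "y \<in> M" and l: "l \<in> {0..1}"
  define D where "D = d x y"
  show "\<exists>m\<in>M. \<forall>z\<in>M. (d z m)\<^sup>2 \<le> (1 - l) * (d z x)\<^sup>2 + l * (d z y)\<^sup>2 - l * (1 - l) * (d x y)\<^sup>2"
  proof (cases "x = y \<or> l = 0 \<or> l = 1")
    case True
    then consider "x = y" | "l = 0" | "l = 1" by blast
    then show ?thesis
    proof cases
      case 1 then show ?thesis using x by (intro bexI[of _ x]) (auto simp: algebra_simps)
    next
      case 2 then show ?thesis using x by (intro bexI[of _ x]) auto
    next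
      case 3 then show ?thesis using y by (intro bexI[of _ y]) auto
    qed
  next
    case False
    then have l: "0 < l" "l < 1" and xy: "x \<noteq> y" using l by auto
    have D: "D > 0" using xy x y by (simp add: D_def)
    obtain m where m: "m \<in> M" and h: "\<And>z. z \<in> M \<Longrightarrow> sinh D * cosh (d z m)
        \<le> sinh ((1 - l) * D) * cosh (d z x) + sinh (l * D) * cosh (d z y)"
      using H[OF x y xy l] unfolding D_def by blast
    \<comment> \<open>For z = x and z = y the hypothesis gives the upper bounds l D and (1 - l) D for the distances of m
      from x and y; the triangle inequality turns both into equalities.\<close>
    have bound: "u \<le> s" if "sinh D * cosh u \<le> sinh (D - s) + sinh s * cosh D" "0 \<le> u" "0 \<le> s" for u s
    proof -
      have "sinh D * cosh u \<le> sinh D * cosh s" using that(1) by (simp add: sinh_diff mult.commute)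
      then have "cosh u \<le> cosh s" using D by simp
      then show ?thesis using that by (simp add: cosh_real_nonneg_le_iff)
    qed
    have "d x m \<le> l * D"
    proof (rule bound)
      show "sinh D * cosh (d x m) \<le> sinh (D - l * D) + sinh (l * D) * cosh D"
        using h[OF x] x by (simp add: D_def[symmetric] left_diff_distrib)
    qed (use l D in auto)
    moreover have "d y m \<le> (1 - l) * D"
    proof (rule bound)
      have "D - (1 - l) * D = l * D" by (simp add: algebra_simps)
      then show "sinh D * cosh (d y m) \<le> sinh (D - (1 - l) * D) + sinh ((1 - l) * D) * cosh D"
        using h[OF y] y unfolding commute[of y x] D_def[symmetric] by simp
    qed (use l D in auto)
    moreover have "D \<le> d x m + d y m" using triangle[OF x m y] by (simp add: D_def commute)
    moreover have "l * D + (1 - l) * D = D" by (simp add: algebra_simps)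
    ultimately have dm: "d x m = l * D" "d y m = (1 - l) * D" by linarith+
    have "(d z m)\<^sup>2 \<le> (1 - l) * (d z x)\<^sup>2 + l * (d z y)\<^sup>2 - l * (1 - l) * D\<^sup>2" if z: "z \<in> M" for z
    proof (cases "z = m")
      case True
      then show ?thesis
        unfolding True commute[of m x] commute[of m y] dm using m
        by (simp add: power2_eq_square algebra_simps)
    next
      case False
      show ?thesis
      proof (rule hyperbolic_imp_cn_ineq[OF _ l D _ _ _ _ _ _ h[OF z]])
        show "0 < d z m" using False z m by simp
        show "\<bar>d z m - l * D\<bar> \<le> d z x" "d z x \<le> d z m + l * D"
          using triangle[OF z m x] triangle[OF z x m] triangle[OF x z m] dm
          unfolding commute[of m x] commute[of x z] by linarith+
        show "\<bar>d z m - (1 - l) * D\<bar> \<le> d z y" "d z y \<le> d z m + (1 - l) * D"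
          using triangle[OF z m y] triangle[OF z y m] triangle[OF y z m] dm
          unfolding commute[of m y] commute[of y z] by linarith+
      qed auto
    qed
    then show ?thesis using m unfolding D_def by blast
  qed
qed

end

section \<open>The hyperbolic cone over the line\<close>

text \<open>
  A point \<open>(r, t)\<close> stands for the point at distance \<open>arsinh r\<close> from the apex in direction \<open>t\<close>. With this choice
  of the radial coordinate the hyperboloid model has the coordinates \<open>ch r\<close> and \<open>r e\<^sup>i\<^sup>t\<close>, and geodesics
  in a sector are given by linear combinations of these. Directions are real numbers and not taken
  modulo \<open>2 \<pi>\<close>; as soon as they differ by at least \<open>\<pi>\<close>, the geodesic passes through the apex.
\<close>
definition ch :: "real \<Rightarrow> real" where "ch r = sqrt (1 + r\<^sup>2)"

definition angle :: "real \<Rightarrow> real \<Rightarrow> real" where "angle s t = min pi \<bar>s - t\<bar>"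

definition cone_form :: "real \<times> real \<Rightarrow> real \<times> real \<Rightarrow> real" where
  "cone_form = (\<lambda>(a, s) (b, t). ch a * ch b - a * b * cos (angle s t))"

definition cone_dist :: "real \<times> real \<Rightarrow> real \<times> real \<Rightarrow> real" where
  "cone_dist x y = arcosh (cone_form x y)"

text \<open>
  The set \<open>Z\<close> restricts the points of the cone other than the apex, which is always \<open>(0, 0)\<close>.
\<close>
definition cone :: "(real \<times> real) set \<Rightarrow> (real \<times> real) set" where
  "cone Z = {(r, t). 0 \<le> r \<and> (if r = 0 then t = 0 else (r, t) \<in> Z)}"

lemma ch_sq: "(ch r)\<^sup>2 = 1 + r\<^sup>2" by (simp add: ch_def)

lemma ch_ge_1: "1 \<le> ch r" by (simp add: ch_def)

lemma ch_0 [simp]: "ch 0 = 1" by (simp add: ch_def)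

lemma ch_sinh: "ch (sinh r) = cosh r"
  unfolding ch_def by (rule real_sqrt_unique) (simp_all add: cosh_square_eq)

lemma cosh_arsinh_ch: "cosh (arsinh r) = ch r"
  by (simp add: cosh_arsinh_real ch_def add.commute)

lemma ch_mult_ge: "1 + \<bar>a * b\<bar> \<le> ch a * ch b"
proof (rule power2_le_imp_le)
  have "(ch a * ch b)\<^sup>2 - (1 + \<bar>a * b\<bar>)\<^sup>2 = (\<bar>a\<bar> - \<bar>b\<bar>)\<^sup>2"
    unfolding power_mult_distrib ch_sq by (simp add: power2_eq_square algebra_simps abs_mult)
  then show "(1 + \<bar>a * b\<bar>)\<^sup>2 \<le> (ch a * ch b)\<^sup>2" by (smt (verit) zero_le_power2)
qed (simp add: ch_def)

lemma angle_bounds: "0 \<le> angle s t" "angle s t \<le> pi"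
  by (auto simp: angle_def)

lemma angle_commute: "angle s t = angle t s"
  by (simp add: angle_def abs_minus_commute)

lemma angle_self [simp]: "angle t t = 0"
  by (simp add: angle_def)

lemma cone_form_ge: "1 \<le> cone_form x y"
proof -
  obtain a s b t where xy: "x = (a, s)" "y = (b, t)" by (cases x, cases y)
  have "a * b * cos (angle s t) \<le> \<bar>a * b\<bar> * 1"
    by (rule order_trans[OF abs_ge_self]) (simp add: abs_mult mult_left_le)
  with ch_mult_ge[of a b] show ?thesis by (simp add: xy cone_form_def)
qed

lemma cosh_cone_dist: "cosh (cone_dist x y) = cone_form x y"
  unfolding cone_dist_def using cone_form_ge by simp

lemma cone_dist_nonneg: "0 \<le> cone_dist x y"
  unfolding cone_dist_def using cone_form_ge by simp

lemma cone_form_commute: "cone_form x y = cone_form y x"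
  by (simp add: cone_form_def case_prod_unfold angle_commute mult.commute mult.left_commute)

lemma cone_dist_commute: "cone_dist x y = cone_dist y x"
  by (simp add: cone_dist_def cone_form_commute)

lemma cone_dist_le_iff: "0 \<le> r \<Longrightarrow> cone_dist x y \<le> r \<longleftrightarrow> cone_form x y \<le> cosh r"
  using cosh_real_nonneg_le_iff[OF cone_dist_nonneg[of x y], of r] by (simp add: cosh_cone_dist)

lemma cone_dist_eqI: "0 \<le> r \<Longrightarrow> cone_form x y = cosh r \<Longrightarrow> cone_dist x y = r"
  by (simp add: cone_dist_def arcosh_cosh_real)

lemma arsinh_nonneg: "0 \<le> (a::real) \<Longrightarrow> 0 \<le> arsinh a"
  using arsinh_real_neg_iff[of a] by linarith

lemma cone_dist_apex: "0 \<le> a \<Longrightarrow> cone_dist (0, t) (a, s) = arsinh a"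
  by (rule cone_dist_eqI) (auto simp: cone_form_def cosh_arsinh_ch arsinh_nonneg)

lemma cone_form_ge_angle:
  assumes "0 \<le> a" "0 \<le> b"
  shows "1 + a * b * (1 - cos (angle s t)) \<le> cone_form (a, s) (b, t)"
  using ch_mult_ge[of a b] assms by (simp add: cone_form_def algebra_simps)

lemma cone_form_eq_1_iff:
  assumes "(a, s) \<in> cone Z" "(b, t) \<in> cone Z"
  shows "cone_form (a, s) (b, t) = 1 \<longleftrightarrow> (a, s) = (b, t)"
proof
  have ab: "0 \<le> a" "0 \<le> b" using assms by (auto simp: cone_def)
  assume Q: "cone_form (a, s) (b, t) = 1"
  have "a * b * (1 - cos (angle s t)) \<ge> 0" using ab by simp
  then have e: "ch a * ch b = 1 + a * b" "a * b * (1 - cos (angle s t)) = 0"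
    using Q ch_mult_ge[of a b] ab by (auto simp: cone_form_def algebra_simps)
  have "(1 + a\<^sup>2) * (1 + b\<^sup>2) = (1 + a * b)\<^sup>2"
    by (simp add: e(1)[symmetric] power_mult_distrib ch_sq)
  then have "(a - b)\<^sup>2 = 0" by (simp add: power2_eq_square algebra_simps)
  then have "a = b" by simp
  moreover have "s = t" if "a \<noteq> 0"
  proof -
    have "cos (angle s t) = cos 0" using e(2) that \<open>a = b\<close> by simp
    then have "angle s t = 0" using angle_bounds[of s t] cos_monotone_0_pi[of 0 "angle s t"] by linarith
    then show ?thesis using pi_gt_zero by (auto simp: angle_def min_def split: if_splits)
  qed
  ultimately show "(a, s) = (b, t)" using assms by (cases "a = 0") (auto simp: cone_def)
next
  assume "(a, s) = (b, t)"
  then show "cone_form (a, s) (b, t) = 1"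
    by (simp add: cone_form_def flip: power2_eq_square) (simp add: ch_sq)
qed

text \<open>
  The triangle inequality of the hyperbolic plane. In an orthonormal frame of the tangent plane at the
  middle vertex the other two vertices have the components \<open>(u1, v1)\<close> and \<open>(- u2, v2)\<close>, of lengths
  \<open>sqrt (A\<^sup>2 - 1)\<close> and \<open>sqrt (B\<^sup>2 - 1)\<close>, and the claim is the inequality of Cauchy and Schwarz.
\<close>
lemma cone_form_planar_triangle:
  assumes "A = ch a * ch b - a * b * cos p" "B = ch b * ch c - b * c * cos q"
    and "1 \<le> A" "1 \<le> B"
  shows "ch a * ch c - a * c * cos (p + q) \<le> cosh (arcosh A + arcosh B)"
proof -
  define u1 v1 u2 v2 where "u1 = a * sin p" and "v1 = b * ch a - a * ch b * cos p"
    and "u2 = c * sin q" and "v2 = b * ch c - c * ch b * cos q"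
  have sc: "(sin p)\<^sup>2 = 1 - (cos p)\<^sup>2" "(sin q)\<^sup>2 = 1 - (cos q)\<^sup>2" by (simp_all add: sin_squared_eq)
  have 1: "A\<^sup>2 - 1 = u1\<^sup>2 + v1\<^sup>2"
  proof -
    have "A\<^sup>2 - 1 - (u1\<^sup>2 + v1\<^sup>2) = (ch a)\<^sup>2 * ((ch b)\<^sup>2 - b\<^sup>2) - a\<^sup>2 * (cos p)\<^sup>2 * ((ch b)\<^sup>2 - b\<^sup>2)
        - a\<^sup>2 * (sin p)\<^sup>2 - 1"
      unfolding assms(1) u1_def v1_def by (simp add: power2_eq_square algebra_simps)
    also have "\<dots> = 0" unfolding ch_sq sc by (simp add: algebra_simps)
    finally show ?thesis by simp
  qed
  have 2: "B\<^sup>2 - 1 = u2\<^sup>2 + v2\<^sup>2"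
  proof -
    have "B\<^sup>2 - 1 - (u2\<^sup>2 + v2\<^sup>2) = (ch c)\<^sup>2 * ((ch b)\<^sup>2 - b\<^sup>2) - c\<^sup>2 * (cos q)\<^sup>2 * ((ch b)\<^sup>2 - b\<^sup>2)
        - c\<^sup>2 * (sin q)\<^sup>2 - 1"
      unfolding assms(2) u2_def v2_def by (simp add: power2_eq_square algebra_simps)
    also have "\<dots> = 0" unfolding ch_sq sc by (simp add: algebra_simps)
    finally show ?thesis by simp
  qed
  have "A * B + u1 * u2 - v1 * v2 - (ch a * ch c - a * c * cos (p + q))
      = (ch a * ch c - a * c * cos p * cos q) * ((ch b)\<^sup>2 - b\<^sup>2 - 1)"
    unfolding assms(1,2) u1_def u2_def v1_def v2_def cos_add
    by (simp add: power2_eq_square algebra_simps)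
  then have "ch a * ch c - a * c * cos (p + q) = A * B + u1 * u2 - v1 * v2" by (simp add: ch_sq)
  also have "\<dots> \<le> A * B + sqrt (u1\<^sup>2 + v1\<^sup>2) * sqrt (u2\<^sup>2 + v2\<^sup>2)"
  proof -
    have "(u1 * u2 - v1 * v2)\<^sup>2 + (u1 * v2 + v1 * u2)\<^sup>2 = (u1\<^sup>2 + v1\<^sup>2) * (u2\<^sup>2 + v2\<^sup>2)"
      by (simp add: power2_eq_square algebra_simps)
    then have "(u1 * u2 - v1 * v2)\<^sup>2 \<le> (u1\<^sup>2 + v1\<^sup>2) * (u2\<^sup>2 + v2\<^sup>2)"
      by (smt (verit) zero_le_power2)
    then have "\<bar>u1 * u2 - v1 * v2\<bar> \<le> sqrt ((u1\<^sup>2 + v1\<^sup>2) * (u2\<^sup>2 + v2\<^sup>2))"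
      by (metis real_sqrt_abs real_sqrt_le_iff)
    then show ?thesis by (simp add: real_sqrt_mult)
  qed
  also have "\<dots> = cosh (arcosh A + arcosh B)"
    using assms(3,4) by (simp add: cosh_add sinh_arcosh_real 1 2)
  finally show ?thesis .
qed

text \<open>
  If the two angles add up to more than \<open>\<pi>\<close>, decrease the second one until the sum is \<open>\<pi>\<close>. This shortens
  the second side, and the third side becomes a path through the apex, which is longest possible.
\<close>
lemma cone_dist_triangle:
  assumes "x \<in> cone Z" "y \<in> cone Z" "z \<in> cone Z"
  shows "cone_dist x z \<le> cone_dist x y + cone_dist y z"
proof -
  obtain a r b s c t where xyz: "x = (a, r)" "y = (b, s)" "z = (c, t)" by (cases x, cases y, cases z)
  have abc: "0 \<le> a" "0 \<le> b" "0 \<le> c" using assms by (auto simp: xyz cone_def)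
  define p q where "p = angle r s" and "q = angle s t"
  have pq: "0 \<le> p" "p \<le> pi" "0 \<le> q" "q \<le> pi" "angle r t \<le> p + q"
    by (auto simp: p_def q_def angle_def min_def)
  define A B where "A = cone_form x y" and "B = cone_form y z"
  have A: "A = ch a * ch b - a * b * cos p" "1 \<le> A" and B: "B = ch b * ch c - b * c * cos q" "1 \<le> B"
    using cone_form_ge by (auto simp: A_def B_def p_def q_def xyz cone_form_def)
  have "cone_form x z \<le> cosh (arcosh A + arcosh B)"
  proof (cases "p + q \<le> pi")
    case True
    have "cos (p + q) \<le> cos (angle r t)"
      using pq True angle_bounds[of r t] by (intro cos_monotone_0_pi_le) auto
    then have "a * c * cos (p + q) \<le> a * c * cos (angle r t)" using abc by (intro mult_left_mono) auto
    then show ?thesis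
      using cone_form_planar_triangle[OF A(1) B(1) A(2) B(2)] by (simp add: xyz cone_form_def)
  next
    case False
    define B' where "B' = ch b * ch c - b * c * cos (pi - p)"
    have "cos q \<le> cos (pi - p)" using pq False by (intro cos_monotone_0_pi_le) auto
    then have "b * c * cos q \<le> b * c * cos (pi - p)" using abc by (intro mult_left_mono) auto
    then have BB: "B' \<le> B" by (simp add: B'_def B(1))
    have "b * c * cos (pi - p) \<le> b * c * 1" using abc by (intro mult_left_mono) auto
    then have B': "1 \<le> B'" using ch_mult_ge[of b c] abc by (simp add: B'_def)
    have "a * c * - 1 \<le> a * c * cos (angle r t)" using abc by (intro mult_left_mono) auto
    then have "cone_form x z \<le> ch a * ch c - a * c * cos (p + (pi - p))" by (simp add: xyz cone_form_def)
    also have "\<dots> \<le> cosh (arcosh A + arcosh B')"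
      by (rule cone_form_planar_triangle[OF A(1) B'_def A(2) B'])
    also have "\<dots> \<le> cosh (arcosh A + arcosh B)"
    proof -
      have "arcosh B' \<le> arcosh B" using B' BB by (metis arcosh_real_strict_mono less_eq_real_def)
      moreover have "0 \<le> arcosh A" "0 \<le> arcosh B'" using A(2) B' by simp_all
      ultimately show ?thesis by (subst cosh_real_nonneg_le_iff) linarith+
    qed
    finally show ?thesis .
  qed
  then show ?thesis
    unfolding A_def B_def cone_dist_def[symmetric]
    by (subst cone_dist_le_iff) (auto simp: cone_dist_nonneg)
qed

lemma Metric_space_cone: "Metric_space (cone Z) cone_dist"
proof
  fix x y assume xy: "x \<in> cone Z" "y \<in> cone Z"
  have "cone_dist x y = 0 \<longleftrightarrow> cone_form x y = 1"
    unfolding cone_dist_def using cone_form_ge[of x y] by simp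
  then show "cone_dist x y = 0 \<longleftrightarrow> x = y"
    using cone_form_eq_1_iff xy by (cases x, cases y) metis
qed (auto simp: cone_dist_nonneg cone_dist_commute cone_dist_triangle)

interpretation cone: Metric_space "cone Z" cone_dist for Z
  by (rule Metric_space_cone)

lemma apex_in_cone: "(0, 0) \<in> cone Z"
  by (simp add: cone_def)

subsection \<open>Convexity\<close>

text \<open>
  In the second condition \<open>(r, u)\<close> are the polar coordinates of \<open>m a e\<^sup>i\<^sup>s + n b e\<^sup>i\<^sup>t\<close>: the components
  orthogonal to the direction \<open>u\<close> cancel. Points of hyperbolic geodesics arise in this way with
  \<open>m + n \<le> 1\<close>. For \<open>t \<ge> s + \<pi>\<close> the geodesic consists of two radial segments, which the first condition
  covers.
\<close>
definition cone_convex :: "(real \<times> real) set \<Rightarrow> bool" where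
  "cone_convex Z \<longleftrightarrow>
     (\<forall>r t r'. (r, t) \<in> Z \<and> 0 \<le> r' \<and> r' \<le> r \<longrightarrow> (r', t) \<in> Z) \<and>
     (\<forall>a s b t m n u r. (a, s) \<in> Z \<and> (b, t) \<in> Z \<and> 0 \<le> a \<and> 0 \<le> b \<and> s \<le> u \<and> u \<le> t \<and> t < s + pi \<and>
        0 \<le> m \<and> 0 \<le> n \<and> m + n \<le> 1 \<and> m * a * sin (u - s) = n * b * sin (t - u) \<and>
        r = m * a * cos (u - s) + n * b * cos (t - u) \<and> 0 \<le> r \<longrightarrow> (r, u) \<in> Z)"

text \<open>
  Polar coordinates of \<open>m e\<^sup>i\<^sup>s + n e\<^sup>i\<^sup>t\<close> with an angle between \<open>s\<close> and \<open>t\<close>, obtained from the intermediate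
  value theorem; this avoids reducing an argument modulo \<open>2 \<pi>\<close>.
\<close>
lemma sector_point:
  fixes m n s t :: real
  assumes "0 \<le> m" "0 \<le> n" "s \<le> t" "t < s + pi"
  obtains u where "s \<le> u" "u \<le> t" "m * sin (u - s) = n * sin (t - u)"
    "0 \<le> m * cos (u - s) + n * cos (t - u)"
proof -
  define h where "h u = m * sin (u - s) - n * sin (t - u)" for u
  have st: "sin (t - s) \<ge> 0" using assms by (intro sin_ge_zero) auto
  have "\<exists>u. s \<le> u \<and> u \<le> t \<and> h u = 0"
  proof (rule IVT')
    show "h s \<le> 0" "0 \<le> h t" using st assms by (auto simp: h_def)
    show "continuous_on {s..t} h" unfolding h_def by (intro continuous_intros)
  qed (use assms in auto)
  then obtain u where u: "s \<le> u" "u \<le> t" "m * sin (u - s) = n * sin (t - u)" by (auto simp: h_def)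
  define r where "r = m * cos (u - s) + n * cos (t - u)"
  have add: "sin (t - s) = sin (t - u) * cos (u - s) + cos (t - u) * sin (u - s)"
    using sin_add[of "t - u" "u - s"] by simp
  have "r * sin (u - s) = m * sin (u - s) * cos (u - s) + n * cos (t - u) * sin (u - s)"
    by (simp add: r_def algebra_simps)
  also have "\<dots> = n * sin (t - s)" unfolding u(3) add by (simp add: algebra_simps)
  finally have 1: "r * sin (u - s) \<ge> 0" using st assms by simp
  have "r * sin (t - u) = m * cos (u - s) * sin (t - u) + (n * sin (t - u)) * cos (t - u)"
    by (simp add: r_def algebra_simps)
  also have "\<dots> = m * sin (t - s)" unfolding u(3)[symmetric] add by (simp add: algebra_simps)
  finally have 2: "r * sin (t - u) \<ge> 0" using st assms by simp
  have "0 \<le> r"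
  proof (cases "u = s \<and> u = t")
    case True
    then show ?thesis using assms by (auto simp: r_def)
  next
    case False
    then have "sin (u - s) > 0 \<or> sin (t - u) > 0"
      using u assms sin_gt_zero[of "u - s"] sin_gt_zero[of "t - u"] by (cases "u = s") auto
    then show ?thesis using 1 2 by (auto simp: zero_le_mult_iff)
  qed
  then show ?thesis using u that unfolding r_def by blast
qed

lemma cos_angle_ge: "- cos (angle s t) \<ge> - cos (s - t)"
proof (cases "\<bar>s - t\<bar> \<le> pi")
  case True
  then have "cos (angle s t) = cos \<bar>s - t\<bar>" by (simp add: angle_def)
  then show ?thesis by simp
next
  case False
  then show ?thesis by (simp add: angle_def)
qed

text \<open>
  The form \<open>(ch r)\<^sup>2 - r\<^sup>2\<close> takes the value \<open>1\<close> on the combination if and only if the coefficients are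
  normalized, so that it lies again on the hyperboloid.
\<close>
lemma ch_combination:
  assumes "0 \<le> m" "0 \<le> n" "m\<^sup>2 + n\<^sup>2 + 2 * m * n * (ch a * ch b - k) = 1"
    and "r\<^sup>2 = m\<^sup>2 * a\<^sup>2 + n\<^sup>2 * b\<^sup>2 + 2 * m * n * k"
  shows "ch r = m * ch a + n * ch b"
proof -
  have "(m * ch a + n * ch b)\<^sup>2 = m\<^sup>2 * (ch a)\<^sup>2 + n\<^sup>2 * (ch b)\<^sup>2 + 2 * m * n * (ch a * ch b)"
    by (simp add: power2_eq_square algebra_simps)
  also have "\<dots> = 1 + r\<^sup>2" using assms(3,4) unfolding ch_sq by (simp add: algebra_simps)
  finally show ?thesis
    unfolding ch_def[of r] using assms(1,2) ch_ge_1[of a] ch_ge_1[of b]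
    by (intro real_sqrt_unique) auto
qed

text \<open>
  The point \<open>(c, v)\<close> may be at an angle greater than \<open>\<pi>\<close>. If \<open>u\<close> is within \<open>\<pi>\<close> of \<open>v\<close>, the term
  \<open>- r cos (angle v u)\<close> is linear in the planar vector and \<open>- cos (min \<pi> x) \<ge> - cos x\<close> suffices. If not,
  this term is \<open>r\<close>, the projection of the planar vector to the direction \<open>u\<close>, and the directions \<open>s\<close> and
  \<open>t\<close> are so far from \<open>v\<close> that their terms are at least their projections to \<open>u\<close>.
\<close>
lemma cone_form_sector:
  assumes ab: "0 \<le> a" "0 \<le> b" "0 \<le> c" and mn: "0 \<le> m" "0 \<le> n" and st: "s \<le> u" "u \<le> t" "t < s + pi"
    and norm: "m\<^sup>2 + n\<^sup>2 + 2 * m * n * cone_form (a, s) (b, t) = 1"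
    and u: "m * a * sin (u - s) = n * b * sin (t - u)"
    and r: "r = m * a * cos (u - s) + n * b * cos (t - u)" "0 \<le> r"
  shows "cone_form (c, v) (r, u) \<le> m * cone_form (c, v) (a, s) + n * cone_form (c, v) (b, t)"
proof -
  have "angle s t = t - s" using st by (simp add: angle_def)
  moreover have "r\<^sup>2 = m\<^sup>2 * a\<^sup>2 + n\<^sup>2 * b\<^sup>2 + 2 * m * n * (a * b * cos (t - s))"
  proof -
    have "(A * c1 + B * c2)\<^sup>2 + (A * s1 - B * s2)\<^sup>2
      = A\<^sup>2 * (s1\<^sup>2 + c1\<^sup>2) + B\<^sup>2 * (s2\<^sup>2 + c2\<^sup>2) + 2 * A * B * (c1 * c2 - s1 * s2)" for A B c1 c2 s1 s2 :: real
      by (simp add: power2_eq_square algebra_simps)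
    from this[of "m * a" "cos (u - s)" "n * b" "cos (t - u)" "sin (u - s)" "sin (t - u)"]
    show ?thesis using u r(1) cos_add[of "u - s" "t - u"] by (simp add: power_mult_distrib mult_ac)
  qed
  ultimately have "ch r = m * ch a + n * ch b"
    using norm by (intro ch_combination[OF mn, of _ _ "a * b * cos (angle s t)"]) (auto simp: cone_form_def)
  moreover have "r * - cos (angle v u) \<le> m * a * - cos (angle v s) + n * b * - cos (angle v t)"
  proof (cases "\<bar>v - u\<bar> \<le> pi")
    case True
    have e: "cos (v - s) = cos (v - u) * cos (u - s) - sin (v - u) * sin (u - s)"
      "cos (v - t) = cos (v - u) * cos (t - u) + sin (v - u) * sin (t - u)"
      using cos_add[of "v - u" "u - s"] cos_diff[of "v - u" "t - u"] by simp_all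
    have "cos (angle v u) = cos \<bar>v - u\<bar>" using True by (simp add: angle_def)
    then have "r * - cos (angle v u) = - (r * cos (v - u)) - sin (v - u) * (n * b * sin (t - u) - m * a * sin (u - s))"
      using u by simp
    also have "\<dots> = m * a * - cos (v - s) + n * b * - cos (v - t)"
      unfolding e r(1) by (simp add: algebra_simps)
    also have "\<dots> \<le> m * a * - cos (angle v s) + n * b * - cos (angle v t)"
      using ab mn by (intro add_mono mult_left_mono cos_angle_ge) auto
    finally show ?thesis .
  next
    case False
    have far: "cos w \<le> - cos (angle v z)" if "\<bar>u - z\<bar> = w" "w \<le> pi" for z w
    proof -
      have "pi - w \<le> angle v z" using False that by (auto simp: angle_def)
      then have "cos (angle v z) \<le> cos (pi - w)" using that angle_bounds[of v z] by (intro cos_monotone_0_pi_le) auto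
      then show ?thesis by simp
    qed
    have "r * - cos (angle v u) = r" using False by (simp add: angle_def)
    also have "\<dots> \<le> m * a * - cos (angle v s) + n * b * - cos (angle v t)"
      unfolding r(1) using ab mn st by (intro add_mono mult_left_mono far) auto
    finally show ?thesis .
  qed
  then have "c * (r * - cos (angle v u)) \<le> c * (m * a * - cos (angle v s) + n * b * - cos (angle v t))"
    using ab by (intro mult_left_mono)
  ultimately show ?thesis by (simp add: cone_form_def algebra_simps)
qed

text \<open>
  Here the geodesic from \<open>(a, s)\<close> to \<open>(b, t)\<close> passes through the apex and \<open>(r, s)\<close> lies on its first half. As the
  angles of \<open>v\<close> with \<open>s\<close> and \<open>t\<close> add up to at least \<open>\<pi>\<close>, the cosines have a nonpositive sum.
\<close>
lemma cone_form_opposite: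
  assumes ab: "0 \<le> a" "0 \<le> b" "0 \<le> c" and mn: "0 \<le> m" "0 \<le> n" and st: "pi \<le> \<bar>s - t\<bar>"
    and norm: "m\<^sup>2 + n\<^sup>2 + 2 * m * n * cone_form (a, s) (b, t) = 1"
    and r: "r = m * a - n * b" "0 \<le> r"
  shows "cone_form (c, v) (r, s) \<le> m * cone_form (c, v) (a, s) + n * cone_form (c, v) (b, t)"
proof -
  have "cos (angle s t) = - 1" using st by (simp add: angle_def)
  then have "ch r = m * ch a + n * ch b"
    using norm unfolding r(1)
    by (intro ch_combination[OF mn, of _ _ "- (a * b)"]) (auto simp: cone_form_def power2_eq_square algebra_simps)
  moreover have "r * - cos (angle v s) \<le> m * a * - cos (angle v s) + n * b * - cos (angle v t)"
  proof -
    have "pi - angle v s \<le> angle v t" using st by (auto simp: angle_def)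
    then have "cos (angle v t) \<le> cos (pi - angle v s)"
      using angle_bounds[of v s] angle_bounds[of v t] by (intro cos_monotone_0_pi_le) auto
    then have "n * b * cos (angle v s) \<le> n * b * - cos (angle v t)" using ab mn by (intro mult_left_mono) auto
    then show ?thesis by (simp add: r(1) algebra_simps)
  qed
  then have "c * (r * - cos (angle v s)) \<le> c * (m * a * - cos (angle v s) + n * b * - cos (angle v t))"
    using ab by (intro mult_left_mono)
  ultimately show ?thesis by (simp add: cone_form_def algebra_simps)
qed

lemma cone_form_normalize: "cone_form z (r, if r = 0 then 0 else u) = cone_form z (r, u)"
  by (cases z) (simp add: cone_form_def)

lemma cone_convex_combination:
  assumes Z: "cone_convex Z" and xy: "(a, s) \<in> Z" "(b, t) \<in> Z" "0 \<le> a" "0 \<le> b" and st: "s \<le> t"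
    and mn: "0 \<le> m" "0 \<le> n" "m + n \<le> 1"
    and norm: "m\<^sup>2 + n\<^sup>2 + 2 * m * n * cone_form (a, s) (b, t) = 1"
  shows "\<exists>w\<in>cone Z. \<forall>z\<in>cone Z. cone_form z w \<le> m * cone_form z (a, s) + n * cone_form z (b, t)"
proof -
  have star: "(r', t) \<in> Z" if "(r, t) \<in> Z" "0 \<le> r'" "r' \<le> r" for r r' t
    using Z that unfolding cone_convex_def by blast
  have wit: ?thesis if "0 \<le> r" "(r, u) \<in> Z"
    "\<And>c v. 0 \<le> c \<Longrightarrow> cone_form (c, v) (r, u) \<le> m * cone_form (c, v) (a, s) + n * cone_form (c, v) (b, t)" for r u
  proof (intro bexI[of _ "(r, if r = 0 then 0 else u)"] ballI)
    show "(r, if r = 0 then 0 else u) \<in> cone Z" using that by (auto simp: cone_def)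
    fix z assume "z \<in> cone Z"
    then have "0 \<le> fst z" by (auto simp: cone_def)
    then show "cone_form z (r, if r = 0 then 0 else u) \<le> m * cone_form z (a, s) + n * cone_form z (b, t)"
      unfolding cone_form_normalize using that(3)[of "fst z" "snd z"] by simp
  qed
  show ?thesis
  proof (cases "t < s + pi")
    case True
    obtain u where u: "s \<le> u" "u \<le> t" "m * a * sin (u - s) = n * b * sin (t - u)"
      "0 \<le> m * a * cos (u - s) + n * b * cos (t - u)"
      using sector_point[of "m * a" "n * b" s t] xy mn st True by auto
    define r where "r = m * a * cos (u - s) + n * b * cos (t - u)"
    have "(r, u) \<in> Z"
      using Z xy mn u True unfolding cone_convex_def r_def by blast
    then show ?thesis
      using wit[of r u] cone_form_sector[OF xy(3,4) _ mn(1,2) u(1,2) True norm u(3) r_def] u(4) by (simp add: r_def)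
  next
    case False
    show ?thesis
    proof (cases "m * a - n * b \<ge> 0")
      case True
      have "m * a \<le> 1 * a" using mn xy by (intro mult_right_mono) auto
      then have "(m * a - n * b, s) \<in> Z" using mn xy True by (intro star[OF xy(1)]) (auto intro: order_trans[of _ "m * a"])
      then show ?thesis
        using wit[OF True] cone_form_opposite[OF xy(3,4) _ mn(1,2) _ norm refl True] False st by simp
    next
      case neg: False
      have "n * b \<le> 1 * b" using mn xy by (intro mult_right_mono) auto
      then have "(n * b - m * a, t) \<in> Z" using mn xy neg by (intro star[OF xy(2)]) (auto intro: order_trans[of _ "n * b"])
      moreover have norm': "n\<^sup>2 + m\<^sup>2 + 2 * n * m * cone_form (b, t) (a, s) = 1"
        using norm by (simp add: cone_form_commute[of "(b, t)"] algebra_simps)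
      moreover have pos: "0 \<le> n * b - m * a" using neg by simp
      ultimately show ?thesis
        using wit[OF pos] cone_form_opposite[OF xy(4,3) _ mn(2,1) _ norm' refl pos] False st
        by (simp add: add.commute)
    qed
  qed
qed

lemma cone_convex_combination':
  assumes Z: "cone_convex Z" and xy: "(a, s) \<in> Z" "(b, t) \<in> Z" "0 \<le> a" "0 \<le> b"
    and mn: "0 \<le> m" "0 \<le> n" "m + n \<le> 1"
    and norm: "m\<^sup>2 + n\<^sup>2 + 2 * m * n * cone_form (a, s) (b, t) = 1"
  shows "\<exists>w\<in>cone Z. \<forall>z\<in>cone Z. cone_form z w \<le> m * cone_form z (a, s) + n * cone_form z (b, t)"
proof (cases "s \<le> t")
  case True
  show ?thesis by (rule cone_convex_combination[OF Z xy True mn norm])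
next
  case False
  have norm': "n\<^sup>2 + m\<^sup>2 + 2 * n * m * cone_form (b, t) (a, s) = 1"
    using norm by (simp add: cone_form_commute[of "(b, t)"] algebra_simps)
  have mn': "n + m \<le> 1" "t \<le> s" using mn False by auto
  show ?thesis
    using cone_convex_combination[OF Z xy(2,1,4,3) mn'(2) mn(2,1) mn'(1) norm'] by (simp add: add.commute)
qed

text \<open>
  The coefficients of the point at fraction \<open>l\<close> of a geodesic of length \<open>D\<close> on the hyperboloid are
  \<open>sinh ((1 - l) D) / sinh D\<close> and \<open>sinh (l D) / sinh D\<close>.
\<close>
theorem cn_space_cone:
  assumes Z: "cone_convex Z" shows "cone.cn_space Z"
proof (rule cone.cn_space_of_hyperbolic_convexity)
  fix x y and l :: real
  assume x: "x \<in> cone Z" and y: "y \<in> cone Z" and xy: "x \<noteq> y" and l: "0 < l" "l < 1"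
  define D where "D = cone_dist x y"
  have D: "0 < D" using x y xy by (simp add: D_def)
  define p q where "p = (1 - l) * D" and "q = l * D"
  have pq: "0 < p" "0 < q" "D = p + q" using l D by (auto simp: p_def q_def algebra_simps)
  define m n where "m = sinh p / sinh D" and "n = sinh q / sinh D"
  have sD: "sinh D > 0" using D by simp
  have mn: "0 \<le> m" "0 \<le> n" using pq sD by (auto simp: m_def n_def)
  have "sinh p * 1 + 1 * sinh q \<le> sinh p * cosh q + cosh p * sinh q"
    using pq cosh_real_ge_1 by (intro add_mono mult_left_mono mult_right_mono) auto
  then have "sinh p + sinh q \<le> sinh D" unfolding pq(3) sinh_add by simp
  then have mn1: "m + n \<le> 1" using sD by (simp add: m_def n_def add_divide_distrib[symmetric])
  have "(sinh p)\<^sup>2 + (sinh q)\<^sup>2 + 2 * sinh p * sinh q * cosh (p + q) - (sinh (p + q))\<^sup>2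
    = (sinh p)\<^sup>2 * (1 + (sinh q)\<^sup>2 + (sinh q)\<^sup>2 - (cosh q)\<^sup>2) + (sinh q)\<^sup>2 * (1 - (cosh p)\<^sup>2)"
    unfolding cosh_add sinh_add by (simp add: power2_eq_square algebra_simps)
  also have "\<dots> = 0" unfolding cosh_square_eq by (simp add: algebra_simps)
  finally have "(sinh p)\<^sup>2 + (sinh q)\<^sup>2 + 2 * sinh p * sinh q * cosh D = (sinh D)\<^sup>2" unfolding pq(3) by simp
  then have "((sinh p)\<^sup>2 + (sinh q)\<^sup>2 + 2 * sinh p * sinh q * cosh D) / (sinh D)\<^sup>2 = 1" using sD by simp
  then have norm: "m\<^sup>2 + n\<^sup>2 + 2 * m * n * cone_form x y = 1"
    unfolding cosh_cone_dist[symmetric] D_def[symmetric] m_def n_def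
    by (simp add: add_divide_distrib power_divide power2_eq_square)
  obtain a s b t where ab: "x = (a, s)" "y = (b, t)" by (cases x, cases y)
  have pos: "0 \<le> a" "0 \<le> b" using x y by (auto simp: ab cone_def)
  have star: "(0, t) \<in> Z" if "(r, t) \<in> Z" "0 \<le> r" for r t
    using Z that unfolding cone_convex_def by blast
  \<comment> \<open>If one of the points is the apex, its direction is replaced by that of the other point.\<close>
  have "\<exists>s' t'. (a, s') \<in> Z \<and> (b, t') \<in> Z \<and> (a \<noteq> 0 \<longrightarrow> s' = s) \<and> (b \<noteq> 0 \<longrightarrow> t' = t)"
  proof -
    consider "a \<noteq> 0" "b \<noteq> 0" | "a = 0" "b \<noteq> 0" | "a \<noteq> 0" "b = 0"
      using x y xy by (auto simp: ab cone_def split: if_splits)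
    then show ?thesis
    proof cases
      case 1 then show ?thesis using x y by (auto simp: ab cone_def)
    next
      case 2 then show ?thesis using y star[of b t] pos by (auto simp: ab cone_def)
    next
      case 3 then show ?thesis using x star[of a s] pos by (auto simp: ab cone_def)
    qed
  qed
  then obtain s' t' where st': "(a, s') \<in> Z" "(b, t') \<in> Z" "a \<noteq> 0 \<Longrightarrow> s' = s" "b \<noteq> 0 \<Longrightarrow> t' = t" by blast
  have form: "cone_form z (a, s') = cone_form z x" "cone_form z (b, t') = cone_form z y" for z
    unfolding ab using st'(3) st'(4)
    by (cases "a = 0", simp_all add: cone_form_def case_prod_unfold)
       (cases "b = 0", simp_all add: cone_form_def case_prod_unfold)
  have "cone_form (a, s') (b, t') = cone_form x y"
    unfolding form(2) cone_form_commute[of _ y] form(1) ..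
  then obtain w where w: "w \<in> cone Z" "\<And>z. z \<in> cone Z \<Longrightarrow> cone_form z w \<le> m * cone_form z x + n * cone_form z y"
    using cone_convex_combination'[OF Z st'(1,2) pos mn mn1] norm unfolding form by auto
  have "sinh D * cosh (cone_dist z w) \<le> sinh p * cosh (cone_dist z x) + sinh q * cosh (cone_dist z y)"
    if "z \<in> cone Z" for z
    using w(2)[OF that] sD unfolding cosh_cone_dist m_def n_def by (simp add: field_simps)
  then show "\<exists>m\<in>cone Z. \<forall>z\<in>cone Z. sinh (cone_dist x y) * cosh (cone_dist z m)
      \<le> sinh ((1 - l) * cone_dist x y) * cosh (cone_dist z x) + sinh (l * cone_dist x y) * cosh (cone_dist z y)"
    using w(1) unfolding D_def[symmetric] p_def[symmetric] q_def[symmetric] by blast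
qed

subsection \<open>Completeness and paths\<close>

text \<open>
  The distances from the apex converge. If the limit is positive, the angles converge too, since
  points at distance bounded below from the apex that are close to each other have a small angle.
\<close>
theorem mcomplete_cone:
  assumes "closed Z" shows "cone.mcomplete Z"
  unfolding cone.mcomplete_def
proof (intro allI impI)
  fix \<sigma> :: "nat \<Rightarrow> real \<times> real" assume "cone.MCauchy Z \<sigma>"
  then have \<sigma>: "\<sigma> n \<in> cone Z"
    and cau: "\<And>e. e > 0 \<Longrightarrow> \<exists>N. \<forall>m n. N \<le> m \<longrightarrow> N \<le> n \<longrightarrow> cone_dist (\<sigma> m) (\<sigma> n) < e" for n
    unfolding cone.MCauchy_def by auto
  define \<rho> \<theta> where "\<rho> n = fst (\<sigma> n)" and "\<theta> n = snd (\<sigma> n)" for n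
  have \<sigma>_eq: "\<sigma> n = (\<rho> n, \<theta> n)" for n by (simp add: \<rho>_def \<theta>_def)
  have \<rho>0: "0 \<le> \<rho> n" for n using \<sigma>[of n] by (auto simp: \<sigma>_eq cone_def)
  have ar: "cone_dist (0, 0) (\<sigma> n) = arsinh (\<rho> n)" for n
    using \<rho>0 by (simp add: \<sigma>_eq cone_dist_apex)
  have "Cauchy (\<lambda>n. arsinh (\<rho> n))"
    unfolding Cauchy_def
  proof (intro allI impI)
    fix e :: real assume "e > 0"
    then obtain N where N: "\<And>m n. N \<le> m \<Longrightarrow> N \<le> n \<Longrightarrow> cone_dist (\<sigma> m) (\<sigma> n) < e" using cau by meson
    have "dist (arsinh (\<rho> m)) (arsinh (\<rho> n)) \<le> cone_dist (\<sigma> m) (\<sigma> n)" for m n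
      using cone.triangle[OF apex_in_cone \<sigma> \<sigma>, of m n] cone.triangle[OF apex_in_cone \<sigma> \<sigma>, of n m]
      unfolding ar cone_dist_commute[of "\<sigma> n" "\<sigma> m"] by (simp add: dist_real_def abs_le_iff)
    with N show "\<exists>N. \<forall>m\<ge>N. \<forall>n\<ge>N. dist (arsinh (\<rho> m)) (arsinh (\<rho> n)) < e" by (meson le_less_trans)
  qed
  then obtain R where R: "(\<lambda>n. arsinh (\<rho> n)) \<longlonglongrightarrow> R" by (auto simp: Cauchy_convergent_iff convergent_def)
  define r where "r = sinh R"
  have r: "\<rho> \<longlonglongrightarrow> r" using tendsto_sinh[OF R] by (simp add: r_def)
  have "0 \<le> r" using r \<rho>0 by (intro LIMSEQ_le_const) auto
  show "\<exists>x. limitin (cone.mtopology Z) \<sigma> x sequentially"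
  proof (cases "r = 0")
    case True
    then have "(\<lambda>n. cone_dist (\<sigma> n) (0, 0)) \<longlonglongrightarrow> 0" using R unfolding cone_dist_commute[of "\<sigma> _"] ar by (simp add: r_def)
    then have "limitin (cone.mtopology Z) \<sigma> (0, 0) sequentially"
      using \<sigma> by (simp add: cone.limitin_metric_dist_null apex_in_cone)
    then show ?thesis by blast
  next
    case False
    with \<open>0 \<le> r\<close> have "0 < r" by simp
    then have "eventually (\<lambda>n. r / 2 < \<rho> n) sequentially" using r by (intro order_tendstoD) auto
    then obtain N0 where N0: "\<And>n. n \<ge> N0 \<Longrightarrow> r / 2 < \<rho> n" by (auto simp: eventually_sequentially)
    have "Cauchy \<theta>"
      unfolding Cauchy_def
    proof (intro allI impI)
      fix e0 :: real assume "e0 > 0"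
      define e where "e = min e0 pi"
      have e: "0 < e" "e \<le> pi" "e \<le> e0" using \<open>e0 > 0\<close> by (auto simp: e_def)
      have "cos e < cos 0" using e by (intro cos_monotone_0_pi) auto
      then have c: "0 < (r / 2)\<^sup>2 * (1 - cos e)" using \<open>0 < r\<close> by simp
      \<comment> \<open>Two points with radial coordinates at least r / 2 and distance less than h have angle less than e.\<close>
      define h where "h = arcosh (1 + (r / 2)\<^sup>2 * (1 - cos e))"
      have "h > 0" using c by (auto simp: h_def)
      then obtain N where N: "\<And>m n. N \<le> m \<Longrightarrow> N \<le> n \<Longrightarrow> cone_dist (\<sigma> m) (\<sigma> n) < h" using cau by meson
      have "dist (\<theta> m) (\<theta> n) < e0" if mn: "m \<ge> max N N0" "n \<ge> max N N0" for m n
      proof -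
        have "1 + \<rho> m * \<rho> n * (1 - cos (angle (\<theta> m) (\<theta> n))) \<le> cosh (cone_dist (\<sigma> m) (\<sigma> n))"
          unfolding cosh_cone_dist \<sigma>_eq by (rule cone_form_ge_angle[OF \<rho>0 \<rho>0])
        also have "\<dots> < cosh h"
          using N mn \<open>h > 0\<close> by (subst cosh_real_nonneg_less_iff) (auto simp: cone_dist_nonneg)
        also have "\<dots> = 1 + (r / 2)\<^sup>2 * (1 - cos e)" using c by (simp add: h_def)
        finally have 1: "\<rho> m * \<rho> n * (1 - cos (angle (\<theta> m) (\<theta> n))) < (r / 2)\<^sup>2 * (1 - cos e)" by simp
        have "(r / 2)\<^sup>2 * (1 - cos (angle (\<theta> m) (\<theta> n))) \<le> \<rho> m * \<rho> n * (1 - cos (angle (\<theta> m) (\<theta> n)))"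
          using N0[of m] N0[of n] mn \<open>0 < r\<close> unfolding power2_eq_square
          by (intro mult_right_mono mult_mono) auto
        with 1 have "(r / 2)\<^sup>2 * (1 - cos (angle (\<theta> m) (\<theta> n))) < (r / 2)\<^sup>2 * (1 - cos e)" by linarith
        then have "cos e < cos (angle (\<theta> m) (\<theta> n))" using \<open>0 < r\<close> by simp
        then have "angle (\<theta> m) (\<theta> n) < e"
          using cos_monotone_0_pi_le[of e "angle (\<theta> m) (\<theta> n)"] e angle_bounds[of "\<theta> m" "\<theta> n"] by linarith
        then show ?thesis using e by (auto simp: angle_def dist_real_def)
      qed
      then show "\<exists>N. \<forall>m\<ge>N. \<forall>n\<ge>N. dist (\<theta> m) (\<theta> n) < e0" by blast
    qed
    then obtain t where t: "\<theta> \<longlonglongrightarrow> t" by (auto simp: Cauchy_convergent_iff convergent_def)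
    have "eventually (\<lambda>n. \<sigma> n \<in> Z) sequentially"
      unfolding eventually_sequentially
    proof (intro exI allI impI)
      fix n assume "N0 \<le> n"
      then have "\<rho> n \<noteq> 0" using N0[of n] \<open>0 < r\<close> by auto
      then show "\<sigma> n \<in> Z" using \<sigma>[of n] by (auto simp: \<sigma>_eq cone_def)
    qed
    moreover have "\<sigma> \<longlonglongrightarrow> (r, t)" unfolding \<sigma>_eq[abs_def] using r t by (rule tendsto_Pair)
    ultimately have "(r, t) \<in> Z" using \<open>closed Z\<close> by (intro Lim_in_closed_set) auto
    then have rt: "(r, t) \<in> cone Z" using \<open>0 < r\<close> by (simp add: cone_def)
    have "(\<lambda>n. ch (\<rho> n) * ch r - \<rho> n * r * cos (min pi \<bar>\<theta> n - t\<bar>))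
        \<longlonglongrightarrow> ch r * ch r - r * r * cos (min pi \<bar>t - t\<bar>)"
      unfolding ch_def by (intro tendsto_intros r t)
    also have "ch r * ch r - r * r * cos (min pi \<bar>t - t\<bar>) = 1"
      by (simp add: ch_sq flip: power2_eq_square)
    finally have "(\<lambda>n. cone_form (\<sigma> n) (r, t)) \<longlonglongrightarrow> 1" by (simp add: \<sigma>_eq cone_form_def angle_def)
    then have "(\<lambda>n. arcosh (cone_form (\<sigma> n) (r, t))) \<longlonglongrightarrow> arcosh 1"
      using cone_form_ge by (intro tendsto_arcosh_strong) auto
    then have "limitin (cone.mtopology Z) \<sigma> (r, t) sequentially"
      using \<sigma> rt by (simp add: cone.limitin_metric_dist_null cone_dist_def)
    then show ?thesis by blast
  qed
qed

lemma connectedin_cone_path: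
  fixes f g :: "real \<Rightarrow> real"
  assumes "connected A" and cont: "continuous_on A f" "continuous_on A g"
    and Z: "\<And>t. t \<in> A \<Longrightarrow> 0 < f t \<and> (f t, g t) \<in> Z"
  shows "connectedin (cone.mtopology Z) ((\<lambda>t. (f t, g t)) ` A)"
proof (rule cone.connectedin_path[OF \<open>connected A\<close>])
  show M: "(f t, g t) \<in> cone Z" if "t \<in> A" for t using Z[OF that] by (simp add: cone_def)
  fix t e :: real assume t: "t \<in> A" and "e > 0"
  have "continuous_on A (\<lambda>s. ch (f t) * ch (f s) - f t * f s * cos (min pi \<bar>g t - g s\<bar>))"
    unfolding ch_def by (intro continuous_intros cont)
  then have "continuous_on A (\<lambda>s. cone_form (f t, g t) (f s, g s))"
    by (simp add: cone_form_def angle_def)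
  then have "continuous_on A (\<lambda>s. cone_dist (f t, g t) (f s, g s))"
    unfolding cone_dist_def using cone_form_ge by (intro continuous_on_arcosh') auto
  then obtain r where "r > 0" and r: "\<And>s. s \<in> A \<Longrightarrow> dist s t < r \<Longrightarrow>
      dist (cone_dist (f t, g t) (f s, g s)) (cone_dist (f t, g t) (f t, g t)) < e"
    using t \<open>e > 0\<close> unfolding continuous_on_iff by blast
  have "cone_dist (f t, g t) (f t, g t) = 0" using cone.mdist_zero[OF M[OF t]] .
  with r have "\<forall>s\<in>A. \<bar>s - t\<bar> < r \<longrightarrow> cone_dist (f t, g t) (f s, g s) < e"
    by (auto simp: dist_real_def)
  with \<open>r > 0\<close> show "\<exists>r>0. \<forall>s\<in>A. \<bar>s - t\<bar> < r \<longrightarrow> cone_dist (f t, g t) (f s, g s) < e" by blast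
qed

lemma cone_dist_radial:
  assumes "0 \<le> a" "0 \<le> b" shows "cone_dist (sinh a, t) (sinh b, t) = \<bar>a - b\<bar>"
  by (rule cone_dist_eqI) (simp_all add: cone_form_def ch_sinh flip: cosh_diff)

lemma cone_dist_opposite:
  assumes "0 \<le> a" "0 \<le> b" "pi \<le> \<bar>s - t\<bar>"
  shows "cone_dist (a, s) (b, t) = arsinh a + arsinh b"
  using assms by (intro cone_dist_eqI) (simp_all add: arsinh_nonneg cone_form_def angle_def cosh_add cosh_arsinh_ch)

lemma cone_dist_apex_sinh: "0 \<le> a \<Longrightarrow> cone_dist (0, s) (sinh a, t) = a"
  by (simp add: cone_dist_apex arsinh_sinh_real)

lemma gromov_product_self: "x \<in> cone Z \<Longrightarrow> cone.gromov_product (0, 0) x x = arsinh (fst x)"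
  by (cases x) (auto simp: cone.gromov_product_def cone_def cone_dist_commute[of _ "(0, 0)"] cone_dist_apex)

section \<open>A hyperbolic sector\<close>

definition sector :: "(real \<times> real) set" where "sector = {(r, t). 0 \<le> t \<and> t \<le> 1}"

lemma closed_sector: "closed sector"
  unfolding sector_def case_prod_unfold by (intro closed_Collect_conj closed_Collect_le continuous_intros)

lemma cone_convex_sector: "cone_convex sector"
  by (auto simp: cone_convex_def sector_def)

lemma sector_radial_gromov_product:
  assumes "0 \<le> a" "0 \<le> b"
  shows "cone.gromov_product (0, 0) (sinh a, t) (sinh b, t) = min a b"
  using assms by (simp add: cone.gromov_product_def cone_dist_radial cone_dist_commute[of _ "(0, 0)"] cone_dist_apex_sinh)

lemma radial_gromov_sequence:
  assumes "\<And>r. 0 < r \<Longrightarrow> (r, t) \<in> Z"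
  shows "(\<lambda>n. (sinh (real n + 1), t)) \<in> cone.gromov_sequences Z (0, 0)"
  unfolding cone.gromov_sequences_iff
proof (intro conjI allI)
  show "range (\<lambda>n. (sinh (real n + 1), t)) \<subseteq> cone Z" using assms by (auto simp: cone_def)
  fix K :: real
  obtain N :: nat where "K \<le> N" using real_arch_simple by blast
  then show "\<exists>N. \<forall>m\<ge>N. \<forall>n\<ge>N. K \<le> cone.gromov_product (0, 0) (sinh (real m + 1), t) (sinh (real n + 1), t)"
    by (intro exI[of _ N]) (auto simp: sector_radial_gromov_product)
qed

lemma sector_same_end:
  "cone.same_end sector (0, 0) (\<lambda>n. (sinh (real n + 1), 0)) (\<lambda>n. (sinh (real n + 1), 1))"
  unfolding cone.same_end_def
proof
  fix R :: real
  obtain N :: nat where N: "R \<le> N" using real_arch_simple by blast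
  have "cone.joined sector (0, 0) R (sinh (real m + 1), 0) (sinh (real n + 1), 1)" if "m \<ge> N" "n \<ge> N" for m n
  proof -
    define f where "f t = sinh ((1 - t) * (real m + 1) + t * (real n + 1))" for t :: real
    have rad: "(1 - t) * (real m + 1) + t * (real n + 1) \<ge> N + 1" if "t \<in> {0..1}" for t
    proof -
      have "(1 - t) * (real m + 1) + t * (real n + 1) \<ge> (1 - t) * (N + 1) + t * (N + 1)"
        using that \<open>m \<ge> N\<close> \<open>n \<ge> N\<close> by (intro add_mono mult_left_mono) auto
      then show ?thesis by (simp add: algebra_simps)
    qed
    have rad0: "(1 - t) * (real m + 1) + t * (real n + 1) > 0" if "t \<in> {0..1}" for t
      using rad[OF that] by linarith
    have "connectedin (cone.mtopology sector) ((\<lambda>t. (f t, t)) ` {0..1})"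
      using rad0 unfolding f_def
      by (intro connectedin_cone_path) (auto intro!: continuous_intros simp: sector_def)
    moreover have "R < cone_dist (0, 0) (f t, t)" if "t \<in> {0..1}" for t
      using rad[OF that] rad0[OF that] N by (simp add: f_def cone_dist_apex_sinh)
    moreover have "(sinh (real m + 1), 0) \<in> (\<lambda>t. (f t, t)) ` {0..1}"
      by (rule image_eqI[of _ _ 0]) (simp_all add: f_def)
    moreover have "(sinh (real n + 1), 1) \<in> (\<lambda>t. (f t, t)) ` {0..1}"
      by (rule image_eqI[of _ _ 1]) (simp_all add: f_def)
    ultimately show ?thesis unfolding cone.joined_def by blast
  qed
  then show "\<exists>N. \<forall>m\<ge>N. \<forall>n\<ge>N. cone.joined sector (0, 0) R (sinh (real m + 1), 0) (sinh (real n + 1), 1)" by blast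
qed

text \<open>
  With \<open>r\<close>, \<open>r'\<close> the distances from the apex and \<open>d\<close> the distance of the points, \<open>r + r' - d\<close> is at least \<open>2 K\<close>.
  Hence \<open>a b (1 - cos \<alpha>) \<le> cosh d \<le> exp (r + r' - 2 K)\<close> for the angle \<open>\<alpha>\<close>, while \<open>a b\<close> is comparable to
  \<open>exp (r + r')\<close>.
\<close>
lemma angle_small_of_gromov_product:
  assumes xy: "(a, s) \<in> cone Z" "(b, t) \<in> cone Z" and K: "1 \<le> K" "K \<le> cone.gromov_product (0, 0) (a, s) (b, t)"
  shows "1 - cos (angle s t) \<le> 16 * exp (- 2 * K)"
proof -
  have ab: "0 \<le> a" "0 \<le> b" using xy by (auto simp: cone_def)
  define r r' d where "r = arsinh a" and "r' = arsinh b" and "d = cone_dist (a, s) (b, t)"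
  have ra: "cone_dist (0, 0) (a, s) = r" "cone_dist (0, 0) (b, t) = r'" using ab by (simp_all add: r_def r'_def cone_dist_apex)
  have prod: "cone.gromov_product (0, 0) (a, s) (b, t) = (r + r' - d) / 2"
    by (simp add: cone.gromov_product_def cone_dist_commute[of _ "(0, 0)"] ra d_def)
  have "r \<le> r' + d" "r' \<le> r + d"
    using cone.triangle[OF apex_in_cone xy(2,1)] cone.triangle[OF apex_in_cone xy]
    unfolding ra d_def cone_dist_commute[of "(b, t)"] by simp_all
  moreover have "1 \<le> (r + r' - d) / 2" using K unfolding prod by linarith
  ultimately have r1: "1 \<le> r" "1 \<le> r'" by auto
  have sinh: "exp v / 4 \<le> sinh v" if "1 \<le> v" for v :: real
  proof -
    have "2 \<le> exp v" using exp_ge_add_one_self[of v] that by linarith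
    moreover have "exp (- v) \<le> 1" using that by simp
    ultimately have "2 * exp (- v) \<le> exp v" by linarith
    then show ?thesis by (simp add: sinh_field_def)
  qed
  have "exp r / 4 * (exp r' / 4) \<le> a * b"
    using sinh[OF r1(1)] sinh[OF r1(2)] ab by (intro mult_mono) (auto simp: r_def r'_def)
  then have "exp (r + r') / 16 * (1 - cos (angle s t)) \<le> a * b * (1 - cos (angle s t))"
    by (intro mult_right_mono) (auto simp: exp_add)
  also have "\<dots> \<le> cosh d" using cone_form_ge_angle[OF ab, of s t] by (simp add: d_def cosh_cone_dist)
  also have "cosh d \<le> exp d"
    using cone_dist_nonneg[of "(a, s)" "(b, t)"] by (simp add: cosh_field_def d_def)
  also have "exp d \<le> exp (r + r' + (- 2 * K))" using K prod by simp
  also have "\<dots> = exp (r + r') * exp (- 2 * K)" by (rule exp_add)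
  finally have "exp (r + r') * (1 - cos (angle s t)) \<le> exp (r + r') * (16 * exp (- 2 * K))" by simp
  then show ?thesis by simp
qed

lemma gromov_E_sector_direction:
  assumes E: "(x, y) \<in> cone.gromov_E sector (0, 0)" and x: "(\<lambda>n. snd (x n)) \<longlonglongrightarrow> v"
  shows "(\<lambda>n. snd (y n)) \<longlonglongrightarrow> v"
  unfolding LIMSEQ_def
proof (intro allI impI)
  fix e :: real assume "e > 0"
  define h where "h = min (e / 2) 1"
  have h: "0 < h" "h \<le> e / 2" "h \<le> 1" "h \<le> pi" using \<open>e > 0\<close> pi_gt3 by (auto simp: h_def)
  have "cos h < cos 0" using h by (intro cos_monotone_0_pi) auto
  then have c: "0 < 1 - cos h" by simp
  define K where "K = max 1 (8 / (1 - cos h))"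
  have "8 / (1 - cos h) \<le> K" by (simp add: K_def)
  moreover have "16 / (1 - cos h) = 2 * (8 / (1 - cos h))" by simp
  ultimately have "1 + 16 / (1 - cos h) \<le> exp (2 * K)"
    using exp_ge_add_one_self[of "2 * K"] by linarith
  then have "16 / (1 - cos h) < exp (2 * K)" by simp
  then have K: "1 \<le> K" "16 * exp (- 2 * K) < 1 - cos h"
    using c by (auto simp: K_def exp_minus field_simps)
  obtain N1 where N1: "\<And>m n. m \<ge> N1 \<Longrightarrow> n \<ge> N1 \<Longrightarrow> K \<le> cone.gromov_product (0, 0) (x m) (y n)"
    using E unfolding cone.gromov_E_iff by meson
  obtain N2 where N2: "\<And>n. n \<ge> N2 \<Longrightarrow> dist (snd (x n)) v < e / 2"
    using x half_gt_zero[OF \<open>e > 0\<close>] unfolding LIMSEQ_def by meson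
  have "dist (snd (y n)) v < e" if n: "n \<ge> max N1 N2" for n
  proof -
    obtain a s b t where xy: "x n = (a, s)" "y n = (b, t)" by (cases "x n", cases "y n")
    have M: "(a, s) \<in> cone sector" "(b, t) \<in> cone sector"
      using E unfolding cone.gromov_E_iff cone.gromov_sequences_iff xy[symmetric] by auto
    have "1 - cos (angle s t) \<le> 16 * exp (- 2 * K)"
      using N1[of n n] n by (intro angle_small_of_gromov_product[OF M K(1)]) (simp add: xy)
    then have "cos h < cos (angle s t)" using K(2) by linarith
    then have "angle s t < h"
      using cos_monotone_0_pi_le[of h "angle s t"] h angle_bounds[of s t] by linarith
    then have "\<bar>s - t\<bar> < e / 2" using h by (auto simp: angle_def min_def split: if_splits)
    moreover have "\<bar>s - v\<bar> < e / 2" using N2[of n] n by (simp add: xy dist_real_def)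
    ultimately show ?thesis unfolding xy dist_real_def snd_conv by linarith
  qed
  then show "\<exists>N. \<forall>n\<ge>N. dist (snd (y n)) v < e" by blast
qed

text \<open>
  By \<open>gromov_E_sector_direction\<close> the limit direction is preserved in each step of a chain of related
  sequences.
\<close>
lemma sector_not_equivalent:
  "((\<lambda>n. (sinh (real n + 1), 0)), (\<lambda>n. (sinh (real n + 1), 1))) \<notin> (cone.gromov_E sector (0, 0))\<^sup>+"
proof
  have "(\<lambda>n. snd (y n)) \<longlonglongrightarrow> 0"
    if "((\<lambda>n. (sinh (real n + 1), 0)), y) \<in> (cone.gromov_E sector (0, 0))\<^sup>+" for y
    using that
  proof induction
    case (base y)
    then show ?case by (rule gromov_E_sector_direction) simp
  next
    case (step y z)
    show ?case by (rule gromov_E_sector_direction[OF step(2,3)])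
  qed
  moreover assume "((\<lambda>n. (sinh (real n + 1), 0)), (\<lambda>n. (sinh (real n + 1), 1))) \<in> (cone.gromov_E sector (0, 0))\<^sup>+"
  ultimately have "(\<lambda>n::nat. 1 :: real) \<longlonglongrightarrow> 0" by fastforce
  then show False using LIMSEQ_unique[OF tendsto_const[of "1::real"]] by force
qed

section \<open>A spiral\<close>

definition spiral :: "(real \<times> real) set" where "spiral = {(r, t). r \<le> exp t}"

lemma closed_spiral: "closed spiral"
  unfolding spiral_def case_prod_unfold by (intro closed_Collect_le continuous_intros)

lemma cos_plus_sin_le_exp: "0 \<le> x \<Longrightarrow> cos x + sin x \<le> exp (x::real)"
  using cos_le_one[of x] sin_x_le_x[of x] exp_ge_add_one_self[of x] by linarith

lemma cos_minus_sin_le_exp: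
  assumes "0 \<le> x" "x \<le> pi" shows "cos x - sin x \<le> exp (- x)"
proof -
  have "(cos x - sin x) * exp x \<le> (cos 0 - sin 0) * exp 0"
  proof (rule DERIV_nonpos_imp_nonincreasing[OF assms(1)])
    fix y assume y: "0 \<le> y" "y \<le> x"
    have "((\<lambda>x. (cos x - sin x) * exp x) has_real_derivative (- 2 * sin y * exp y)) (at y)"
      by (auto intro!: derivative_eq_intros simp: algebra_simps)
    moreover have "- 2 * sin y * exp y \<le> 0" using y assms sin_ge_zero[of y] by simp
    ultimately show "\<exists>d. ((\<lambda>x. (cos x - sin x) * exp x) has_real_derivative d) (at y) \<and> d \<le> 0" by blast
  qed
  then show ?thesis by (simp add: exp_minus field_simps)
qed

text \<open>
  In polar coordinates \<open>r exp (- \<theta>)\<close> is a convex function on every sector of angle less than \<open>\<pi>\<close>, because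
  \<open>exp (- \<theta>)\<close> lies above its tangent sinusoid at each angle: \<open>exp (- x) \<ge> cos x - sin x\<close> for
  \<open>- \<pi> \<le> x \<le> \<pi>\<close>. The two preceding lemmas are the two signs of \<open>x\<close>.
\<close>
lemma cone_convex_spiral: "cone_convex spiral"
  unfolding cone_convex_def
proof (intro conjI allI impI)
  fix a s b t m n u r :: real
  assume H: "(a, s) \<in> spiral \<and> (b, t) \<in> spiral \<and> 0 \<le> a \<and> 0 \<le> b \<and> s \<le> u \<and> u \<le> t \<and> t < s + pi \<and>
    0 \<le> m \<and> 0 \<le> n \<and> m + n \<le> 1 \<and> m * a * sin (u - s) = n * b * sin (t - u) \<and>
    r = m * a * cos (u - s) + n * b * cos (t - u) \<and> 0 \<le> r"
  have "r = m * a * (cos (u - s) + sin (u - s)) + n * b * (cos (t - u) - sin (t - u))"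
    using H by (simp add: algebra_simps)
  also have "\<dots> \<le> m * a * exp (u - s) + n * b * exp (- (t - u))"
    using H by (intro add_mono mult_left_mono cos_plus_sin_le_exp cos_minus_sin_le_exp) auto
  also have "\<dots> \<le> m * exp s * exp (u - s) + n * exp t * exp (- (t - u))"
    using H by (intro add_mono mult_right_mono mult_left_mono) (auto simp: spiral_def)
  also have "\<dots> = (m + n) * exp u"
    by (simp add: mult.assoc flip: exp_add) (simp add: algebra_simps)
  also have "\<dots> \<le> 1 * exp u" using H by (intro mult_right_mono) auto
  finally show "(r, u) \<in> spiral" by (simp add: spiral_def)
qed (auto simp: spiral_def)

lemma spiral_in_cone: "range (\<lambda>n. (exp (real n), real n)) \<subseteq> cone spiral"
  by (auto simp: cone_def spiral_def)

lemma spiral_same_end: "cone.same_end spiral (0, 0) (\<lambda>n. (exp (real n), real n)) (\<lambda>n. (exp (real n), real n))"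
  unfolding cone.same_end_def
proof
  fix R :: real
  obtain N :: nat where N: "R < N" using reals_Archimedean2 by blast
  have "connectedin (cone.mtopology spiral) ((\<lambda>t. (exp t, t)) ` {real N..})"
    by (intro connectedin_cone_path) (auto intro!: continuous_intros simp: spiral_def)
  moreover have "R < cone_dist (0, 0) (exp t, t)" if "t \<in> {real N..}" for t
  proof -
    have "sinh t < exp t" by (simp add: sinh_field_def add_pos_pos field_simps)
    then have "t < arsinh (exp t)" using arsinh_real_strict_mono[of "sinh t" "exp t"] by (simp add: arsinh_sinh_real)
    then show ?thesis using that N by (simp add: cone_dist_apex)
  qed
  moreover have "(exp (real n), real n) \<in> (\<lambda>t. (exp t, t)) ` {real N..}" if "n \<ge> N" for n
    using that by auto
  ultimately show "\<exists>N. \<forall>m\<ge>N. \<forall>n\<ge>N. cone.joined spiral (0, 0) R (exp (real m), real m) (exp (real n), real n)"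
    unfolding cone.joined_def by blast
qed

text \<open>
  Fix one term \<open>(a, s)\<close> of the sequence. A later term is so far from the apex that the bound \<open>r \<le> e\<^sup>\<theta>\<close> forces its
  angle to be at least \<open>s + \<pi>\<close>, and the Gromov product of the two terms is \<open>0\<close>.
\<close>
lemma spiral_no_gromov_sequence: "cone.gromov_sequences spiral (0, 0) = {}"
proof (rule equals0I)
  fix y assume "y \<in> cone.gromov_sequences spiral (0, 0)"
  then have M: "y n \<in> cone spiral" and K: "\<exists>N. \<forall>m\<ge>N. \<forall>n\<ge>N. K \<le> cone.gromov_product (0, 0) (y m) (y n)" for n K
    unfolding cone.gromov_sequences_iff by auto
  obtain N where N: "\<And>m n. m \<ge> N \<Longrightarrow> n \<ge> N \<Longrightarrow> 1 \<le> cone.gromov_product (0, 0) (y m) (y n)" using K[of 1] by blast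
  obtain a s where as: "y N = (a, s)" by (cases "y N")
  obtain N' where N': "\<And>m n. m \<ge> N' \<Longrightarrow> n \<ge> N' \<Longrightarrow> arsinh (exp (s + pi)) \<le> cone.gromov_product (0, 0) (y m) (y n)"
    using K by blast
  define n where "n = max N N'"
  obtain b t where bt: "y n = (b, t)" by (cases "y n")
  have "arsinh (exp (s + pi)) \<le> arsinh b"
    using N'[of n n] gromov_product_self[OF M, of n] by (simp add: n_def bt[unfolded n_def])
  then have b: "exp (s + pi) \<le> b" by (metis arsinh_less_iff_real not_less)
  then have "0 < b" using exp_gt_zero[of "s + pi"] by linarith
  then have "b \<le> exp t" using M[of n] by (auto simp: bt cone_def spiral_def)
  with b have "exp (s + pi) \<le> exp t" by linarith
  then have "s + pi \<le> t" by simp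
  moreover have "0 \<le> a" using M[of N] by (auto simp: as cone_def)
  ultimately have "cone.gromov_product (0, 0) (y N) (y n) = 0"
    using \<open>0 < b\<close> cone_dist_opposite[of a b s t]
    by (simp add: as bt cone.gromov_product_def cone_dist_commute[of _ "(0, 0)"] cone_dist_apex)
  then show False using N[of N n] by (simp add: n_def)
qed

section \<open>A hedgehog with bounded legs of unbounded lengths\<close>

text \<open>
  The legs are in the directions \<open>k \<pi>\<close> for \<open>k = 1, 2, \<dots>\<close>, which is just far enough for the paths between
  different legs to pass through the apex. The leg in direction \<open>t\<close> has length \<open>t\<close>.
\<close>
definition star :: "(real \<times> real) set" where "star = {(r, t). sin t = 0 \<and> 0 \<le> t \<and> r \<le> sinh t}"

lemma closed_star: "closed star"
  unfolding star_def case_prod_unfold sinh_field_def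
  by (intro closed_Collect_conj closed_Collect_le closed_Collect_eq continuous_intros) auto

lemma sin_zeros_apart:
  assumes "sin s = 0" "sin t = 0" "s < t" shows "s + pi \<le> (t::real)"
proof (rule ccontr)
  assume "\<not> s + pi \<le> t"
  then have "0 < sin (t - s)" using assms by (intro sin_gt_zero) auto
  then show False using assms by (simp add: sin_diff)
qed

lemma cone_convex_star: "cone_convex star"
  unfolding cone_convex_def
proof (intro conjI allI impI)
  fix a s b t m n u r :: real
  assume H: "(a, s) \<in> star \<and> (b, t) \<in> star \<and> 0 \<le> a \<and> 0 \<le> b \<and> s \<le> u \<and> u \<le> t \<and> t < s + pi \<and>
    0 \<le> m \<and> 0 \<le> n \<and> m + n \<le> 1 \<and> m * a * sin (u - s) = n * b * sin (t - u) \<and>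
    r = m * a * cos (u - s) + n * b * cos (t - u) \<and> 0 \<le> r"
  then have "s \<le> t" "\<not> s < t" using sin_zeros_apart[of s t] by (auto simp: star_def)
  then have "s = t" by simp
  with H have u: "u = t" by simp
  with \<open>s = t\<close> H have "r = m * a + n * b" by simp
  also have "\<dots> \<le> m * sinh t + n * sinh t"
    using H \<open>s = t\<close> by (intro add_mono mult_left_mono) (auto simp: star_def)
  also have "\<dots> = (m + n) * sinh t" by (simp add: algebra_simps)
  also have "\<dots> \<le> 1 * sinh t" using H by (intro mult_right_mono) (auto simp: star_def)
  finally show "(r, u) \<in> star" using H by (simp add: star_def u)
qed (auto simp: star_def)

lemma cone_star_leg: "(r, t) \<in> cone star \<Longrightarrow> sin t = 0 \<and> 0 \<le> t \<and> 0 \<le> r \<and> r \<le> sinh t"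
  by (auto simp: cone_def star_def split: if_splits)

lemma cone_star_dist:
  assumes "(a, s) \<in> cone star" "(b, t) \<in> cone star" "s \<noteq> t"
  shows "cone_dist (a, s) (b, t) = arsinh a + arsinh b"
  using cone_star_leg[OF assms(1)] cone_star_leg[OF assms(2)] assms(3) sin_zeros_apart[of s t] sin_zeros_apart[of t s]
  by (intro cone_dist_opposite) (auto simp: abs_real_def)

lemma star_hedgehog: "hedgehog (cone star) cone_dist (0, 0) snd"
proof (intro hedgehog.intro hedgehog_axioms.intro Metric_space_cone apex_in_cone)
  fix x y assume xy: "x \<in> cone star" "y \<in> cone star" "snd x \<noteq> snd y"
  obtain a s b t where ab: "x = (a, s)" "y = (b, t)" by (cases x, cases y)
  have "0 \<le> a" "0 \<le> b" using xy cone_star_leg by (auto simp: ab)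
  then show "cone_dist x y = cone_dist (0, 0) x + cone_dist (0, 0) y"
    using cone_star_dist[of a s b t] xy by (simp add: ab cone_dist_apex)
next
  fix i :: real
  have "cone_dist (0, 0) x \<le> i" if xi: "x \<in> cone star" "snd x = i" for x
  proof -
    obtain a where x: "x = (a, i)" using xi(2) by (metis prod.collapse)
    then have "0 \<le> a" "a \<le> sinh i" using xi cone_star_leg by auto
    then have "arsinh a \<le> i" by (metis arsinh_less_iff_real arsinh_sinh_real not_less)
    then show ?thesis using \<open>0 \<le> a\<close> by (simp add: x cone_dist_apex)
  qed
  then show "\<exists>B. \<forall>x\<in>cone star. snd x = i \<longrightarrow> cone_dist (0, 0) x \<le> B" by blast
qed

lemma star_point:
  fixes n :: nat
  assumes "0 < r" "r \<le> real n" shows "(sinh r, real n * pi) \<in> cone star"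
proof -
  have "real n * 1 \<le> real n * pi" using pi_gt3 by (intro mult_left_mono) auto
  then have "r \<le> real n * pi" using assms by linarith
  then show ?thesis using assms by (auto simp: cone_def star_def)
qed

section \<open>The product of two hedgehogs\<close>

interpretation square: Metric_space12 "cone Z" cone_dist "cone Z'" cone_dist for Z Z'
  by (intro Metric_space12.intro Metric_space_cone)

text \<open>
  For vectors \<open>P = (a, b)\<close>, \<open>Q = (a', b')\<close> with lengths \<open>n\<close>, \<open>n'\<close> this is a lower bound for the defect
  \<open>\<bar>P\<bar> + \<bar>Q\<bar> - \<bar>P + Q\<bar>\<close> of the triangle inequality by the cross product. The vector \<open>P + Q\<close> enters because
  points on different legs in both factors have distance \<open>\<bar>P + Q\<bar>\<close>.
\<close>
lemma quadrant_product_bound: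
  fixes a b a' b' :: real
  assumes pos: "0 < a" "0 \<le> b" "0 < a'" "0 \<le> b'"
  defines "n \<equiv> sqrt (a\<^sup>2 + b\<^sup>2)" and "n' \<equiv> sqrt (a'\<^sup>2 + b'\<^sup>2)"
  shows "(a * b' - a' * b)\<^sup>2 / (2 * n * n' * (n + n')) \<le> n + n' - sqrt ((a + a')\<^sup>2 + (b + b')\<^sup>2)"
proof -
  define S where "S = sqrt ((a + a')\<^sup>2 + (b + b')\<^sup>2)"
  define p where "p = a * a' + b * b'"
  have n: "n\<^sup>2 = a\<^sup>2 + b\<^sup>2" "n'\<^sup>2 = a'\<^sup>2 + b'\<^sup>2" by (simp_all add: n_def n'_def)
  have n0: "0 < n" "0 < n'" using pos by (auto simp: n_def n'_def add_pos_nonneg)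
  have "S\<^sup>2 = (a + a')\<^sup>2 + (b + b')\<^sup>2" by (simp add: S_def)
  then have S2: "S\<^sup>2 = n\<^sup>2 + n'\<^sup>2 + 2 * p"
    unfolding n by (simp add: p_def power2_eq_square algebra_simps)
  have p0: "0 \<le> p" using pos by (simp add: p_def)
  have cross: "(a * b' - a' * b)\<^sup>2 = (n * n' - p) * (n * n' + p)"
  proof -
    have "(n * n' - p) * (n * n' + p) = n\<^sup>2 * n'\<^sup>2 - p\<^sup>2" by (simp add: power2_eq_square algebra_simps)
    then show ?thesis unfolding n p_def by (simp add: power2_eq_square algebra_simps)
  qed
  have pn: "p \<le> n * n'"
  proof -
    have "0 \<le> (n * n' - p) * (n * n' + p)" using cross by (metis zero_le_power2)
    moreover have "0 < n * n' + p" using n0 p0 by (simp add: add_pos_nonneg)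
    ultimately show ?thesis by (simp add: zero_le_mult_iff)
  qed
  have "S\<^sup>2 \<le> (n + n')\<^sup>2" unfolding S2 using pn by (simp add: power2_eq_square algebra_simps)
  then have S: "S \<le> n + n'" by (rule power2_le_imp_le) (use n0 in simp)
  have "(a * b' - a' * b)\<^sup>2 \<le> (n * n' - p) * (2 * (n * n'))"
    unfolding cross using pn by (intro mult_left_mono) auto
  also have "\<dots> = (n + n' - S) * (n + n' + S) * (n * n')"
    using S2 by (simp add: power2_eq_square algebra_simps)
  also have "\<dots> \<le> (n + n' - S) * (2 * (n + n')) * (n * n')"
    using S n0 by (intro mult_right_mono mult_left_mono) auto
  finally have "(a * b' - a' * b)\<^sup>2 \<le> (n + n' - S) * (2 * n * n' * (n + n'))" by (simp add: mult_ac)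
  then show ?thesis unfolding S_def[symmetric] using n0 by (simp add: pos_divide_le_eq)
qed

text \<open>
  The vectors are \<open>p\<^sup>5 (p, 1)\<close> and \<open>q\<^sup>5 (q, 1)\<close>, with lengths at most \<open>2 p\<^sup>6\<close> and \<open>2 q\<^sup>6\<close> and cross product
  \<open>p\<^sup>5 q\<^sup>5 (p - q)\<close>. So the bound is of the order \<open>p\<^sup>4 (q - p)\<^sup>2 / q\<^sup>2\<close>, where \<open>(q - p) / q \<ge> 1 / (2 p)\<close>.
\<close>
lemma slope_separation:
  fixes p q :: real
  assumes p: "1 \<le> p" and q: "p + 1 \<le> q"
  defines "n \<equiv> \<lambda>p::real. sqrt ((p ^ 6)\<^sup>2 + (p ^ 5)\<^sup>2)"
  shows "p\<^sup>2 / 128 \<le> n p + n q - sqrt ((p ^ 6 + q ^ 6)\<^sup>2 + (p ^ 5 + q ^ 5)\<^sup>2)"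
proof -
  have n: "n p \<le> 2 * p ^ 6" "0 < n p" if "1 \<le> p" for p :: real
  proof -
    have "p ^ 5 \<le> p ^ 6" using that by (intro power_increasing) auto
    then have "sqrt ((p ^ 6)\<^sup>2 + (p ^ 5)\<^sup>2) \<le> p ^ 6 + p ^ 6"
      using sqrt_sum_squares_le_sum[of "p ^ 6" "p ^ 5"] that by simp
    then show "n p \<le> 2 * p ^ 6" by (simp add: n_def)
    show "0 < n p" using that by (simp add: n_def add_pos_pos)
  qed
  have q1: "1 \<le> q" using p q by simp
  have pq: "0 < p" "0 < q" using p q by auto
  have "p\<^sup>2 / 128 \<le> p ^ 4 * (q - p)\<^sup>2 / (32 * q\<^sup>2)"
  proof -
    have "q \<le> 2 * p * (q - p)"
    proof -
      have "q = p * 1 + 1 * (q - p)" by simp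
      also have "\<dots> \<le> p * (q - p) + p * (q - p)"
        using p q by (intro add_mono mult_left_mono mult_right_mono) auto
      finally show ?thesis by simp
    qed
    then have "q\<^sup>2 \<le> (2 * p * (q - p))\<^sup>2" using pq by (intro power_mono) auto
    then have "p\<^sup>2 * q\<^sup>2 \<le> p\<^sup>2 * (2 * p * (q - p))\<^sup>2" by (intro mult_left_mono) auto
    also have "\<dots> = 4 * (p ^ 4 * (q - p)\<^sup>2)" by (simp add: power_mult_distrib power2_eq_square power4_eq_xxxx)
    finally show ?thesis using pq by (simp add: field_simps)
  qed
  also have "\<dots> = (p ^ 6 * q ^ 5 - q ^ 6 * p ^ 5)\<^sup>2 / (2 * (2 * p ^ 6) * (2 * q ^ 6) * (4 * q ^ 6))"
  proof -
    have "p ^ 6 * q ^ 5 - q ^ 6 * p ^ 5 = p ^ 5 * q ^ 5 * (p - q)" by (simp add: eval_nat_numeral algebra_simps)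
    then have "(p ^ 6 * q ^ 5 - q ^ 6 * p ^ 5)\<^sup>2 = p ^ 10 * q ^ 10 * (q - p)\<^sup>2"
      by (simp add: power_mult_distrib power2_commute[of p q] flip: power_mult)
    also have "p ^ 10 = p ^ 6 * p ^ 4" by (simp flip: power_add)
    finally have num: "(p ^ 6 * q ^ 5 - q ^ 6 * p ^ 5)\<^sup>2 = (p ^ 6 * q ^ 10) * (p ^ 4 * (q - p)\<^sup>2)"
      by (simp only: mult_ac)
    have "q ^ 6 * q ^ 6 = q ^ 10 * q\<^sup>2" by (simp flip: power_add)
    then have den: "2 * (2 * p ^ 6) * (2 * q ^ 6) * (4 * q ^ 6) = (p ^ 6 * q ^ 10) * (32 * q\<^sup>2)"
      by simp
    have "p ^ 6 * q ^ 10 \<noteq> 0" using pq by simp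
    then show ?thesis unfolding num den by (simp only: nonzero_mult_divide_mult_cancel_left simp_thms)
  qed
  also have "\<dots> \<le> (p ^ 6 * q ^ 5 - q ^ 6 * p ^ 5)\<^sup>2 / (2 * n p * n q * (n p + n q))"
  proof (intro divide_left_mono mult_mono mult_pos_pos)
    have "p ^ 6 \<le> q ^ 6" using p q by (intro power_mono) auto
    then show "n p + n q \<le> 4 * q ^ 6" using n(1)[OF p] n(1)[OF q1] by simp
  qed (use n[OF p] n[OF q1] pq in auto)
  also have "\<dots> \<le> n p + n q - sqrt ((p ^ 6 + q ^ 6)\<^sup>2 + (p ^ 5 + q ^ 5)\<^sup>2)"
    unfolding n_def using pq by (intro quadrant_product_bound) auto
  finally show ?thesis .
qed

text \<open>
  Both coordinates of the \<open>n\<close>-th point lie on leg number \<open>(n + 1)\<^sup>6\<close>, which is longer than the heights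
  \<open>(n + 1)\<^sup>6\<close> and \<open>(n + 1)\<^sup>5\<close>.
\<close>
definition divergent_slopes :: "nat \<Rightarrow> (real \<times> real) \<times> (real \<times> real)" where
  "divergent_slopes n =
     ((sinh (real (n + 1) ^ 6), real ((n + 1) ^ 6) * pi), (sinh (real (n + 1) ^ 5), real ((n + 1) ^ 6) * pi))"

lemma divergent_slopes_in: "divergent_slopes n \<in> cone star \<times> cone star"
proof -
  have "real (n + 1) ^ 5 \<le> real (n + 1) ^ 6" by (intro power_increasing) auto
  then show ?thesis
    unfolding divergent_slopes_def
    using star_point[of "real (n + 1) ^ 6" "(n + 1) ^ 6"] star_point[of "real (n + 1) ^ 5" "(n + 1) ^ 6"]
    by simp
qed

lemma divergent_slopes_norm:
  "prod_dist cone_dist cone_dist ((0, 0), (0, 0)) (divergent_slopes n)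
    = sqrt ((real (n + 1) ^ 6)\<^sup>2 + (real (n + 1) ^ 5)\<^sup>2)"
  by (simp add: prod_dist_def divergent_slopes_def cone_dist_apex_sinh)

lemma divergent_slopes_dist:
  assumes "m \<noteq> n"
  shows "prod_dist cone_dist cone_dist (divergent_slopes m) (divergent_slopes n)
    = sqrt ((real (m + 1) ^ 6 + real (n + 1) ^ 6)\<^sup>2 + (real (m + 1) ^ 5 + real (n + 1) ^ 5)\<^sup>2)"
proof -
  have "(m + 1) ^ 6 \<noteq> (n + 1) ^ 6" using assms power_inject_base[of "m" 5 "n"] 
    by (metis add_right_cancel power_eq_iff_eq_base zero_le zero_less_numeral)
  then have "real ((m + 1) ^ 6) \<noteq> real ((n + 1) ^ 6)" by (metis of_nat_eq_iff)
  then have ne: "real ((m + 1) ^ 6) * pi \<noteq> real ((n + 1) ^ 6) * pi" by (metis mult_right_cancel pi_neq_zero)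
  show ?thesis
    using divergent_slopes_in[of m] divergent_slopes_in[of n] cone_star_dist[OF _ _ ne]
    unfolding divergent_slopes_def prod_dist_def by (simp add: arsinh_sinh_real)
qed

lemma divergent_slopes_gromov:
  "divergent_slopes \<in> square.Prod_metric.gromov_sequences star star ((0, 0), (0, 0))"
  unfolding square.Prod_metric.gromov_sequences_iff
proof (intro conjI allI)
  show "range divergent_slopes \<subseteq> cone star \<times> cone star" using divergent_slopes_in by blast
  let ?d = "prod_dist cone_dist cone_dist" and ?o = "((0, 0), (0, 0))"
  let ?g = "square.Prod_metric.gromov_product ?o"
  have comm: "?d x ?o = ?d ?o x" for x by (rule square.Prod_metric.commute)
  have lt: "(real (m + 1))\<^sup>2 / 256 \<le> ?g (divergent_slopes m) (divergent_slopes n)" if "m < n" for m n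
    using slope_separation[of "real (m + 1)" "real (n + 1)"] that
    unfolding square.Prod_metric.gromov_product_def comm divergent_slopes_norm
      divergent_slopes_dist[OF less_imp_neq[OF that]] by simp
  have eq: "(real (m + 1))\<^sup>2 / 256 \<le> ?g (divergent_slopes m) (divergent_slopes m)" for m
  proof -
    have "(real (m + 1))\<^sup>2 / 256 \<le> (real (m + 1))\<^sup>2" by simp
    also have "\<dots> \<le> real (m + 1) ^ 6" by (intro power_increasing) auto
    also have "\<dots> \<le> sqrt ((real (m + 1) ^ 6)\<^sup>2 + (real (m + 1) ^ 5)\<^sup>2)" by (rule real_le_rsqrt) simp
    also have "\<dots> = ?g (divergent_slopes m) (divergent_slopes m)"
      using divergent_slopes_in[of m]
      unfolding square.Prod_metric.gromov_product_def comm divergent_slopes_norm by simp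
    finally show ?thesis .
  qed
  have sym: "?g x y = ?g y x" for x y
    by (simp add: square.Prod_metric.gromov_product_def square.Prod_metric.commute)
  fix K :: real
  obtain N :: nat where N: "256 * \<bar>K\<bar> + 1 \<le> N" using real_arch_simple by blast
  have large: "K \<le> (real (m + 1))\<^sup>2 / 256" if "m \<ge> N" for m
  proof -
    have "real N \<le> real m" using that by simp
    then have "256 * K \<le> real (m + 1) * 1" using N abs_ge_self[of K] by simp
    also have "\<dots> \<le> real (m + 1) * real (m + 1)" by (intro mult_left_mono) auto
    finally show ?thesis by (simp add: power2_eq_square)
  qed
  have "K \<le> ?g (divergent_slopes m) (divergent_slopes n)" if "m \<ge> N" "n \<ge> N" for m n
  proof (cases m n rule: linorder_cases)
    case less
    show ?thesis using large[OF that(1)] lt[OF less] by linarith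
  next
    case equal
    show ?thesis using large[OF that(1)] eq[of m] unfolding equal by linarith
  next
    case greater
    show ?thesis using large[OF that(2)] lt[OF greater] sym[of "divergent_slopes m" "divergent_slopes n"] by linarith
  qed
  then show "\<exists>N. \<forall>m\<ge>N. \<forall>n\<ge>N. K \<le> ?g (divergent_slopes m) (divergent_slopes n)" by blast
qed

text \<open>
  The equality case of the triangle inequality in the plane, with componentwise subadditivity instead of
  a sum of vectors.
\<close>
lemma norm_add_eq_imp_parallel:
  fixes a1 b1 a2 b2 a3 b3 m k :: real
  assumes "a1\<^sup>2 + b1\<^sup>2 = m\<^sup>2" "a2\<^sup>2 + b2\<^sup>2 = k\<^sup>2" "a3\<^sup>2 + b3\<^sup>2 = (m + k)\<^sup>2"
    and "0 \<le> a3" "a3 \<le> a1 + a2" "0 \<le> b3" "b3 \<le> b1 + b2" "0 \<le> m" "0 \<le> k"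
  shows "m * a2 = k * a1" "m * b2 = k * b1"
proof -
  have "a3\<^sup>2 \<le> (a1 + a2)\<^sup>2" "b3\<^sup>2 \<le> (b1 + b2)\<^sup>2" using assms by (auto intro: power_mono)
  then have "m * k \<le> a1 * a2 + b1 * b2"
    using assms(1-3) by (simp add: power2_eq_square algebra_simps)
  then have "2 * m * k * (m * k) \<le> 2 * m * k * (a1 * a2 + b1 * b2)" using assms by (intro mult_left_mono) auto
  moreover have "(m * a2 - k * a1)\<^sup>2 + (m * b2 - k * b1)\<^sup>2
    = m\<^sup>2 * (a2\<^sup>2 + b2\<^sup>2) + k\<^sup>2 * (a1\<^sup>2 + b1\<^sup>2) - 2 * m * k * (a1 * a2 + b1 * b2)"
    by (simp add: power2_eq_square algebra_simps)
  ultimately have "(m * a2 - k * a1)\<^sup>2 + (m * b2 - k * b1)\<^sup>2 \<le> 0"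
    unfolding assms(1,2) by (simp add: power2_eq_square algebra_simps)
  then show "m * a2 = k * a1" "m * b2 = k * b1" by (simp_all add: sum_power2_le_zero_iff)
qed

lemma linear_of_proportional:
  fixes f :: "nat \<Rightarrow> nat \<Rightarrow> real"
  assumes prp: "\<And>i j k. i \<le> j \<Longrightarrow> j \<le> k \<Longrightarrow> (real j - real i) * f j k = (real k - real j) * f i j"
    and mn: "m \<le> n"
  shows "f m n = f 0 1 * (real n - real m)"
proof -
  have step: "f j (Suc j) = f 0 1" for j
  proof (induction j)
    case (Suc j)
    then show ?case using prp[of j "Suc j" "Suc (Suc j)"] by simp
  qed simp
  have "f 0 m = f 0 1 * real m" using prp[of 0 m "Suc m"] step[of m] by (simp add: mult.commute)
  then show ?thesis
    using prp[of 0 m n] prp[of 0 n "Suc n"] step[of n] mn by (cases "m = 0") (auto simp: mult_ac)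
qed

text \<open>
  The components of a geodesic in a product are geodesics of constant speed: for three points on the
  geodesic the pairs of component distances are parallel vectors by \<open>norm_add_eq_imp_parallel\<close>.
\<close>
lemma (in Metric_space12) discrete_ray_components:
  assumes "Prod_metric.discrete_ray z"
  obtains c1 c2 where "c1 > 0 \<or> c2 > 0"
    "\<And>m n. m \<le> n \<Longrightarrow> d1 (fst (z m)) (fst (z n)) = c1 * (real n - real m)"
    "\<And>m n. m \<le> n \<Longrightarrow> d2 (snd (z m)) (snd (z n)) = c2 * (real n - real m)"
proof -
  have z: "fst (z n) \<in> M1" "snd (z n) \<in> M2" for n
    using assms unfolding Prod_metric.discrete_ray_def by (auto simp: image_subset_iff mem_Times_iff)
  define f1 f2 where "f1 m n = d1 (fst (z m)) (fst (z n))" and "f2 m n = d2 (snd (z m)) (snd (z n))" for m n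
  have sq: "(f1 m n)\<^sup>2 + (f2 m n)\<^sup>2 = (real n - real m)\<^sup>2" if "m \<le> n" for m n
  proof -
    have "sqrt ((f1 m n)\<^sup>2 + (f2 m n)\<^sup>2) = \<bar>real m - real n\<bar>"
      using assms unfolding Prod_metric.discrete_ray_def
      by (simp add: prod_dist_def case_prod_unfold f1_def f2_def)
    then have "(f1 m n)\<^sup>2 + (f2 m n)\<^sup>2 = \<bar>real m - real n\<bar>\<^sup>2"
      by (metis real_sqrt_pow2 sum_power2_ge_zero)
    then show ?thesis by (simp add: power2_commute)
  qed
  have tri: "f1 i k \<le> f1 i j + f1 j k" "f2 i k \<le> f2 i j + f2 j k" for i j k
    using M1.triangle[OF z(1) z(1) z(1)] M2.triangle[OF z(2) z(2) z(2)] by (simp_all add: f1_def f2_def)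
  have prp: "(real j - real i) * f1 j k = (real k - real j) * f1 i j \<and>
    (real j - real i) * f2 j k = (real k - real j) * f2 i j" if ij: "i \<le> j" "j \<le> k" for i j k
  proof -
    have "(f1 i k)\<^sup>2 + (f2 i k)\<^sup>2 = ((real j - real i) + (real k - real j))\<^sup>2" using sq[of i k] ij by simp
    from norm_add_eq_imp_parallel[OF sq[OF ij(1)] sq[OF ij(2)] this _ tri(1) _ tri(2)]
    show ?thesis using ij by (simp add: f1_def f2_def)
  qed
  have lin: "f1 m n = f1 0 1 * (real n - real m)" "f2 m n = f2 0 1 * (real n - real m)" if "m \<le> n" for m n
    using linear_of_proportional[of f1, OF _ that] linear_of_proportional[of f2, OF _ that] prp by auto
  have "(f1 0 1)\<^sup>2 + (f2 0 1)\<^sup>2 = 1" using sq[of 0 1] by simp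
  then have "f1 0 1 \<noteq> 0 \<or> f2 0 1 \<noteq> 0" by auto
  moreover have "f1 0 1 \<ge> 0" "f2 0 1 \<ge> 0" by (simp_all add: f1_def f2_def)
  ultimately have "f1 0 1 > 0 \<or> f2 0 1 > 0" by auto
  then show ?thesis using that[of "f1 0 1" "f2 0 1"] lin unfolding f1_def f2_def by blast
qed

lemma star_square_no_discrete_ray: "\<not> square.Prod_metric.discrete_ray star star z"
proof
  interpret hedgehog "cone star" cone_dist "(0, 0)" snd by (rule star_hedgehog)
  assume z: "square.Prod_metric.discrete_ray star star z"
  then have M: "fst (z n) \<in> cone star" "snd (z n) \<in> cone star" for n
    unfolding square.Prod_metric.discrete_ray_def by (auto simp: image_subset_iff mem_Times_iff)
  obtain c1 c2 where c: "c1 > 0 \<or> c2 > 0"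
    "\<And>m n. m \<le> n \<Longrightarrow> cone_dist (fst (z m)) (fst (z n)) = c1 * (real n - real m)"
    "\<And>m n. m \<le> n \<Longrightarrow> cone_dist (snd (z m)) (snd (z n)) = c2 * (real n - real m)"
    using square.discrete_ray_components[OF z] by blast
  show False
    using c(1)
  proof
    assume "c1 > 0"
    then show False using no_linear_sequence[of "\<lambda>n. fst (z n)" c1] M(1) c(2) by blast
  next
    assume "c2 > 0"
    then show False using no_linear_sequence[of "\<lambda>n. snd (z n)" c2] M(2) c(3) by blast
  qed
qed

section \<open>A flat quarter plane\<close>

definition half_line :: "(real \<times> real) set" where "half_line = {(r, t). t = 0}"

lemma closed_half_line: "closed half_line"
  unfolding half_line_def case_prod_unfold by (intro closed_Collect_eq continuous_intros)

lemma cone_convex_half_line: "cone_convex half_line"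
  by (auto simp: cone_convex_def half_line_def)

lemma half_line_point: "0 \<le> r \<Longrightarrow> (sinh r, 0) \<in> cone half_line"
  by (simp add: cone_def half_line_def)

definition ray1 :: "real \<Rightarrow> (real \<times> real) \<times> (real \<times> real)" where
  "ray1 = (\<lambda>t\<in>{0..}. ((sinh t, 0), (0, 0)))"

definition ray2 :: "real \<Rightarrow> (real \<times> real) \<times> (real \<times> real)" where
  "ray2 = (\<lambda>t\<in>{0..}. ((0, 0), (sinh t, 0)))"

lemma apex_dist_self [simp]: "cone_dist (0, 0) (0, 0) = 0"
  using cone_dist_apex_sinh[of 0 0 0] by simp

lemma cone_dist_sinh_apex: "0 \<le> a \<Longrightarrow> cone_dist (sinh a, t) (0, s) = a"
  by (simp add: cone_dist_commute[of _ "(0, s)"] cone_dist_apex_sinh)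

lemma quarter_plane_rays:
  "ray1 \<in> square.Prod_metric.geodesic_rays half_line half_line"
  "ray2 \<in> square.Prod_metric.geodesic_rays half_line half_line"
  unfolding square.Prod_metric.geodesic_rays_def ray1_def ray2_def
  by (auto simp: prod_dist_def cone_dist_radial half_line_point apex_in_cone)

lemma quarter_plane_rays_dist:
  assumes "0 \<le> s" "0 \<le> t"
  shows "prod_dist cone_dist cone_dist (ray1 s) (ray2 t) = sqrt (s\<^sup>2 + t\<^sup>2)"
  using assms by (simp add: ray1_def ray2_def prod_dist_def cone_dist_apex_sinh cone_dist_sinh_apex)

lemma quarter_plane_rays_not_asymptotic: "(ray1, ray2) \<notin> square.Prod_metric.asymptotic half_line half_line"
proof
  assume "(ray1, ray2) \<in> square.Prod_metric.asymptotic half_line half_line"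
  then obtain C where "\<And>t. 0 \<le> t \<Longrightarrow> sqrt (t\<^sup>2 + t\<^sup>2) \<le> C"
    unfolding square.Prod_metric.asymptotic_def using quarter_plane_rays_dist by auto
  moreover have "\<bar>C\<bar> + 1 \<le> sqrt ((\<bar>C\<bar> + 1)\<^sup>2 + (\<bar>C\<bar> + 1)\<^sup>2)" by (rule real_le_rsqrt) simp
  ultimately show False by (smt (verit))
qed

lemma quarter_plane_rays_gromov_E:
  "((\<lambda>n. ray1 (real n)), (\<lambda>n. ray2 (real n))) \<in> square.Prod_metric.gromov_E half_line half_line ((0, 0), (0, 0))"
proof -
  let ?o = "((0, 0), (0, 0))"
  have o: "?o \<in> cone half_line \<times> cone half_line" by (simp add: apex_in_cone)
  have seq: "(\<lambda>n. \<gamma> (real n)) \<in> square.Prod_metric.gromov_sequences half_line half_line ?o" if "\<gamma> \<in> square.Prod_metric.geodesic_rays half_line half_line" for \<gamma>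
  proof -
    have "(\<gamma>, \<gamma>) \<in> square.Prod_metric.asymptotic half_line half_line" using that square.Prod_metric.equiv_asymptotic by (auto simp: equiv_def refl_on_def)
    then have "((\<lambda>n. \<gamma> (real n)), (\<lambda>n. \<gamma> (real n))) \<in> square.Prod_metric.gromov_E half_line half_line ?o"
      using o by (intro square.Prod_metric.asymptotic_rays_gromov_E filterlim_real_sequentially) auto
    then show ?thesis by (simp add: square.Prod_metric.gromov_E_iff)
  qed
  have prod: "square.Prod_metric.gromov_product ?o (ray1 s) (ray2 t) = (s + t - sqrt (s\<^sup>2 + t\<^sup>2)) / 2" if "0 \<le> s" "0 \<le> t" for s t
    using that quarter_plane_rays_dist[OF that]
    by (simp add: square.Prod_metric.gromov_product_def) (simp add: ray1_def ray2_def prod_dist_def cone_dist_sinh_apex)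
  have "\<exists>N. \<forall>m\<ge>N. \<forall>n\<ge>N. K \<le> square.Prod_metric.gromov_product ?o (ray1 (real m)) (ray2 (real n))" for K
  proof -
    obtain N :: nat where N: "4 * \<bar>K\<bar> + 1 \<le> N" using real_arch_simple by blast
    have "K \<le> square.Prod_metric.gromov_product ?o (ray1 (real m)) (ray2 (real n))" if mn: "m \<ge> N" "n \<ge> N" for m n
    proof -
      define s t where "s = real m" and "t = real n"
      have st: "4 * \<bar>K\<bar> \<le> s" "4 * \<bar>K\<bar> \<le> t" "0 < s" "0 < t" using N mn by (auto simp: s_def t_def)
      \<comment> \<open>Here 4 |K| (s + t) is at most 2 s t because s and t are at least 4 |K|.\<close>
      have "(s\<^sup>2 + t\<^sup>2) \<le> (s + t - 2 * \<bar>K\<bar>)\<^sup>2"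
      proof -
        have "2 * \<bar>K\<bar> * s \<le> (t / 2) * s" "2 * \<bar>K\<bar> * t \<le> (s / 2) * t"
          using st by (intro mult_right_mono; simp)+
        then have "4 * \<bar>K\<bar> * (s + t) \<le> 2 * s * t" by (simp add: algebra_simps)
        moreover have "(s + t - 2 * \<bar>K\<bar>)\<^sup>2 = s\<^sup>2 + t\<^sup>2 + 2 * s * t - 4 * \<bar>K\<bar> * (s + t) + 4 * \<bar>K\<bar>\<^sup>2"
          by (simp add: power2_eq_square algebra_simps)
        ultimately show ?thesis by (smt (verit) zero_le_power2)
      qed
      then have "sqrt (s\<^sup>2 + t\<^sup>2) \<le> s + t - 2 * \<bar>K\<bar>" using st by (intro real_le_lsqrt) auto
      then show ?thesis using prod[of s t] st by (simp add: s_def t_def)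
    qed
    then show ?thesis by blast
  qed
  then show ?thesis
    unfolding square.Prod_metric.gromov_E_iff using seq quarter_plane_rays by blast
qed

section \<open>The two spaces\<close>

text \<open>
  Interleaving of sequences; it embeds the wedge, whose points consist of twelve real numbers, into the
  real sequences.
\<close>
definition pair_code :: "('a \<Rightarrow> nat \<Rightarrow> real) \<Rightarrow> ('b \<Rightarrow> nat \<Rightarrow> real) \<Rightarrow> 'a \<times> 'b \<Rightarrow> nat \<Rightarrow> real" where
  "pair_code f g = (\<lambda>(x, y) n. if even n then f x (n div 2) else g y (n div 2))"

lemma inj_pair_code:
  assumes "inj f" "inj g" shows "inj (pair_code f g)"
proof (rule injI)
  fix p q assume eq: "pair_code f g p = pair_code f g q"
  obtain x y x' y' where pq: "p = (x, y)" "q = (x', y')" by (cases p, cases q)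
  have "f x n = f x' n" "g y n = g y' n" for n
    using fun_cong[OF eq, of "2 * n"] fun_cong[OF eq, of "2 * n + 1"] by (auto simp: pq pair_code_def)
  then have "f x = f x'" "g y = g y'" by auto
  then show "p = q" using assms by (auto simp: pq dest: injD)
qed

lemma inj_code_real_pair: "\<exists>f :: real \<times> real \<Rightarrow> nat \<Rightarrow> real. inj f"
proof -
  have "inj (\<lambda>(x::real) (n::nat). x)" by (rule injI) (metis)
  then have "inj (pair_code (\<lambda>(x::real) (n::nat). x) (\<lambda>(x::real) (n::nat). x))"
    by (intro inj_pair_code)
  then show ?thesis by (intro exI)
qed

lemma inj_code_pair:
  assumes "\<exists>f :: 'a \<Rightarrow> nat \<Rightarrow> real. inj f" "\<exists>g :: 'b \<Rightarrow> nat \<Rightarrow> real. inj g"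
  shows "\<exists>h :: 'a \<times> 'b \<Rightarrow> nat \<Rightarrow> real. inj h"
proof -
  obtain f :: "'a \<Rightarrow> nat \<Rightarrow> real" and g :: "'b \<Rightarrow> nat \<Rightarrow> real" where "inj f" "inj g"
    using assms by blast
  then have "inj (pair_code f g)" by (rule inj_pair_code)
  then show ?thesis by (intro exI)
qed

lemma hedgehog_pull_dist:
  assumes "hedgehog N e q leg" "inj_on f N"
  shows "hedgehog (f ` N) (pull_dist N f e) (f q) (\<lambda>x. leg (inv_into N f x))"
proof -
  interpret hedgehog N e q leg by fact
  show ?thesis
  proof (intro hedgehog.intro hedgehog_axioms.intro Metric_space_pull_dist Metric_space_axioms assms(2))
    show "f q \<in> f ` N" using centre by blast
    fix i
    obtain B where "\<forall>x\<in>N. leg x = i \<longrightarrow> e q x \<le> B" using legs_bounded by blast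
    then show "\<exists>B. \<forall>x\<in>f ` N. leg (inv_into N f x) = i \<longrightarrow> pull_dist N f e (f q) x \<le> B"
      using assms(2) centre by (auto simp: pull_dist_def)
  qed (use assms(2) centre legs_apart in \<open>auto simp: pull_dist_def\<close>)
qed

lemma complete_CAT0_pull_dist:
  assumes N: "Metric_space N e" and f: "inj_on f N"
    and "Metric_space.cn_space N e" "Metric_space.mcomplete N e"
  shows "Metric_space.cn_space (f ` N) (pull_dist N f e)" "Metric_space.mcomplete (f ` N) (pull_dist N f e)"
    "Metric_space.complete_CAT0 (f ` N) (pull_dist N f e)"
proof -
  interpret P: Metric_space "f ` N" "pull_dist N f e" by (rule Metric_space_pull_dist[OF N f])
  show cn: P.cn_space and c: P.mcomplete
    using isometric_image[OF N P.Metric_space_axioms pull_dist_image[OF f]] assms(3,4) by auto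
  show P.complete_CAT0 unfolding P.complete_CAT0_def using c P.cn_imp_CAT0[OF cn] by blast
qed

lemma (in Metric_space) not_mbounded:
  assumes "p \<in> M" "\<And>n. \<exists>x\<in>M. real n \<le> d p x"
  shows "\<not> mbounded M"
proof
  assume "mbounded M"
  then obtain a B where "M \<subseteq> mcball a B" unfolding mbounded_def by blast
  then have B: "a \<in> M" "d a x \<le> B" if "x \<in> M" for x using that by auto
  obtain n :: nat where n: "d p a + B < n" using reals_Archimedean2 by blast
  obtain x where x: "x \<in> M" "real n \<le> d p x" using assms(2) by blast
  show False using triangle[OF assms(1) B(1)[OF x(1)] x(1)] B(2)[OF x(1)] x(2) n by linarith
qed

lemma unbounded_space_without_boundaries:
  "\<exists>(Y :: (nat \<Rightarrow> real) set) d.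
      Metric_space Y d \<and> Metric_space.complete_CAT0 Y d \<and> \<not> Metric_space.mbounded Y d Y \<and>
      Metric_space.ideal_boundary Y d = {} \<and>
      (\<forall>b\<in>Y. Metric_space.gromov_boundary Y d b = {} \<and> Metric_space.end_boundary Y d b = {})"
proof -
  obtain f :: "real \<times> real \<Rightarrow> nat \<Rightarrow> real" where f: "inj_on f (cone star)"
    using inj_code_real_pair inj_on_subset by blast
  define Y d where "Y = f ` cone star" and "d = pull_dist (cone star) f cone_dist"
  interpret Y: hedgehog Y d "f (0, 0)" "\<lambda>x. snd (inv_into (cone star) f x)"
    unfolding Y_def d_def by (rule hedgehog_pull_dist[OF star_hedgehog f])
  have "Y.complete_CAT0"
    using complete_CAT0_pull_dist(3)[OF Metric_space_cone f cn_space_cone[OF cone_convex_star]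
        mcomplete_cone[OF closed_star]] unfolding Y_def d_def .
  moreover have "\<not> Y.mbounded Y"
  proof (rule Y.not_mbounded[OF Y.centre])
    fix n
    have x: "(sinh (real (n + 1)), real (n + 1) * pi) \<in> cone star" by (rule star_point) auto
    then have "d (f (0, 0)) (f (sinh (real (n + 1)), real (n + 1) * pi)) = real (n + 1)"
      unfolding d_def by (subst pull_dist_image[OF f apex_in_cone]) (auto intro!: cone_dist_apex_sinh)
    then show "\<exists>x\<in>Y. real n \<le> d (f (0, 0)) x" using x unfolding Y_def by force
  qed
  moreover have "Y.gromov_boundary b = {}" if "b \<in> Y" for b
    using Y.gromov_sequences_rebase[OF Y.centre that] Y.no_gromov_sequence
    unfolding Y.gromov_boundary_def by simp
  ultimately show ?thesis
    using Y.Metric_space_axioms Y.ideal_boundary_empty Y.end_boundary_empty by blast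
qed

text \<open>
  A wedge of wedges: \<open>WA\<close> is made of the sector and the spiral, \<open>WB\<close> of the product of hedgehogs and the
  quarter plane. The base point of every wedge is the apex \<open>v\<close> in all coordinates, so each of the four
  pieces is a branch of the whole space at the same point.
\<close>
lemma space_with_neither_inj_nor_surj_maps:
  "\<exists>(X :: (nat \<Rightarrow> real) set) d.
      Metric_space X d \<and> X \<noteq> {} \<and> Metric_space.complete_CAT0 X d \<and>
      (\<forall>b\<in>X.
         neither_inj_nor_surj (Metric_space.nu X d b)
           (Metric_space.ideal_boundary X d) (Metric_space.gromov_boundary X d b) \<and>
         neither_inj_nor_surj (Metric_space.phi X d b)
           (Metric_space.gromov_boundary X d b) (Metric_space.end_boundary X d b) \<and>
         neither_inj_nor_surj (Metric_space.eps X d b)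
           (Metric_space.ideal_boundary X d) (Metric_space.end_boundary X d b))"
proof -
  define v :: "real \<times> real" where "v = (0, 0)"
  have v: "v \<in> cone Z" for Z by (simp add: v_def apex_in_cone)
  note cone = Metric_space_cone
  have cn: "cone.cn_space sector" "cone.cn_space spiral" "cone.cn_space star" "cone.cn_space half_line"
    by (intro cn_space_cone cone_convex_sector cone_convex_spiral cone_convex_star cone_convex_half_line)+
  have complete: "cone.mcomplete sector" "cone.mcomplete spiral" "cone.mcomplete star" "cone.mcomplete half_line"
    by (intro mcomplete_cone closed_sector closed_spiral closed_star closed_half_line)+
  define pd where "pd = prod_dist cone_dist cone_dist"
  interpret A: wedge_space "cone sector" cone_dist "cone spiral" cone_dist v v
    by (intro wedge_space.intro wedge_space_axioms.intro Metric_space12.intro cone v)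
  interpret B: wedge_space "cone star \<times> cone star" pd "cone half_line \<times> cone half_line" pd "(v, v)" "(v, v)"
    unfolding pd_def
    by (intro wedge_space.intro wedge_space_axioms.intro Metric_space12.intro
        square.Prod_metric.Metric_space_axioms SigmaI v)
  define WA WB where "WA = wedge (cone sector) v (cone spiral) v"
    and "WB = wedge (cone star \<times> cone star) (v, v) (cone half_line \<times> cone half_line) (v, v)"
  define dA dB where "dA = wedge_dist cone_dist cone_dist" and "dB = wedge_dist pd pd"
  interpret W: wedge_space WA dA WB dB "(v, v)" "((v, v), (v, v))"
    unfolding WA_def WB_def dA_def dB_def
  proof (intro wedge_space.intro wedge_space_axioms.intro Metric_space12.intro
      A.W.Metric_space_axioms B.W.Metric_space_axioms)
    show "(v, v) \<in> wedge (cone sector) v (cone spiral) v" using v by (auto simp: wedge_def)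
    show "((v, v), (v, v)) \<in> wedge (cone star \<times> cone star) (v, v) (cone half_line \<times> cone half_line) (v, v)"
      using v by (auto simp: wedge_def)
  qed
  define W where "W = wedge WA (v, v) WB ((v, v), (v, v))"
  define dW where "dW = wedge_dist dA dB"
  have "square.Prod_metric.cn_space star star" "square.Prod_metric.cn_space half_line half_line"
    by (intro square.cn_space_prod cn)+
  then have B: "B.W.cn_space" unfolding pd_def by (intro B.cn_space_wedge[unfolded pd_def])
  have "square.Prod_metric.mcomplete star star" "square.Prod_metric.mcomplete half_line half_line"
    using complete by (simp_all add: square.mcomplete_prod_metric)
  then have B': "B.W.mcomplete" unfolding pd_def by (intro B.mcomplete_wedge[unfolded pd_def])
  have A: "A.W.cn_space" "A.W.mcomplete"
    by (intro A.cn_space_wedge A.mcomplete_wedge cn complete)+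
  have WMS: "Metric_space W dW" unfolding W_def dW_def by (rule W.W.Metric_space_axioms)
  have Wcn: "Metric_space.cn_space W dW" "Metric_space.mcomplete W dW"
    using W.cn_space_wedge W.mcomplete_wedge A B B'
    unfolding W_def dW_def WA_def WB_def dA_def dB_def by blast+
  define p where "p = ((v, v), ((v, v), (v, v)))"
  have pW: "p \<in> W" using W.base by (auto simp: W_def p_def wedge_def)
  have branchA: "branch WA dA W dW (\<lambda>x. (x, ((v, v), (v, v)))) (v, v)"
    and branchB: "branch WB dB W dW (\<lambda>y. ((v, v), y)) ((v, v), (v, v))"
    unfolding W_def dW_def by (rule W.wedge_branch1 W.wedge_branch2)+
  note branches = A.wedge_branch1 A.wedge_branch2 B.wedge_branch1 B.wedge_branch2
  note branches = branches[folded WA_def WB_def dA_def dB_def]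
  obtain f :: "((real \<times> real) \<times> (real \<times> real)) \<times>
      (((real \<times> real) \<times> (real \<times> real)) \<times> ((real \<times> real) \<times> (real \<times> real))) \<Rightarrow> nat \<Rightarrow> real"
    where f: "inj_on f W"
    using inj_code_pair[OF inj_code_pair[OF inj_code_real_pair inj_code_real_pair]
        inj_code_pair[OF inj_code_pair[OF inj_code_real_pair inj_code_real_pair]
          inj_code_pair[OF inj_code_real_pair inj_code_real_pair]]] inj_on_subset by blast
  define X d where "X = f ` W" and "d = pull_dist W f dW"
  have fX: "branch W dW X d f p" unfolding X_def d_def by (rule branch_of_isometry[OF WMS f pW])
  have X: "Metric_space X d" unfolding X_def d_def by (rule Metric_space_pull_dist[OF WMS f])
  have Xcn: "Metric_space.cn_space X d" "Metric_space.mcomplete X d" "Metric_space.complete_CAT0 X d"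
    unfolding X_def d_def by (rule complete_CAT0_pull_dist[OF WMS f Wcn])+
  have "branch (cone sector) cone_dist X d (\<lambda>x. f ((x, v), ((v, v), (v, v)))) v"
    by (rule branch_comp[OF branch_comp[OF branches(1) branchA] fX]) (simp_all add: p_def)
  moreover have "branch (cone spiral) cone_dist X d (\<lambda>x. f ((v, x), ((v, v), (v, v)))) v"
    by (rule branch_comp[OF branch_comp[OF branches(2) branchA] fX]) (simp_all add: p_def)
  moreover have "branch (cone star \<times> cone star) pd X d (\<lambda>x. f ((v, v), (x, (v, v)))) (v, v)"
    by (rule branch_comp[OF branch_comp[OF branches(3) branchB] fX]) (simp_all add: p_def)
  moreover have "branch (cone half_line \<times> cone half_line) pd X d (\<lambda>x. f ((v, v), ((v, v), x))) (v, v)"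
    by (rule branch_comp[OF branch_comp[OF branches(4) branchB] fX]) (simp_all add: p_def)
  ultimately have
    "neither_inj_nor_surj (Metric_space.nu X d b)
           (Metric_space.ideal_boundary X d) (Metric_space.gromov_boundary X d b)"
    "neither_inj_nor_surj (Metric_space.phi X d b)
           (Metric_space.gromov_boundary X d b) (Metric_space.end_boundary X d b)"
    "neither_inj_nor_surj (Metric_space.eps X d b)
           (Metric_space.ideal_boundary X d) (Metric_space.end_boundary X d b)" if "b \<in> X" for b
    using neither_inj_nor_surj_of_branches[OF X Xcn(1,2) that,
        of "cone half_line \<times> cone half_line" pd _ "(v, v)" "f p" ray1 ray2
          "cone star \<times> cone star" pd _ "(v, v)" divergent_slopes
          "cone sector" cone_dist _ v "\<lambda>n. (sinh (real n + 1), 0)" "\<lambda>n. (sinh (real n + 1), 1)"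
          "cone spiral" cone_dist _ v "\<lambda>n. (exp (real n), real n)"]
      quarter_plane_rays quarter_plane_rays_not_asymptotic quarter_plane_rays_gromov_E
      divergent_slopes_gromov star_square_no_discrete_ray
      radial_gromov_sequence[of 0 sector] radial_gromov_sequence[of 1 sector]
      sector_same_end sector_not_equivalent
      spiral_in_cone spiral_same_end spiral_no_gromov_sequence
    unfolding pd_def v_def p_def by (auto simp: sector_def)
  then show ?thesis using X Xcn(3) pW unfolding X_def by blast
qed

theorem theorem1p1:
  shows "(\<exists>(X :: (nat \<Rightarrow> real) set) d.
            Metric_space X d \<and> X \<noteq> {} \<and> Metric_space.complete_CAT0 X d \<and>
            (\<forall>b\<in>X.
               neither_inj_nor_surj (Metric_space.nu X d b)
                 (Metric_space.ideal_boundary X d) (Metric_space.gromov_boundary X d b) \<and>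
               neither_inj_nor_surj (Metric_space.phi X d b)
                 (Metric_space.gromov_boundary X d b) (Metric_space.end_boundary X d b) \<and>
               neither_inj_nor_surj (Metric_space.eps X d b)
                 (Metric_space.ideal_boundary X d) (Metric_space.end_boundary X d b)))
       \<and> (\<exists>(Y :: (nat \<Rightarrow> real) set) d.
            Metric_space Y d \<and> Metric_space.complete_CAT0 Y d \<and>
            \<not> Metric_space.mbounded Y d Y \<and>
            Metric_space.ideal_boundary Y d = {} \<and>
            (\<forall>b\<in>Y. Metric_space.gromov_boundary Y d b = {} \<and>
                   Metric_space.end_boundary Y d b = {}))"
  using space_with_neither_inj_nor_surj_maps unbounded_space_without_boundaries by blast

end
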